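(* Let $(A,\{\cdot,\cdot\})$ be a polynomial Poisson algebra over a field of characteristic $0$, with basis $\{x_i\}_{i\in\mathcal I}$ and $X_{ij}=\{x_i,x_j\}$, and let $\pi_\star=\pi+h\pi_1+h^2\pi_2+h^3\pi_3$ be the explicit third order deformation of $A$ given in the context. Then $\pi_\star$ extends to a fourth, hence fifth, order deformation if and only if the following condition is satisfied for all $\alpha<\beta<\gamma$ in $\mathcal I$: $$\begin{aligned} &2X_{ij}X_{kl}^i\big(X_{\alpha\beta}^{km}X_{\gamma m}^{jl}+X_{\beta\gamma}^{km}X_{\alpha m}^{jl}+X_{\gamma\alpha}^{km}X_{\beta m}^{jl}\big)\\ &+X_{ij}X_{kl}\big(X_{\alpha\beta}^{ikm}X_{\gamma m}^{jl}+X_{\beta\gamma}^{ikm}X_{\alpha m}^{jl}+X_{\gamma\alpha}^{ikm}X_{\beta m}^{jl}\big)=0. \end{aligned}$$ This condition is non-trivial (it is not satisfied by every polynomial Poisson algebra).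
   Context: $A=\mathbb F[x_i]_{i\in\mathcal I}$, $\mathcal I$ totally ordered, with product $\pi$; a Poisson bracket is an antisymmetric biderivation satisfying the Jacobi identity. Repeated Latin indices are summed over $\mathcal I$. Superscripts denote partial derivatives: $\partial^i=\partial/\partial x_i$, $\partial^{ij\cdots}=\partial^i\partial^j\cdots$, $X_{ij}^{kl\cdots}=\partial^{kl\cdots}X_{ij}$; and $(p\,\partial^I\otimes\partial^J)(f,g)=p\,\partial^I(f)\,\partial^J(g)$. The explicit third order deformation is $$\begin{aligned} \pi_\star=\pi&+\frac h2X_{ij}\partial^i\otimes\partial^j+\frac{h^2}{24}\Big[2X_{ij}^lX_{lk}(\partial^i\otimes\partial^{jk}+\partial^{jk}\otimes\partial^i)+3X_{ij}X_{kl}\partial^{ik}\otimes\partial^{jl}\Big]\\ &+\frac{h^3}{48}\Big[2X_{ij}X_{kl}^iX_{mn}^{jk}(\partial^n\otimes\partial^{lm}-\partial^{lm}\otimes\partial^n)+X_{ij}X_{kl}X_{mn}\partial^{ikm}\otimes\partial^{jln}\\ &\qquad+X_{lm}^kX_{jn}^lX_{ki}(\partial^{mn}\otimes\partial^{ij}-\partial^{ij}\otimes\partial^{mn})+X_{mn}^{kl}X_{lj}X_{ki}(\partial^m\otimes\partial^{nij}-\partial^{nij}\otimes\partial^m)\\ &\qquad+2X_{ij}^kX_{kl}X_{mn}(\partial^{jlm}\otimes\partial^{in}-\partial^{in}\otimes\partial^{jlm})\Big]. \end{aligned}$$ An $n$-th order deformation of $A$ is a product $\pi+h\pi_1+\cdots+h^n\pi_n$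 on $A[[h]]$, where the $\pi_i:A\times A\to A$ are $\mathbb F$-bilinear maps extended $\mathbb F[[h]]$-bilinearly, which is associative modulo $h^{n+1}$. It extends to order $m>n$ if there are bilinear maps $\pi_{n+1},\dots,\pi_m:A\times A\to A$ such that $\pi+h\pi_1+\cdots+h^m\pi_m$ is an $m$-th order deformation. *)

theory Defs
  imports
    "HOL-Library.Poly_Mapping"
    "HOL-Computational_Algebra.Formal_Power_Series"
begin

section \<open>Polynomial algebras\<close>

text \<open>The polynomial algebra over \<open>'a\<close> in the (possibly infinitely many) variables indexed by
  \<open>'i\<close>: finitely supported functions from monomials \<open>'i \<Rightarrow>\<^sub>0 nat\<close> to coefficients,
  with the convolution product.\<close>

type_synonym ('i, 'a) mpoly = "('i \<Rightarrow>\<^sub>0 nat) \<Rightarrow>\<^sub>0 'a"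

definition var :: "'i \<Rightarrow> ('i, 'a::field_char_0) mpoly" where
  "var i = Poly_Mapping.single (Poly_Mapping.single i 1) 1"

definition scale :: "'a::field_char_0 \<Rightarrow> ('i, 'a) mpoly \<Rightarrow> ('i, 'a) mpoly" where
  "scale c p = Poly_Mapping.single 0 c * p"

lemma vector_space_scale: "vector_space scale"
  by unfold_locales
    (simp_all add: scale_def algebra_simps single_add mult_single flip: mult.assoc)

text \<open>The truncated subtraction \<open>m - single i 1\<close> is harmless: the coefficient vanishes if
  \<open>x\<^sub>i\<close> does not occur in the monomial \<open>m\<close>.\<close>

definition pderiv_var :: "'i \<Rightarrow> ('i, 'a::field_char_0) mpoly \<Rightarrow> ('i, 'a) mpoly" where
  "pderiv_var i p =
     (\<Sum>m\<in>Poly_Mapping.keys p.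
        Poly_Mapping.single (m - Poly_Mapping.single i 1)
          (of_nat (Poly_Mapping.lookup m i) * Poly_Mapping.lookup p m))"

definition pderivs :: "'i list \<Rightarrow> ('i, 'a::field_char_0) mpoly \<Rightarrow> ('i, 'a) mpoly"
    (\<open>\<partial>\<close>) where
  "\<partial> ks p = foldr pderiv_var ks p"

section \<open>Poisson brackets\<close>

type_synonym ('i, 'a) binop = "('i, 'a) mpoly \<Rightarrow> ('i, 'a) mpoly \<Rightarrow> ('i, 'a) mpoly"

definition bilinear_map :: "('i, 'a::field_char_0) binop \<Rightarrow> bool" where
  "bilinear_map B \<longleftrightarrow>
     (\<forall>f. Vector_Spaces.linear scale scale (B f)) \<and>
     (\<forall>g. Vector_Spaces.linear scale scale (\<lambda>f. B f g))"

definition biderivation :: "('i, 'a::field_char_0) binop \<Rightarrow> bool" where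
  "biderivation B \<longleftrightarrow> bilinear_map B \<and>
     (\<forall>f g h. B f (g * h) = B f g * h + g * B f h) \<and>
     (\<forall>f g h. B (f * g) h = B f h * g + f * B g h)"

definition poisson_bracket :: "('i, 'a::field_char_0) binop \<Rightarrow> bool" where
  "poisson_bracket B \<longleftrightarrow> biderivation B \<and>
     (\<forall>f g. B f g = - B g f) \<and>
     (\<forall>f g h. B f (B g h) + B g (B h f) + B h (B f g) = 0)"

text \<open>\<open>X B i j [k, l, \<dots>]\<close> is the partial derivative \<open>\<partial>\<^sup>k\<partial>\<^sup>l\<dots> X\<^sub>i\<^sub>j\<close> of
  \<open>X\<^sub>i\<^sub>j = B x\<^sub>i x\<^sub>j\<close>.\<close>

definition X :: "('i, 'a::field_char_0) binop \<Rightarrow> 'i \<Rightarrow> 'i \<Rightarrow> 'i list \<Rightarrow> ('i, 'a) mpoly" where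
  "X B i j ks = \<partial> ks (B (var i) (var j))"

section \<open>Deformations\<close>

text \<open>The \<open>h\<close>-adically continuous bilinear extension of a bilinear map from \<open>A\<close> to \<open>A[[h]]\<close>;
  \<open>h\<close> is \<^const>\<open>fps_X\<close>.\<close>

definition extend_fps ::
  "('i, 'a::field_char_0) binop \<Rightarrow>
     ('i, 'a) mpoly fps \<Rightarrow> ('i, 'a) mpoly fps \<Rightarrow> ('i, 'a) mpoly fps" where
  "extend_fps B F G = Abs_fps (\<lambda>n. \<Sum>j\<le>n. B (fps_nth F j) (fps_nth G (n - j)))"

definition deformed_product ::
  "nat \<Rightarrow> (nat \<Rightarrow> ('i, 'a::field_char_0) binop) \<Rightarrow>
     ('i, 'a) mpoly fps \<Rightarrow> ('i, 'a) mpoly fps \<Rightarrow> ('i, 'a) mpoly fps" where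
  "deformed_product n ps F G = (\<Sum>i\<le>n. fps_X ^ i * extend_fps (ps i) F G)"

definition deformation :: "nat \<Rightarrow> (nat \<Rightarrow> ('i, 'a::field_char_0) binop) \<Rightarrow> bool" where
  "deformation n ps \<longleftrightarrow>
     ps 0 = (*) \<and>
     (\<forall>i\<le>n. bilinear_map (ps i)) \<and>
     (\<forall>F G H. fps_X ^ (n + 1) dvd
        deformed_product n ps (deformed_product n ps F G) H
        - deformed_product n ps F (deformed_product n ps G H))"

text \<open>Only the terms \<open>ps i\<close> with \<open>i \<le> n\<close> are relevant here.\<close>

definition extends_to_order ::
  "nat \<Rightarrow> nat \<Rightarrow> (nat \<Rightarrow> ('i, 'a::field_char_0) binop) \<Rightarrow> bool" where
  "extends_to_order n m ps \<longleftrightarrow> (\<exists>qs. (\<forall>i\<le>n. qs i = ps i) \<and> deformation m qs)"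

section \<open>The explicit third order deformation\<close>

text \<open>Summation over repeated indices. If there are infinitely many variables, every sum below
  still has only finitely many nonzero terms, since a polynomial involves finitely many variables
  and since each index occurs as a derivative; so \<^const>\<open>Sum_any\<close> (which is \<open>0\<close>
  on infinite support) gives the intended value, also when iterated.\<close>

notation Sum_any (binder \<open>\<Sum>\<^sub>*\<close> 10)

definition star1 :: "('i, 'a::field_char_0) binop \<Rightarrow> ('i, 'a) binop" where
  "star1 B f g = scale (1/2) (\<Sum>\<^sub>*i j. X B i j [] * \<partial> [i] f * \<partial> [j] g)"

definition star2 :: "('i, 'a::field_char_0) binop \<Rightarrow> ('i, 'a) binop" where
  "star2 B f g = scale (1/24)
    (2 * (\<Sum>\<^sub>*i j k l. X B i j [l] * X B l k [] *
            (\<partial> [i] f * \<partial> [j, k] g + \<partial> [j, k] f * \<partial> [i] g))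
     + 3 * (\<Sum>\<^sub>*i j k l. X B i j [] * X B k l [] * (\<partial> [i, k] f * \<partial> [j, l] g)))"

definition star3 :: "('i, 'a::field_char_0) binop \<Rightarrow> ('i, 'a) binop" where
  "star3 B f g = scale (1/48)
    (2 * (\<Sum>\<^sub>*i j k l m n. X B i j [] * X B k l [i] * X B m n [j, k] *
            (\<partial> [n] f * \<partial> [l, m] g - \<partial> [l, m] f * \<partial> [n] g))
     + (\<Sum>\<^sub>*i j k l m n. X B i j [] * X B k l [] * X B m n [] *
            (\<partial> [i, k, m] f * \<partial> [j, l, n] g))
     + (\<Sum>\<^sub>*i j k l m n. X B l m [k] * X B j n [l] * X B k i [] *
            (\<partial> [m, n] f * \<partial> [i, j] g - \<partial> [i, j] f * \<partial> [m, n] g))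
     + (\<Sum>\<^sub>*i j k l m n. X B m n [k, l] * X B l j [] * X B k i [] *
            (\<partial> [m] f * \<partial> [n, i, j] g - \<partial> [n, i, j] f * \<partial> [m] g))
     + 2 * (\<Sum>\<^sub>*i j k l m n. X B i j [k] * X B k l [] * X B m n [] *
            (\<partial> [j, l, m] f * \<partial> [i, n] g - \<partial> [i, n] f * \<partial> [j, l, m] g)))"

definition star_terms :: "('i, 'a::field_char_0) binop \<Rightarrow> nat \<Rightarrow> ('i, 'a) binop" where
  "star_terms B i =
     (if i = 0 then (*)
      else if i = 1 then star1 B
      else if i = 2 then star2 B
      else if i = 3 then star3 B
      else (\<lambda>f g. 0))"

definition obstruction ::
  "('i, 'a::field_char_0) binop \<Rightarrow> 'i \<Rightarrow> 'i \<Rightarrow> 'i \<Rightarrow> ('i, 'a) mpoly" where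
  "obstruction B \<alpha> \<beta> \<gamma> =
     2 * (\<Sum>\<^sub>*i j k l m. X B i j [] * X B k l [i] *
            (X B \<alpha> \<beta> [k, m] * X B \<gamma> m [j, l]
             + X B \<beta> \<gamma> [k, m] * X B \<alpha> m [j, l]
             + X B \<gamma> \<alpha> [k, m] * X B \<beta> m [j, l]))
     + (\<Sum>\<^sub>*i j k l m. X B i j [] * X B k l [] *
            (X B \<alpha> \<beta> [i, k, m] * X B \<gamma> m [j, l]
             + X B \<beta> \<gamma> [i, k, m] * X B \<alpha> m [j, l]
             + X B \<gamma> \<alpha> [i, k, m] * X B \<beta> m [j, l]))"

definition unobstructed :: "('i::linorder, 'a::field_char_0) binop \<Rightarrow> bool" where
  "unobstructed B \<longleftrightarrow> (\<forall>\<alpha> \<beta> \<gamma>. \<alpha> < \<beta> \<and> \<beta> < \<gamma> \<longrightarrow> obstruction B \<alpha> \<beta> \<gamma> = 0)"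

end

theory Submission
  imports Defs
begin

text \<open>A deformation of order \<open>n - 1\<close> extends to order \<open>n\<close> iff the Hochschild cocycle \<open>obs\<close> formed by its
  terms is a coboundary. For polynomial algebras, a normalized 3-cocycle is a coboundary iff its alternating
  sum over any three variables vanishes. In order four most terms of that sum are zero because the
  variables are killed by second derivatives, and what remains is \<open>-1/24\<close> times the given expression.
  Since the term of order \<open>i\<close> has parity \<open>(-1)\<^sup>i\<close> under exchange of its arguments (for \<open>i = 4\<close> after
  symmetrization), the obstruction of order five is invariant under reversal of its arguments, hence its
  alternating sum is zero.

  Associativity in the orders two and three only has to be checked if the first argument is a
  variable, because the associator is a cocycle.\<close>

section \<open>Linear maps, monomials and partial derivatives\<close>

text \<open>The laborious part is associativity in the orders two and three for possibly infinitely
  many variables. Sums over repeated indices are unsuitable for this: \<open>Sum_any\<close> is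
  additive only on finite supports, and equal terms differ by a renaming of indices. The star
  product is therefore rewritten with operators \<open>D1\<close>, \<open>D2\<close>,
  \<open>D3\<close> and brackets, the contraction of \<open>X_ij^l\<close> with \<open>X_lk\<close>
  being the bracket of \<open>X_ij\<close> with \<open>x_k\<close>. An operator is shown to vanish
  by taking commutators with variables: each lowers the order, and what remains are finitely many
  identities between iterated brackets, settled by a normal form of Lie words. A variable as first
  argument keeps these identities short, since second derivatives kill it. The cochain in the
  coboundary criterion can be written down because every monomial other than 1 has a unique smallest
  variable: splitting it off turns the coboundary equation into a recursion. The cochain is
  normalized, so that the cocycle of the next order is normalized as well.\<close>

abbreviation lin :: "(('i, 'a::field_char_0) mpoly \<Rightarrow> ('i, 'a) mpoly) \<Rightarrow> bool" where
  "lin E \<equiv> Vector_Spaces.linear scale scale E"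

lemma lin_iff: "lin E \<longleftrightarrow> (\<forall>f g. E (f + g) = E f + E g) \<and> (\<forall>c f. E (scale c f) = scale c (E f))"
  by (simp add: Vector_Spaces.linear_iff vector_space_scale)

lemma lin_add: "lin E \<Longrightarrow> E (f + g) = E f + E g"
  and lin_scale: "lin E \<Longrightarrow> E (scale c f) = scale c (E f)"
  by (simp_all add: lin_iff)

lemma scale_zero [simp]: "scale c 0 = 0" "scale 0 f = 0"
  and scale_one [simp]: "scale 1 f = f"
  and scale_scale [simp]: "scale a (scale b f) = scale (a * b) f"
  by (simp_all add: scale_def mult_single flip: mult.assoc)

lemma scale_add: "scale c (f + g) = scale c f + scale c g"
  and scale_minus: "scale c (- f) = - scale c f"
  and scale_diff: "scale c (f - g) = scale c f - scale c g"
  and scale_mult_left: "scale c f * g = scale c (f * g)"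
  and scale_mult_right: "f * scale c g = scale c (f * g)"
  and scale_left_minus: "scale (- c) f = - scale c f"
  and scale_sum: "scale c (sum F S) = (\<Sum>i\<in>S. scale c (F i))"
  by (simp_all add: scale_def ring_distribs mult_ac single_uminus sum_distrib_left sum_distrib_right)

lemma scale_of_nat: "scale (of_nat n) f = of_nat n * f"
  by (simp add: scale_def)

lemma scale_numeral: "scale (numeral n) f = numeral n * f"
  by (simp add: scale_def)

lemma lin_zero: "lin E \<Longrightarrow> E 0 = 0"
  by (metis lin_scale scale_zero(2))

lemma lin_minus: "lin E \<Longrightarrow> E (- f) = - E f"
  by (metis lin_scale scale_left_minus scale_one)

lemma lin_diff: "lin E \<Longrightarrow> E (f - g) = E f - E g"
  by (metis lin_add lin_minus diff_conv_add_uminus)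

lemma lin_sum: "lin E \<Longrightarrow> E (sum F S) = (\<Sum>i\<in>S. E (F i))"
  by (induction S rule: infinite_finite_induct) (simp_all add: lin_zero lin_add)

lemma scale_add_left: "scale (a + b) f = scale a f + scale b f"
  by (simp add: scale_def single_add ring_distribs)

lemma lookup_scale: "Poly_Mapping.lookup (scale c f) m = c * Poly_Mapping.lookup f m"
  by (simp add: scale_def flip: mult_map_scale_conv_mult) (simp add: Poly_Mapping.map.rep_eq when_def)

section \<open>Monomials as a basis\<close>

definition mon :: "('i \<Rightarrow>\<^sub>0 nat) \<Rightarrow> ('i, 'a::field_char_0) mpoly" where
  "mon m = Poly_Mapping.single m 1"

lemma mon_0 [simp]: "mon 0 = 1"
  by (simp add: mon_def)

lemma mon_add: "mon (m + n) = mon m * mon n"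
  by (simp add: mon_def mult_single)

lemma mon_single: "mon (Poly_Mapping.single i 1) = var i"
  by (simp add: mon_def var_def)

lemma single_eq_scale_mon: "Poly_Mapping.single m c = scale c (mon m)"
  by (simp add: scale_def mon_def mult_single)

lemma mpoly_expand: "f = (\<Sum>m\<in>Poly_Mapping.keys f. scale (Poly_Mapping.lookup f m) (mon m))"
proof (rule poly_mapping_eqI)
  fix k
  have "Poly_Mapping.lookup (\<Sum>m\<in>Poly_Mapping.keys f. Poly_Mapping.single m (Poly_Mapping.lookup f m)) k
    = (\<Sum>m\<in>Poly_Mapping.keys f. if m = k then Poly_Mapping.lookup f m else 0)"
    by (simp add: lookup_sum lookup_single when_def)
  also have "\<dots> = Poly_Mapping.lookup f k"
    by (simp add: in_keys_iff)
  finally show "Poly_Mapping.lookup f k = Poly_Mapping.lookup (\<Sum>m\<in>Poly_Mapping.keys f. scale (Poly_Mapping.lookup f m) (mon m)) k"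
    by (simp add: single_eq_scale_mon)
qed

definition deg :: "('i \<Rightarrow>\<^sub>0 nat) \<Rightarrow> nat" where
  "deg m = (\<Sum>i\<in>Poly_Mapping.keys m. Poly_Mapping.lookup m i)"

lemma
  assumes i: "i \<in> Poly_Mapping.keys m"
  shows deg_remove: "deg (m - Poly_Mapping.single i 1) < deg m"
    and add_remove: "Poly_Mapping.single i 1 + (m - Poly_Mapping.single i 1) = m"
proof -
  let ?m = "m - Poly_Mapping.single i 1"
  show "Poly_Mapping.single i 1 + ?m = m"
    using i by (intro poly_mapping_eqI) (auto simp: lookup_add lookup_minus lookup_single when_def in_keys_iff)
  have "deg ?m = (\<Sum>j\<in>Poly_Mapping.keys m. Poly_Mapping.lookup ?m j)"
    unfolding deg_def by (rule sum.mono_neutral_left) (auto simp: in_keys_iff lookup_minus)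
  also have "\<dots> < deg m"
    unfolding deg_def
    by (rule sum_strict_mono_ex1) (use i in \<open>auto simp: in_keys_iff lookup_minus lookup_single when_def intro!: bexI[of _ i]\<close>)
  finally show "deg ?m < deg m" .
qed

lemma monomial_induct [case_names zero add]:
  assumes "P 0" and "\<And>i m. P m \<Longrightarrow> P (Poly_Mapping.single i 1 + m)"
  shows "P (m :: 'i \<Rightarrow>\<^sub>0 nat)"
proof (induction "deg m" arbitrary: m rule: less_induct)
  case less
  show ?case
  proof (cases "m = 0")
    case False
    then obtain i where i: "i \<in> Poly_Mapping.keys m"
      by (metis all_not_in_conv lookup_not_eq_zero_eq_in_keys lookup_zero poly_mapping_eqI)
    then have "P (Poly_Mapping.single i 1 + (m - Poly_Mapping.single i 1))"
      by (intro assms(2) less deg_remove)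
    then show ?thesis by (simp only: add_remove[OF i])
  qed (use assms in simp)
qed

lemma lin_expand:
  "lin E \<Longrightarrow> E f = (\<Sum>m\<in>Poly_Mapping.keys f. scale (Poly_Mapping.lookup f m) (E (mon m)))"
  by (subst (1) mpoly_expand) (simp add: lin_sum lin_scale)

lemma lin_eqI:
  assumes "lin E" "lin F" "\<And>m. E (mon m) = F (mon m)"
  shows "E f = F f"
  using assms(3) by (subst lin_expand[OF assms(1)], subst lin_expand[OF assms(2)]) simp

text \<open>A linear map that commutes with multiplication by all variables is multiplication by its
  value at 1. Operator identities are reduced to this by taking the difference of both
  sides.\<close>

lemma lin_eq0I:
  assumes E: "lin E" and "E 1 = 0" and "\<And>y f. E (var y * f) = var y * E f"
  shows "E f = 0"
proof (rule lin_eqI[OF E])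
  show "lin (\<lambda>_. 0)" by (simp add: lin_iff)
  show "E (mon m) = 0" for m
    by (induction m rule: monomial_induct)
      (use assms in \<open>simp_all add: mon_add mon_single[unfolded One_nat_def]\<close>)
qed

section \<open>Partial derivatives\<close>

lemma pderiv_var_superset:
  assumes "finite K" "Poly_Mapping.keys p \<subseteq> K"
  shows "pderiv_var i p = (\<Sum>m\<in>K.
        Poly_Mapping.single (m - Poly_Mapping.single i 1)
          (of_nat (Poly_Mapping.lookup m i) * Poly_Mapping.lookup p m))"
  unfolding pderiv_var_def using assms
  by (intro sum.mono_neutral_left) (auto simp: in_keys_iff)

lemma lin_pderiv: "lin (pderiv_var (i :: 'i) :: ('i, 'a::field_char_0) mpoly \<Rightarrow> _)"
  unfolding lin_iff
proof safe
  fix f g :: "('i, 'a) mpoly"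
  let ?K = "Poly_Mapping.keys f \<union> Poly_Mapping.keys g"
  have "Poly_Mapping.keys (f + g) \<subseteq> ?K" by (rule keys_add)
  then show "pderiv_var i (f + g) = pderiv_var i f + pderiv_var i g"
    by (simp add: pderiv_var_superset[of ?K] lookup_add algebra_simps single_add sum.distrib)
next
  fix c :: 'a and f :: "('i, 'a) mpoly"
  have l: "Poly_Mapping.lookup (scale c f) m = c * Poly_Mapping.lookup f m" for m
    by (simp add: scale_def flip: mult_map_scale_conv_mult) (simp add: Poly_Mapping.map.rep_eq when_def)
  have "Poly_Mapping.keys (scale c f) \<subseteq> Poly_Mapping.keys f"
    by (auto simp: in_keys_iff l)
  then show "pderiv_var i (scale c f) = scale c (pderiv_var i f)"
    by (simp add: pderiv_var_superset[of "Poly_Mapping.keys f"] l scale_sum)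
      (simp add: scale_def mult_single mult_ac)
qed

lemmas pderiv_add = lin_add[OF lin_pderiv] and pderiv_scale = lin_scale[OF lin_pderiv]
  and pderiv_0 [simp] = lin_zero[OF lin_pderiv]

lemma pderiv_mon:
  "pderiv_var i (mon m) = of_nat (Poly_Mapping.lookup m i) * mon (m - Poly_Mapping.single i 1)"
  unfolding scale_of_nat[symmetric]
  by (simp add: pderiv_var_def mon_def scale_def mult_single del: single_of_nat)

lemma pderiv_one [simp]: "pderiv_var i 1 = 0"
  using pderiv_mon[of i 0] by simp

lemma pderiv_var_var: "pderiv_var i (var j) = (if i = j then 1 else 0)"
  unfolding mon_single[symmetric] pderiv_mon by (auto simp: lookup_single)

lemma lin_mult_left: "lin (\<lambda>f. g * f)" and lin_mult_right: "lin (\<lambda>f. f * g)"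
  by (simp_all add: lin_iff algebra_simps scale_mult_left scale_mult_right)

lemma lin_compose: "lin E \<Longrightarrow> lin F \<Longrightarrow> lin (\<lambda>f. E (F f))"
  and lin_plus: "lin E \<Longrightarrow> lin F \<Longrightarrow> lin (\<lambda>f. E f + F f)"
  and lin_sub: "lin E \<Longrightarrow> lin F \<Longrightarrow> lin (\<lambda>f. E f - F f)"
  and lin_uminus: "lin E \<Longrightarrow> lin (\<lambda>f. - E f)"
  and lin_scaled: "lin E \<Longrightarrow> lin (\<lambda>f. scale c (E f))"
  and lin_mult: "lin E \<Longrightarrow> lin (\<lambda>f. g * E f)"
  and lin_mult': "lin E \<Longrightarrow> lin (\<lambda>f. E f * g)"
  and lin_id: "lin (\<lambda>f. f)"
  and lin_0: "lin (\<lambda>f. 0)"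
  by (simp_all add: lin_iff algebra_simps scale_add scale_diff scale_mult_left scale_mult_right scale_minus)

lemma pderiv_mult_mon:
  fixes i :: 'i
  shows "pderiv_var i (mon m * (mon n :: ('i, 'b::field_char_0) mpoly)) = pderiv_var i (mon m) * mon n + mon m * pderiv_var i (mon n)"
proof -
  \<comment> \<open>The truncated subtraction of exponents is harmless here only if
    \<open>x_i\<close> occurs in \<open>m\<close>. Otherwise the factor \<open>lookup m i\<close> is
    zero, whence the case distinction at the end.\<close>
  have *: "mon ((m + n) - Poly_Mapping.single i 1) = mon (m - Poly_Mapping.single i 1) * (mon n :: ('i, 'b::field_char_0) mpoly)"
    if "Poly_Mapping.lookup m i > 0" for m n :: "'i \<Rightarrow>\<^sub>0 nat"
    unfolding mon_add[symmetric] using that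
    by (intro arg_cong[of _ _ mon] poly_mapping_eqI) (auto simp: lookup_add lookup_minus lookup_single when_def)
  have "pderiv_var i (mon m * (mon n :: ('i, 'b) mpoly)) = of_nat (Poly_Mapping.lookup m i) * mon (m + n - Poly_Mapping.single i 1)
    + of_nat (Poly_Mapping.lookup n i) * mon (n + m - Poly_Mapping.single i 1)"
    by (simp add: mon_add[symmetric] pderiv_mon lookup_add distrib_right add.commute del: One_nat_def)
  also have "\<dots> = pderiv_var i (mon m) * mon n + mon m * pderiv_var i (mon n)"
    using *[of m n] *[of n m]
    by (cases "Poly_Mapping.lookup m i = 0"; cases "Poly_Mapping.lookup n i = 0")
      (simp_all add: pderiv_mon mult_ac del: One_nat_def)
  finally show ?thesis .
qed

lemma pderiv_mult: "pderiv_var i (f * g) = pderiv_var i f * g + f * pderiv_var i g"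
proof -
  have "pderiv_var i (mon m * g) = pderiv_var i (mon m) * g + mon m * pderiv_var i g" for m
    by (rule lin_eqI[where f=g, OF lin_compose[OF lin_pderiv lin_mult_left]
          lin_plus[OF lin_mult_left lin_mult[OF lin_pderiv]]]) (rule pderiv_mult_mon)
  then show ?thesis
    by (rule lin_eqI[where f=f, OF lin_compose[OF lin_pderiv lin_mult_right]
          lin_plus[OF lin_mult'[OF lin_pderiv] lin_mult_right]])
qed

text \<open>The commutator of two derivations is a derivation. This one kills the variables and
  hence commutes with multiplication by them.\<close>

lemma pderiv_commute: "pderiv_var i (pderiv_var j f) = pderiv_var j (pderiv_var i f)"
proof -
  have "pderiv_var i (pderiv_var j f) - pderiv_var j (pderiv_var i f) = 0"
  proof (rule lin_eq0I[where f=f])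
    show "lin (\<lambda>f. pderiv_var i (pderiv_var j f) - pderiv_var j (pderiv_var i f))"
      by (rule lin_sub[OF lin_compose[OF lin_pderiv lin_pderiv] lin_compose[OF lin_pderiv lin_pderiv]])
    show "pderiv_var i (pderiv_var j (var y * f)) - pderiv_var j (pderiv_var i (var y * f)) =
      var y * (pderiv_var i (pderiv_var j f) - pderiv_var j (pderiv_var i f))" for y f
      by (cases "i = y"; cases "j = y") (simp_all add: pderiv_mult pderiv_add pderiv_var_var right_diff_distrib)
  qed simp
  then show ?thesis by simp
qed

text \<open>Occurrence of a variable is expressed by a nonzero derivative, which is equivalent in
  characteristic 0. Sums whose terms contain a derivative of \<open>f\<close> can then be restricted
  to this finite set at once.\<close>

definition vars :: "('i, 'a::field_char_0) mpoly \<Rightarrow> 'i set" where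
  "vars f = {i. pderiv_var i f \<noteq> 0}"

lemma vars_var: "vars (var y) \<subseteq> {y}"
  by (auto simp: vars_def pderiv_var_var split: if_splits)

lemma finite_vars [simp]: "finite (vars f)"
proof (rule finite_subset)
  show "vars f \<subseteq> (\<Union>m\<in>Poly_Mapping.keys f. Poly_Mapping.keys m)"
    unfolding vars_def pderiv_var_def by (auto simp: in_keys_iff intro!: sum.neutral)
  show "finite (\<Union>m\<in>Poly_Mapping.keys f. Poly_Mapping.keys m)" by simp
qed

lemma pderiv_outside: "vars f \<subseteq> V \<Longrightarrow> i \<notin> V \<Longrightarrow> pderiv_var i f = 0"
  by (auto simp: vars_def)

lemma vars_pderiv: "vars (pderiv_var j f) \<subseteq> vars f"
  by (auto simp: vars_def pderiv_commute[of _ j])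

section \<open>Differential operators\<close>

text \<open>Differential operators with polynomial coefficients. By the nesting, \<open>D2\<close>
  and \<open>D3\<close> are sums of operators of lower order applied to a derivative. The
  coefficients are not symmetrized, so \<open>D2_var_mult\<close> and \<open>D3_var_mult\<close> add
  over all positions of the index \<open>y\<close>.\<close>

definition D1 :: "('i \<Rightarrow> ('i, 'a) mpoly) \<Rightarrow> ('i, 'a::field_char_0) mpoly \<Rightarrow> ('i, 'a) mpoly" where
  "D1 c f = (\<Sum>\<^sub>*i. c i * pderiv_var i f)"

definition D2 :: "('i \<Rightarrow> 'i \<Rightarrow> ('i, 'a) mpoly) \<Rightarrow> ('i, 'a::field_char_0) mpoly \<Rightarrow> ('i, 'a) mpoly" where
  "D2 c f = (\<Sum>\<^sub>*i. D1 (c i) (pderiv_var i f))"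

definition D3 :: "('i \<Rightarrow> 'i \<Rightarrow> 'i \<Rightarrow> ('i, 'a) mpoly) \<Rightarrow> ('i, 'a::field_char_0) mpoly \<Rightarrow> ('i, 'a) mpoly" where
  "D3 c f = (\<Sum>\<^sub>*i. D2 (c i) (pderiv_var i f))"

lemma Sum_any_eq_sum:
  assumes "finite V" "\<And>i. i \<notin> V \<Longrightarrow> t i = 0"
  shows "Sum_any t = sum t V"
  using assms by (intro Sum_any.expand_superset) auto

lemma D1_zero [simp]: "D1 c 0 = 0"
  by (simp add: D1_def)

lemma D1_eq_sum:
  assumes "finite V" "vars f \<subseteq> V"
  shows "D1 c f = (\<Sum>i\<in>V. c i * pderiv_var i f)"
  unfolding D1_def using assms by (intro Sum_any_eq_sum) (auto simp: pderiv_outside)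

lemma D2_zero [simp]: "D2 c 0 = 0"
  by (simp add: D2_def)

lemma D2_eq_sum:
  assumes V: "finite V" "vars f \<subseteq> V"
  shows "D2 c f = (\<Sum>i\<in>V. \<Sum>j\<in>V. c i j * pderiv_var j (pderiv_var i f))"
proof -
  have "D2 c f = (\<Sum>i\<in>V. D1 (c i) (pderiv_var i f))"
    unfolding D2_def using assms by (intro Sum_any_eq_sum) (simp_all add: pderiv_outside)
  moreover have "D1 (c i) (pderiv_var i f) = (\<Sum>j\<in>V. c i j * pderiv_var j (pderiv_var i f))" for i
    using V vars_pderiv[of i f] by (intro D1_eq_sum) auto
  ultimately show ?thesis by simp
qed

lemma D3_zero [simp]: "D3 c 0 = 0"
  by (simp add: D3_def)

lemma D3_eq_sum:
  assumes V: "finite V" "vars f \<subseteq> V"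
  shows "D3 c f = (\<Sum>i\<in>V. \<Sum>j\<in>V. \<Sum>k\<in>V. c i j k * pderiv_var k (pderiv_var j (pderiv_var i f)))"
proof -
  have "D3 c f = (\<Sum>i\<in>V. D2 (c i) (pderiv_var i f))"
    unfolding D3_def using assms by (intro Sum_any_eq_sum) (simp_all add: pderiv_outside)
  moreover have "D2 (c i) (pderiv_var i f) = (\<Sum>j\<in>V. \<Sum>k\<in>V. c i j k * pderiv_var k (pderiv_var j (pderiv_var i f)))" for i
    using V vars_pderiv[of i f] by (intro D2_eq_sum) auto
  ultimately show ?thesis by simp
qed

text \<open>\<open>Sum_any\<close> is 0 on infinite support and so not additive in general. Here all
  sums are taken over one finite set that contains the variables of all arguments.\<close>

lemma lin_Sum_any_pderiv:
  fixes E :: "'i \<Rightarrow> ('i, 'a::field_char_0) mpoly \<Rightarrow> ('i, 'a) mpoly"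
  assumes "\<And>i. lin (E i)"
  shows "lin (\<lambda>f. \<Sum>\<^sub>*i. E i (pderiv_var i f))"
  unfolding lin_iff
proof safe
  have *: "(\<Sum>\<^sub>*i. E i (pderiv_var i f)) = (\<Sum>i\<in>V. E i (pderiv_var i f))"
    if "finite V" "vars f \<subseteq> V" for f V
    using that by (intro Sum_any_eq_sum) (simp_all add: pderiv_outside lin_zero[OF assms])
  fix f g :: "('i, 'a) mpoly"
  let ?V = "vars f \<union> vars g \<union> vars (f + g)"
  show "(\<Sum>\<^sub>*i. E i (pderiv_var i (f + g))) = (\<Sum>\<^sub>*i. E i (pderiv_var i f)) + (\<Sum>\<^sub>*i. E i (pderiv_var i g))"
    by (subst (1 2 3) *[of ?V]) (auto simp: pderiv_add sum.distrib lin_add[OF assms])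
  fix a
  let ?V = "vars f \<union> vars (scale a f)"
  show "(\<Sum>\<^sub>*i. E i (pderiv_var i (scale a f))) = scale a (\<Sum>\<^sub>*i. E i (pderiv_var i f))"
    by (subst (1 2) *[of ?V]) (auto simp: pderiv_scale scale_sum lin_scale[OF assms])
qed

lemma lin_D1: "lin (D1 c)"
  unfolding D1_def[abs_def] by (rule lin_Sum_any_pderiv) (rule lin_mult_left)

lemma lin_D2: "lin (D2 c)"
  unfolding D2_def[abs_def] by (rule lin_Sum_any_pderiv) (rule lin_D1)

lemma lin_D3: "lin (D3 c)"
  unfolding D3_def[abs_def] by (rule lin_Sum_any_pderiv) (rule lin_D2)

lemma lin_apply: "lin E \<Longrightarrow> E (f + g) = E f + E g" "lin E \<Longrightarrow> E (f - g) = E f - E g"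
  "lin E \<Longrightarrow> E (- f) = - E f" "lin E \<Longrightarrow> E (scale c f) = scale c (E f)"
  "lin E \<Longrightarrow> E 0 = 0"
  by (simp_all add: lin_add lin_diff lin_minus lin_scale lin_zero)

lemma lin_numeral: "lin E \<Longrightarrow> E (numeral n * f) = numeral n * E f"
  by (metis lin_scale scale_numeral)

lemmas D_lin = lin_apply[OF lin_D1] lin_apply[OF lin_D2] lin_apply[OF lin_D3]
  lin_numeral[OF lin_D1] lin_numeral[OF lin_D2] lin_numeral[OF lin_D3]

lemma D1_coeff:
  "D1 (\<lambda>i. c i + c' i) f = D1 c f + D1 c' f" "D1 (\<lambda>i. c i - c' i) f = D1 c f - D1 c' f"
  "D1 (\<lambda>i. - c i) f = - D1 c f" "D1 (\<lambda>i. a * c i) f = a * D1 c f" "D1 (\<lambda>i. c i * a) f = a * D1 c f"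
  "D1 (\<lambda>i. 0) f = 0"
  by (simp_all add: D1_eq_sum[OF finite_vars order_refl] sum.distrib sum_subtractf sum_negf
    sum_distrib_left ring_distribs mult_ac)

lemma D2_coeff:
  "D2 (\<lambda>i j. c i j + c' i j) f = D2 c f + D2 c' f" "D2 (\<lambda>i j. c i j - c' i j) f = D2 c f - D2 c' f"
  "D2 (\<lambda>i j. - c i j) f = - D2 c f" "D2 (\<lambda>i j. a * c i j) f = a * D2 c f" "D2 (\<lambda>i j. c i j * a) f = a * D2 c f"
  "D2 (\<lambda>i j. 0) f = 0"
  by (simp_all add: D2_eq_sum[OF finite_vars order_refl] sum.distrib sum_subtractf sum_negf
    sum_distrib_left ring_distribs mult_ac)

lemma D3_coeff:
  "D3 (\<lambda>i j k. c i j k + c' i j k) f = D3 c f + D3 c' f" "D3 (\<lambda>i j k. c i j k - c' i j k) f = D3 c f - D3 c' f"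
  "D3 (\<lambda>i j k. - c i j k) f = - D3 c f" "D3 (\<lambda>i j k. a * c i j k) f = a * D3 c f" "D3 (\<lambda>i j k. c i j k * a) f = a * D3 c f"
  "D3 (\<lambda>i j k. 0) f = 0"
  by (simp_all add: D3_eq_sum[OF finite_vars order_refl] sum.distrib sum_subtractf sum_negf
    sum_distrib_left ring_distribs mult_ac)

lemmas D_coeff = D1_coeff D2_coeff D3_coeff

lemma D_one [simp]: "D1 c 1 = 0" "D2 c' 1 = 0" "D3 c'' 1 = 0"
  by (simp_all add: D1_def D2_def D3_def)

lemma D_var [simp]: "D1 c (var y) = c y" "D2 c' (var y) = 0" "D3 c'' (var y) = 0"
  by (simp_all add: D1_eq_sum[OF _ vars_var] D2_eq_sum[OF _ vars_var] D3_eq_sum[OF _ vars_var] pderiv_var_var)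

lemma D1_mult: "D1 c (f * g) = f * D1 c g + D1 c f * g"
proof -
  let ?V = "vars f \<union> vars g \<union> vars (f * g)"
  show ?thesis
    by (subst (1 2 3) D1_eq_sum[of ?V])
      (auto simp: pderiv_mult sum.distrib sum_distrib_left sum_distrib_right ring_distribs mult_ac)
qed

lemma D1_var_mult: "D1 c (var y * g) = var y * D1 c g + c y * g"
  by (simp add: D1_mult)

lemma pderiv_var_mult: "pderiv_var i (var y * g) = var y * pderiv_var i g + (if i = y then g else 0)"
  by (simp add: pderiv_mult pderiv_var_var)

text \<open>\<open>F i\<close> is the commutator of \<open>E i\<close> with \<open>x_y\<close>, and
  \<open>E y g\<close> comes from differentiating the factor \<open>x_y\<close> itself.\<close>

lemma Sum_any_pderiv_var_mult:
  assumes E: "\<And>i. lin (E i)" and F: "\<And>i. lin (F i)"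
    and EF: "\<And>i f. E i (var y * f) = var y * E i f + F i f"
  shows "(\<Sum>\<^sub>*i. E i (pderiv_var i (var y * g))) =
    var y * (\<Sum>\<^sub>*i. E i (pderiv_var i g)) + (\<Sum>\<^sub>*i. F i (pderiv_var i g)) + E y g"
proof -
  let ?V = "insert y (vars g \<union> vars (var y * g))"
  have Vg: "vars g \<subseteq> ?V" by blast
  have *: "(\<Sum>\<^sub>*i. E i (pderiv_var i f)) = (\<Sum>i\<in>?V. E i (pderiv_var i f))" if "\<And>i. lin (E i)" "vars f \<subseteq> ?V" for E f
    using that by (intro Sum_any_eq_sum) (auto simp: pderiv_outside lin_zero)
  have "(\<Sum>\<^sub>*i. E i (pderiv_var i (var y * g))) =
    (\<Sum>i\<in>?V. var y * E i (pderiv_var i g) + F i (pderiv_var i g) + (if i = y then E i g else 0))"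
    by (subst *[OF E], blast)
      (intro sum.cong refl, simp add: pderiv_var_mult lin_add[OF E] lin_zero[OF E] EF)
  also have "\<dots> = var y * (\<Sum>i\<in>?V. E i (pderiv_var i g)) + (\<Sum>i\<in>?V. F i (pderiv_var i g)) + E y g"
    unfolding sum.distrib sum_distrib_left by simp
  finally show ?thesis
    unfolding *[of E g, OF E Vg] *[of F g, OF F Vg] .
qed

lemma D2_var_mult: "D2 c (var y * g) = var y * D2 c g + D1 (\<lambda>i. c y i + c i y) g"
proof -
  have "D2 c (var y * g) = var y * D2 c g + D1 (\<lambda>i. c i y) g + D1 (c y) g"
    unfolding D2_def D1_def[of "\<lambda>i. c i y"]
    by (rule Sum_any_pderiv_var_mult) (simp_all add: lin_D1 lin_mult_left D1_var_mult)
  then show ?thesis by (simp add: D1_coeff)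
qed

lemma D3_var_mult: "D3 c (var y * g) = var y * D3 c g + D2 (\<lambda>i j. c y i j + c i y j + c i j y) g"
proof -
  have "D3 c (var y * g) = var y * D3 c g + D2 (\<lambda>i j. c i y j + c i j y) g + D2 (c y) g"
    unfolding D3_def D2_def[of "\<lambda>i j. c i y j + c i j y"]
    by (rule Sum_any_pderiv_var_mult) (simp_all add: lin_D2 lin_D1 D2_var_mult)
  then show ?thesis by (simp add: D2_coeff)
qed

section \<open>Iterated sums over all indices as finite sums\<close>

lemma Sum_any2:
  assumes V: "finite V" and t: "\<And>i j. \<not> (i \<in> V \<and> j \<in> V) \<Longrightarrow> t i j = 0"
  shows "(\<Sum>\<^sub>*i j. t i j) = (\<Sum>i\<in>V. \<Sum>j\<in>V. t i j)"
proof -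
  have "(\<Sum>\<^sub>*j. t i j) = (\<Sum>j\<in>V. t i j)" for i
    by (rule Sum_any_eq_sum[OF V]) (simp add: t)
  moreover have "(\<Sum>\<^sub>*i. \<Sum>j\<in>V. t i j) = (\<Sum>i\<in>V. \<Sum>j\<in>V. t i j)"
    by (rule Sum_any_eq_sum[OF V]) (simp add: t)
  ultimately show ?thesis by simp
qed

lemma Sum_any4:
  assumes V: "finite V" and t: "\<And>i j k l. \<not> (i \<in> V \<and> j \<in> V \<and> k \<in> V \<and> l \<in> V) \<Longrightarrow> t i j k l = 0"
  shows "(\<Sum>\<^sub>*i j k l. t i j k l) = (\<Sum>i\<in>V. \<Sum>j\<in>V. \<Sum>k\<in>V. \<Sum>l\<in>V. t i j k l)"
proof -
  have "(\<Sum>\<^sub>*k l. t i j k l) = (\<Sum>k\<in>V. \<Sum>l\<in>V. t i j k l)" for i j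
    by (rule Sum_any2[OF V]) (rule t, blast)
  moreover have "(\<Sum>\<^sub>*i j. \<Sum>k\<in>V. \<Sum>l\<in>V. t i j k l) = (\<Sum>i\<in>V. \<Sum>j\<in>V. \<Sum>k\<in>V. \<Sum>l\<in>V. t i j k l)"
    by (rule Sum_any2[OF V]) (intro sum.neutral ballI t, blast)
  ultimately show ?thesis by simp
qed

lemma Sum_any5:
  assumes V: "finite V" and t: "\<And>i j k l m. \<not> (i \<in> V \<and> j \<in> V \<and> k \<in> V \<and> l \<in> V \<and> m \<in> V) \<Longrightarrow> t i j k l m = 0"
  shows "(\<Sum>\<^sub>*i j k l m. t i j k l m) = (\<Sum>i\<in>V. \<Sum>j\<in>V. \<Sum>k\<in>V. \<Sum>l\<in>V. \<Sum>m\<in>V. t i j k l m)"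
proof -
  have "(\<Sum>\<^sub>*j k l m. t i j k l m) = (\<Sum>j\<in>V. \<Sum>k\<in>V. \<Sum>l\<in>V. \<Sum>m\<in>V. t i j k l m)" for i
    by (rule Sum_any4[OF V]) (rule t, blast)
  moreover have "(\<Sum>\<^sub>*i. \<Sum>j\<in>V. \<Sum>k\<in>V. \<Sum>l\<in>V. \<Sum>m\<in>V. t i j k l m) = (\<Sum>i\<in>V. \<Sum>j\<in>V. \<Sum>k\<in>V. \<Sum>l\<in>V. \<Sum>m\<in>V. t i j k l m)"
    by (rule Sum_any_eq_sum[OF V]) (intro sum.neutral ballI t, blast)
  ultimately show ?thesis by simp
qed

lemma Sum_any6:
  assumes V: "finite V" and t: "\<And>i j k l m n. \<not> (i \<in> V \<and> j \<in> V \<and> k \<in> V \<and> l \<in> V \<and> m \<in> V \<and> n \<in> V) \<Longrightarrow> t i j k l m n = 0"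
  shows "(\<Sum>\<^sub>*i j k l m n. t i j k l m n) = (\<Sum>i\<in>V. \<Sum>j\<in>V. \<Sum>k\<in>V. \<Sum>l\<in>V. \<Sum>m\<in>V. \<Sum>n\<in>V. t i j k l m n)"
proof -
  have "(\<Sum>\<^sub>*k l m n. t i j k l m n) = (\<Sum>k\<in>V. \<Sum>l\<in>V. \<Sum>m\<in>V. \<Sum>n\<in>V. t i j k l m n)" for i j
    by (rule Sum_any4[OF V]) (rule t, blast)
  moreover have "(\<Sum>\<^sub>*i j. \<Sum>k\<in>V. \<Sum>l\<in>V. \<Sum>m\<in>V. \<Sum>n\<in>V. t i j k l m n) = (\<Sum>i\<in>V. \<Sum>j\<in>V. \<Sum>k\<in>V. \<Sum>l\<in>V. \<Sum>m\<in>V. \<Sum>n\<in>V. t i j k l m n)"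
    by (rule Sum_any2[OF V]) (intro sum.neutral ballI t, blast)
  ultimately show ?thesis by simp
qed

section \<open>The star product in terms of brackets\<close>

lemma mpoly_self_neg_zero: "f = 0" if "f = - f" for f :: "('i, 'a::field_char_0) mpoly"
proof -
  have "f = scale (1/2) (scale 2 f)" by simp
  also have "scale 2 f = f + f" by (simp add: scale_numeral)
  also have "\<dots> = 0" using that by (metis add.right_inverse)
  finally show ?thesis by simp
qed

locale poisson =
  fixes B :: "('i, 'a::field_char_0) binop"
  assumes poisson: "poisson_bracket B"
begin

lemma lin_right: "lin (B f)" and lin_left: "lin (\<lambda>f. B f g)"
  and mult_right: "B f (g * h) = B f g * h + g * B f h"
  and mult_left: "B (f * g) h = B f h * g + f * B g h"
  and antisym: "B f g = - B g f"
  and jacobi: "B f (B g h) + B g (B h f) + B h (B f g) = 0"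
  using poisson unfolding poisson_bracket_def biderivation_def bilinear_map_def by blast+

lemmas B_lin = lin_apply[OF lin_right] lin_apply[OF lin_left] lin_numeral[OF lin_right] lin_numeral[OF lin_left]

lemma self [simp]: "B f f = 0"
  using antisym[of f f] by (rule mpoly_self_neg_zero)

lemma one [simp]: "B 1 g = 0" "B f 1 = 0"
  using mult_left[of 1 1 g] mult_right[of f 1 1] by simp_all

text \<open>A derivation is determined by its values on the variables.\<close>

lemma B_eq_D1: "B f g = D1 (\<lambda>i. B (var i) g) f"
proof -
  have "B f g - D1 (\<lambda>i. B (var i) g) f = 0"
    by (rule lin_eq0I[where f=f, OF lin_sub[OF lin_left lin_D1]])
      (simp_all add: D1_var_mult mult_left right_diff_distrib)
  then show ?thesis by simp
qed

abbreviation xx :: "'i \<Rightarrow> 'i \<Rightarrow> ('i, 'a) mpoly" where "xx i j \<equiv> B (var i) (var j)"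

text \<open>\<open>Q x / 12\<close> is the second order term of the star product by the variable \<open>x\<close>, and \<open>H F a b\<close> is
  the second derivative of \<open>F\<close> in the directions of the Hamiltonian vector fields of \<open>a\<close> and \<open>b\<close>. In
  terms of these and of brackets, all indices of \<^const>\<open>star2\<close> and \<^const>\<open>star3\<close> that occur only in the
  coefficients are summed away; \<open>b2\<close> and \<open>b3\<close> are 24 and 48 times these terms.\<close>

definition Q where "Q x g = D2 (\<lambda>j k. B (xx x j) (var k)) g"

definition H where "H F a b = D2 (\<lambda>k l. xx k a * xx l b) F"

definition Om where "Om f g = D2 (\<lambda>i k. D2 (\<lambda>j l. xx i j * xx k l) g) f"

definition b2 where "b2 f g = 2 * (D1 (\<lambda>i. Q i g) f + D1 (\<lambda>i. Q i f) g) + 3 * Om f g"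

text \<open>\<open>Aa\<close>, \<open>Bb\<close>, \<open>Cc\<close>, \<open>Dd\<close>,
  \<open>Ff\<close> are the five sums of \<open>star3\<close> in the order in which they occur
  there; all but \<open>Bb\<close> contain only the first of the two antisymmetric terms, the other
  one being added in \<open>b3\<close>.\<close>

definition Aa where "Aa f g = D1 (\<lambda>n. D2 (\<lambda>l m. Q l (xx n m)) g) f"
definition Bb where "Bb f g = D3 (\<lambda>i k m. D3 (\<lambda>j l n. xx i j * xx k l * xx m n) g) f"
definition Cc where "Cc f g = D2 (\<lambda>m n. D2 (\<lambda>i j. D1 (\<lambda>l. B (xx l m) (var i)) (xx j n)) g) f"
definition Dd where "Dd f g = D1 (\<lambda>m. D3 (\<lambda>n i j. H (xx m n) i j) g) f"
definition Ff where "Ff f g = D3 (\<lambda>j l m. D2 (\<lambda>i n. B (xx i j) (var l) * xx m n) g) f"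

definition b3 where "b3 f g = 2 * (Aa f g - Aa g f) + Bb f g + (Cc f g - Cc g f) + (Dd f g - Dd g f)
  + 2 * (Ff f g - Ff g f)"

text \<open>For \<open>f\<close> and \<open>g\<close> with variables in \<open>S\<close>, all indices of the nonzero summands lie in
  \<open>cl (cl S)\<close>, since a coefficient has at most two further contractions.\<close>

definition cl where "cl S = S \<union> (\<Union>i\<in>S. \<Union>j\<in>S. vars (xx i j))"

lemma finite_cl [simp]: "finite S \<Longrightarrow> finite (cl S)"
  and subset_cl: "S \<subseteq> cl S" "i \<in> S \<Longrightarrow> i \<in> cl S"
  and vars_cl: "i \<in> S \<Longrightarrow> j \<in> S \<Longrightarrow> vars (xx i j) \<subseteq> cl S"
  by (auto simp: cl_def)

section \<open>Contracted index sums as brackets\<close>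

lemma bracket_sum:
  assumes "finite V" "vars f \<subseteq> V"
  shows "B f g = (\<Sum>l\<in>V. B (var l) g * pderiv_var l f)"
  by (subst B_eq_D1) (rule D1_eq_sum[OF assms])

lemma pd2_outside: "vars f \<subseteq> S \<Longrightarrow> \<not> (j \<in> S \<and> k \<in> S) \<Longrightarrow> pderiv_var j (pderiv_var k f) = 0"
  by (metis pderiv_0 pderiv_commute pderiv_outside)

lemma pd3_outside: "vars f \<subseteq> S \<Longrightarrow> \<not> (i \<in> S \<and> j \<in> S \<and> k \<in> S) \<Longrightarrow> pderiv_var i (pderiv_var j (pderiv_var k f)) = 0"
  by (metis pderiv_0 pderiv_commute pderiv_outside)

text \<open>Coefficients have to be compared only where the derivatives of \<open>f\<close> and
  \<open>g\<close> are nonzero. There the outer indices lie in \<open>S\<close>, so that the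
  contracted sums over the closure of \<open>S\<close> are complete.\<close>

lemma mult_cong_nz: "(c \<noteq> 0 \<Longrightarrow> a = b) \<Longrightarrow> a * c = b * (c :: ('i, 'a) mpoly)"
  by (cases "c = 0") auto

text \<open>The sum of \<open>X_ij^l X_lk\<close> over \<open>l\<close> is the bracket of
  \<open>X_ij\<close> with \<open>x_k\<close>, as soon as the range contains all variables of
  \<open>X_ij\<close>.\<close>

lemma sum_Q_conv:
  assumes S: "finite S" "vars f \<subseteq> S" "vars g \<subseteq> S"
  shows "(\<Sum>i\<in>cl S. \<Sum>j\<in>cl S. \<Sum>k\<in>cl S. \<Sum>l\<in>cl S. pderiv_var l (xx i j) * xx l k *
       (pderiv_var i f * pderiv_var j (pderiv_var k g))) = D1 (\<lambda>i. Q i g) f"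
    (is "?L = _")
proof -
  let ?V = "cl S"
  have V: "finite ?V" "vars f \<subseteq> ?V" "vars g \<subseteq> ?V" using S subset_cl(1)[of S] by auto
  have "D1 (\<lambda>i. Q i g) f = (\<Sum>i\<in>?V. \<Sum>j\<in>?V. \<Sum>k\<in>?V. B (xx i j) (var k) * (pderiv_var i f * pderiv_var j (pderiv_var k g)))"
    by (simp add: D1_eq_sum[OF V(1,2)] Q_def D2_eq_sum[OF V(1,3)] sum_distrib_left sum_distrib_right mult_ac
        pderiv_commute)
  also have "\<dots> = ?L"
    unfolding sum_distrib_right[symmetric]
  proof (intro sum.cong refl mult_cong_nz)
    fix i j k assume nz: "pderiv_var i f * pderiv_var j (pderiv_var k g) \<noteq> 0"
    then have "i \<in> S" "j \<in> S"
      using pderiv_outside[OF S(2), of i] pd2_outside[OF S(3), of j k] by (metis mult_zero_left mult_zero_right)+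
    then show "B (xx i j) (var k) = (\<Sum>l\<in>?V. pderiv_var l (xx i j) * xx l k)"
      by (simp add: bracket_sum[OF V(1) vars_cl] mult_ac)
  qed
  finally show ?thesis by simp
qed

text \<open>On tuples, a permutation of the indices is a single reindexing by a bijection.\<close>

lemma sum_tuple6: "(\<Sum>i\<in>V. \<Sum>j\<in>V. \<Sum>k\<in>V. \<Sum>l\<in>V. \<Sum>m\<in>V. \<Sum>n\<in>V. t i j k l m n)
   = (\<Sum>(i, j, k, l, m, n)\<in>V\<times>V\<times>V\<times>V\<times>V\<times>V. t i j k l m n)"
  by (simp add: sum.cartesian_product)

lemma sum_tuple4: "(\<Sum>i\<in>V. \<Sum>j\<in>V. \<Sum>k\<in>V. \<Sum>l\<in>V. t i j k l)
   = (\<Sum>(i, j, k, l)\<in>V\<times>V\<times>V\<times>V. t i j k l)"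
  by (simp add: sum.cartesian_product)

lemma star2_eq: "star2 B f g = scale (1/24) (b2 f g)"
proof -
  define S where "S = vars f \<union> vars g"
  let ?V = "cl S"
  have S: "finite S" "vars f \<subseteq> S" "vars g \<subseteq> S" by (auto simp: S_def)
  have V: "finite ?V" "vars f \<subseteq> ?V" "vars g \<subseteq> ?V" using S subset_cl(1)[of S] by auto
  have "(\<Sum>\<^sub>*i j k l. X B i j [l] * X B l k [] * (\<partial> [i] f * \<partial> [j, k] g + \<partial> [j, k] f * \<partial> [i] g))
    = (\<Sum>i\<in>?V. \<Sum>j\<in>?V. \<Sum>k\<in>?V. \<Sum>l\<in>?V. pderiv_var l (xx i j) * xx l k *
      (pderiv_var i f * pderiv_var j (pderiv_var k g) + pderiv_var i g * pderiv_var j (pderiv_var k f)))"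
  proof (subst Sum_any4[OF V(1)])
    fix i j k l assume *: "\<not> (i \<in> ?V \<and> j \<in> ?V \<and> k \<in> ?V \<and> l \<in> ?V)"
    show "X B i j [l] * X B l k [] * (\<partial> [i] f * \<partial> [j, k] g + \<partial> [j, k] f * \<partial> [i] g) = 0"
    proof (cases "i \<in> S \<and> j \<in> S \<and> k \<in> S")
      case True
      then have "l \<notin> ?V" using * subset_cl(1)[of S] by auto
      then have "pderiv_var l (xx i j) = 0"
        using True vars_cl[of i S j] by (intro pderiv_outside) auto
      then show ?thesis by (simp add: X_def pderivs_def)
    next
      case False
      then show ?thesis
        using pderiv_outside[OF S(2), of i] pd2_outside[OF S(2), of j k]
          pderiv_outside[OF S(3), of i] pd2_outside[OF S(3), of j k]
        by (auto simp: X_def pderivs_def)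
    qed
  qed (simp add: X_def pderivs_def mult_ac)
  also have "\<dots> = D1 (\<lambda>i. Q i g) f + D1 (\<lambda>i. Q i f) g"
    using sum_Q_conv[OF S] sum_Q_conv[OF S(1,3,2)] by (simp add: ring_distribs sum.distrib)
  moreover have "(\<Sum>\<^sub>*i j k l. X B i j [] * X B k l [] * (\<partial> [i, k] f * \<partial> [j, l] g)) = Om f g"
  proof -
    have "(\<Sum>\<^sub>*i j k l. X B i j [] * X B k l [] * (\<partial> [i, k] f * \<partial> [j, l] g))
      = (\<Sum>i\<in>S. \<Sum>j\<in>S. \<Sum>k\<in>S. \<Sum>l\<in>S. X B i j [] * X B k l [] * (\<partial> [i, k] f * \<partial> [j, l] g))"
    proof (rule Sum_any4[OF S(1)])
      fix i j k l assume "\<not> (i \<in> S \<and> j \<in> S \<and> k \<in> S \<and> l \<in> S)"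
      then have "\<not> (i \<in> S \<and> k \<in> S) \<or> \<not> (j \<in> S \<and> l \<in> S)" by blast
      then have "\<partial> [i, k] f = 0 \<or> \<partial> [j, l] g = 0"
        using pd2_outside[OF S(2), of i k] pd2_outside[OF S(3), of j l] by (simp add: pderivs_def) blast
      then show "X B i j [] * X B k l [] * (\<partial> [i, k] f * \<partial> [j, l] g) = 0"
        by (elim disjE) simp_all
    qed
    also have "\<dots> = (\<Sum>i\<in>S. \<Sum>k\<in>S. \<Sum>j\<in>S. \<Sum>l\<in>S. xx i j * xx k l * (pderiv_var i (pderiv_var k f) * pderiv_var j (pderiv_var l g)))"
      unfolding sum_tuple4
      by (rule sum.reindex_bij_witness[of _ "\<lambda>(i,k,j,l). (i,j,k,l)" "\<lambda>(i,j,k,l). (i,k,j,l)"])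
        (auto simp: X_def pderivs_def)
    also have "\<dots> = Om f g"
      by (simp add: Om_def D2_eq_sum[OF S(1,2)] D2_eq_sum[OF S(1,3)] sum_distrib_left sum_distrib_right mult_ac
        pderiv_commute)
    finally show ?thesis .
  qed
  ultimately show ?thesis by (simp add: star2_def b2_def)
qed

lemma star1_eq: "star1 B f g = scale (1/2) (B f g)"
proof -
  define S where "S = vars f \<union> vars g"
  have S: "finite S" "vars f \<subseteq> S" "vars g \<subseteq> S" by (auto simp: S_def)
  have "(\<Sum>\<^sub>*i j. X B i j [] * \<partial> [i] f * \<partial> [j] g) = (\<Sum>i\<in>S. \<Sum>j\<in>S. X B i j [] * \<partial> [i] f * \<partial> [j] g)"
  proof (rule Sum_any2[OF S(1)])
    fix i j assume "\<not> (i \<in> S \<and> j \<in> S)"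
    then have "\<partial> [i] f = 0 \<or> \<partial> [j] g = 0"
      using pderiv_outside[OF S(2), of i] pderiv_outside[OF S(3), of j] by (simp add: pderivs_def) blast
    then show "X B i j [] * \<partial> [i] f * \<partial> [j] g = 0"
      by (elim disjE) simp_all
  qed
  also have "\<dots> = (\<Sum>i\<in>S. B (var i) g * pderiv_var i f)"
  proof (intro sum.cong refl)
    fix i
    have "B (var i) g = - (\<Sum>j\<in>S. xx j i * pderiv_var j g)"
      by (subst antisym) (simp add: bracket_sum[OF S(1,3)])
    also have "\<dots> = (\<Sum>j\<in>S. xx i j * pderiv_var j g)"
      unfolding sum_negf[symmetric] by (intro sum.cong refl) (subst (2) antisym, simp)
    finally have "B (var i) g = (\<Sum>j\<in>S. xx i j * pderiv_var j g)" .
    then show "(\<Sum>j\<in>S. X B i j [] * \<partial> [i] f * \<partial> [j] g) = B (var i) g * pderiv_var i f"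
      unfolding sum_distrib_right X_def pderivs_def by (simp add: sum_distrib_left mult_ac)
  qed
  also have "\<dots> = B f g" by (simp add: bracket_sum[OF S(1,2)])
  finally show ?thesis by (simp add: star1_def)
qed

abbreviation pd where "pd \<equiv> pderiv_var"

lemma D_sums:
  assumes "finite V" "vars f \<subseteq> V"
  shows "D1 c f = (\<Sum>i\<in>V. c i * pd i f)"
    "D2 c' f = (\<Sum>i\<in>V. \<Sum>j\<in>V. c' i j * pd i (pd j f))"
    "D3 c'' f = (\<Sum>i\<in>V. \<Sum>j\<in>V. \<Sum>k\<in>V. c'' i j k * pd i (pd j (pd k f)))"
proof -
  have *: "pd k (pd j (pd i f)) = pd i (pd j (pd k f))" for i j k
    by (metis pderiv_commute)
  show "D1 c f = (\<Sum>i\<in>V. c i * pd i f)"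
    "D2 c' f = (\<Sum>i\<in>V. \<Sum>j\<in>V. c' i j * pd i (pd j f))"
    "D3 c'' f = (\<Sum>i\<in>V. \<Sum>j\<in>V. \<Sum>k\<in>V. c'' i j k * pd i (pd j (pd k f)))"
    using assms by (simp_all add: D1_eq_sum D2_eq_sum D3_eq_sum pderiv_commute * cong: sum.cong)
qed

lemma Q_sum:
  assumes V: "finite V" "S \<subseteq> V" "vars F \<subseteq> S" and x: "x \<in> S" "S' = cl S" "S' \<subseteq> V"
  shows "Q x F = (\<Sum>j\<in>V. \<Sum>k\<in>V. \<Sum>l\<in>V. xx l k * pd l (xx x j) * pd j (pd k F))"
proof -
  have "vars F \<subseteq> V" using V by auto
  then have "Q x F = (\<Sum>j\<in>V. \<Sum>k\<in>V. B (xx x j) (var k) * pd j (pd k F))"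
    by (simp add: Q_def D_sums[OF V(1)])
  also have "\<dots> = (\<Sum>j\<in>V. \<Sum>k\<in>V. (\<Sum>l\<in>V. xx l k * pd l (xx x j)) * pd j (pd k F))"
  proof (intro sum.cong refl mult_cong_nz)
    fix j k assume "pd j (pd k F) \<noteq> 0"
    then have "j \<in> S" using pd2_outside[OF V(3), of j k] by blast
    then have "vars (xx x j) \<subseteq> V" using vars_cl[of x S j] x by auto
    then show "B (xx x j) (var k) = (\<Sum>l\<in>V. xx l k * pd l (xx x j))"
      by (rule bracket_sum[OF V(1)])
  qed
  finally show ?thesis by (simp add: sum_distrib_right)
qed

lemma sum_A_conv:
  assumes S: "finite S" "vars f \<subseteq> S" "vars g \<subseteq> S" and V: "V = cl (cl S)"
  shows "(\<Sum>i\<in>V. \<Sum>j\<in>V. \<Sum>k\<in>V. \<Sum>l\<in>V. \<Sum>m\<in>V. \<Sum>n\<in>V. xx i j * pd i (xx k l) * pd j (pd k (xx m n)) *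
       (pd n f * pd l (pd m g))) = Aa f g"
    (is "?L = _")
proof -
  have V': "finite V" "vars f \<subseteq> V" "vars g \<subseteq> V" "cl S \<subseteq> V"
    using S subset_cl(1)[of S] subset_cl(1)[of "cl S"] by (auto simp: V)
  have "Aa f g = (\<Sum>n\<in>V. \<Sum>l\<in>V. \<Sum>m\<in>V. Q l (xx n m) * (pd n f * pd l (pd m g)))"
    by (simp add: Aa_def D_sums[OF V'(1,2)] D_sums[OF V'(1,3)] sum_distrib_right sum_distrib_left mult_ac)
  also have "\<dots> = (\<Sum>n\<in>V. \<Sum>l\<in>V. \<Sum>m\<in>V. (\<Sum>k\<in>V. \<Sum>j\<in>V. \<Sum>i\<in>V. xx i j * pd i (xx k l) * pd j (pd k (xx m n))) * (pd n f * pd l (pd m g)))"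
  proof (intro sum.cong refl mult_cong_nz)
    fix n l m assume "pd n f * pd l (pd m g) \<noteq> 0"
    then have "n \<in> S" "l \<in> S" "m \<in> S"
      using pderiv_outside[OF S(2), of n] pd2_outside[OF S(3), of l m] by (metis mult_zero_left mult_zero_right)+
    then have "Q l (xx n m) = (\<Sum>k\<in>V. \<Sum>j\<in>V. \<Sum>i\<in>V. xx i j * pd i (xx l k) * pd k (pd j (xx n m)))"
      by (intro Q_sum[OF V'(1,4) vars_cl subset_cl(2) V order_refl])
    \<comment> \<open>\<open>star3\<close> has \<open>X_kl\<close> and \<open>X_mn\<close> where
      \<open>Q\<close> produces \<open>X_lk\<close> and \<open>X_nm\<close>; the two signs
      cancel.\<close>
    moreover have "pd i (xx l k) * pd k (pd j (xx n m)) = pd i (xx k l) * pd j (pd k (xx m n))" for i j k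
      by (subst antisym[of "var l"], subst antisym[of "var n"], subst pderiv_commute)
        (simp add: lin_minus[OF lin_pderiv])
    ultimately show "Q l (xx n m) = (\<Sum>k\<in>V. \<Sum>j\<in>V. \<Sum>i\<in>V. xx i j * pd i (xx k l) * pd j (pd k (xx m n)))"
      by (simp add: mult.assoc)
  qed
  also have "\<dots> = (\<Sum>n\<in>V. \<Sum>l\<in>V. \<Sum>m\<in>V. \<Sum>k\<in>V. \<Sum>j\<in>V. \<Sum>i\<in>V. xx i j * pd i (xx k l) * pd j (pd k (xx m n)) * (pd n f * pd l (pd m g)))"
    by (simp add: sum_distrib_right)
  also have "\<dots> = ?L"
    unfolding sum_tuple6
    by (rule sum.reindex_bij_witness[of _ "\<lambda>(i,j,k,l,m,n). (n,l,m,k,j,i)" "\<lambda>(n,l,m,k,j,i). (i,j,k,l,m,n)"]) auto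
  finally show ?thesis by simp
qed

lemma sum_B_conv:
  assumes V: "finite V" "vars f \<subseteq> V" "vars g \<subseteq> V"
  shows "(\<Sum>i\<in>V. \<Sum>j\<in>V. \<Sum>k\<in>V. \<Sum>l\<in>V. \<Sum>m\<in>V. \<Sum>n\<in>V. xx i j * xx k l * xx m n *
       (pd i (pd k (pd m f)) * pd j (pd l (pd n g)))) = Bb f g"
    (is "?L = _")
proof -
  have "Bb f g = (\<Sum>i\<in>V. \<Sum>k\<in>V. \<Sum>m\<in>V. \<Sum>j\<in>V. \<Sum>l\<in>V. \<Sum>n\<in>V. xx i j * xx k l * xx m n *
       (pd i (pd k (pd m f)) * pd j (pd l (pd n g))))"
    by (simp add: Bb_def D_sums[OF V(1,2)] D_sums[OF V(1,3)] sum_distrib_right sum_distrib_left mult_ac)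
  also have "\<dots> = ?L"
    unfolding sum_tuple6
    by (rule sum.reindex_bij_witness[of _ "\<lambda>(i,j,k,l,m,n). (i,k,m,j,l,n)" "\<lambda>(i,k,m,j,l,n). (i,j,k,l,m,n)"]) auto
  finally show ?thesis by simp
qed

lemma sum_C_conv:
  assumes S: "finite S" "vars f \<subseteq> S" "vars g \<subseteq> S" and V: "V = cl (cl S)"
  shows "(\<Sum>i\<in>V. \<Sum>j\<in>V. \<Sum>k\<in>V. \<Sum>l\<in>V. \<Sum>m\<in>V. \<Sum>n\<in>V. pd k (xx l m) * pd l (xx j n) * xx k i *
       (pd m (pd n f) * pd i (pd j g))) = Cc f g"
    (is "?L = _")
proof -
  have V': "finite V" "vars f \<subseteq> V" "vars g \<subseteq> V" "cl S \<subseteq> V"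
    using S subset_cl(1)[of S] subset_cl(1)[of "cl S"] by (auto simp: V)
  have "Cc f g = (\<Sum>m\<in>V. \<Sum>n\<in>V. \<Sum>i\<in>V. \<Sum>j\<in>V. D1 (\<lambda>l. B (xx l m) (var i)) (xx j n) * (pd m (pd n f) * pd i (pd j g)))"
    by (simp add: Cc_def D_sums(2)[OF V'(1,2)] D_sums(2)[OF V'(1,3)] sum_distrib_right sum_distrib_left mult_ac)
  also have "\<dots> = (\<Sum>m\<in>V. \<Sum>n\<in>V. \<Sum>i\<in>V. \<Sum>j\<in>V. (\<Sum>l\<in>V. \<Sum>k\<in>V. pd k (xx l m) * pd l (xx j n) * xx k i) * (pd m (pd n f) * pd i (pd j g)))"
  proof (intro sum.cong refl mult_cong_nz)
    fix m n i j assume "pd m (pd n f) * pd i (pd j g) \<noteq> 0"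
    then have *: "n \<in> S" "m \<in> S" "i \<in> S" "j \<in> S"
      using pd2_outside[OF S(2), of m n] pd2_outside[OF S(3), of i j] by (metis mult_zero_left mult_zero_right)+
    then have W: "vars (xx j n) \<subseteq> cl S" by (simp add: vars_cl)
    then have "D1 (\<lambda>l. B (xx l m) (var i)) (xx j n) = (\<Sum>l\<in>V. B (xx l m) (var i) * pd l (xx j n))"
      using V' by (intro D_sums) auto
    \<comment> \<open>The index \<open>l\<close> is itself contracted and lies only in
      \<open>cl S\<close>, so the variables of \<open>X_lm\<close> require the second
      closure.\<close>
    also have "\<dots> = (\<Sum>l\<in>V. (\<Sum>k\<in>V. xx k i * pd k (xx l m)) * pd l (xx j n))"
    proof (intro sum.cong refl mult_cong_nz)
      fix l assume "pd l (xx j n) \<noteq> 0"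
      then have "l \<in> cl S" using pderiv_outside[OF W] by blast
      then have "vars (xx l m) \<subseteq> V" unfolding V using * subset_cl(2)[of _ S] by (intro vars_cl) auto
      then show "B (xx l m) (var i) = (\<Sum>k\<in>V. xx k i * pd k (xx l m))"
        by (rule bracket_sum[OF V'(1)])
    qed
    finally show "D1 (\<lambda>l. B (xx l m) (var i)) (xx j n) = (\<Sum>l\<in>V. \<Sum>k\<in>V. pd k (xx l m) * pd l (xx j n) * xx k i)"
      by (simp add: sum_distrib_right sum_distrib_left mult_ac)
  qed
  also have "\<dots> = (\<Sum>m\<in>V. \<Sum>n\<in>V. \<Sum>i\<in>V. \<Sum>j\<in>V. \<Sum>l\<in>V. \<Sum>k\<in>V. pd k (xx l m) * pd l (xx j n) * xx k i * (pd m (pd n f) * pd i (pd j g)))"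
    by (simp add: sum_distrib_right)
  also have "\<dots> = ?L"
    unfolding sum_tuple6
    by (rule sum.reindex_bij_witness[of _ "\<lambda>(i,j,k,l,m,n). (m,n,i,j,l,k)" "\<lambda>(m,n,i,j,l,k). (i,j,k,l,m,n)"]) auto
  finally show ?thesis by simp
qed

lemma sum_D_conv:
  assumes S: "finite S" "vars f \<subseteq> S" "vars g \<subseteq> S" and V: "V = cl (cl S)"
  shows "(\<Sum>i\<in>V. \<Sum>j\<in>V. \<Sum>k\<in>V. \<Sum>l\<in>V. \<Sum>m\<in>V. \<Sum>n\<in>V. pd k (pd l (xx m n)) * xx l j * xx k i *
       (pd m f * pd n (pd i (pd j g)))) = Dd f g"
    (is "?L = _")
proof -
  have V': "finite V" "vars f \<subseteq> V" "vars g \<subseteq> V" "cl S \<subseteq> V"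
    using S subset_cl(1)[of S] subset_cl(1)[of "cl S"] by (auto simp: V)
  have "Dd f g = (\<Sum>m\<in>V. \<Sum>n\<in>V. \<Sum>i\<in>V. \<Sum>j\<in>V. H (xx m n) i j * (pd m f * pd n (pd i (pd j g))))"
    by (simp add: Dd_def D_sums[OF V'(1,2)] D_sums[OF V'(1,3)] sum_distrib_right sum_distrib_left mult_ac)
  also have "\<dots> = (\<Sum>m\<in>V. \<Sum>n\<in>V. \<Sum>i\<in>V. \<Sum>j\<in>V. (\<Sum>k\<in>V. \<Sum>l\<in>V. pd k (pd l (xx m n)) * xx l j * xx k i) * (pd m f * pd n (pd i (pd j g))))"
  proof (intro sum.cong refl mult_cong_nz)
    fix m n i j assume "pd m f * pd n (pd i (pd j g)) \<noteq> 0"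
    then have *: "n \<in> S" "m \<in> S"
      using pderiv_outside[OF S(2), of m] pd3_outside[OF S(3), of n i j] by (metis mult_zero_left mult_zero_right)+
    then have "vars (xx m n) \<subseteq> V" using vars_cl[of m S n] V' by auto
    then show "H (xx m n) i j = (\<Sum>k\<in>V. \<Sum>l\<in>V. pd k (pd l (xx m n)) * xx l j * xx k i)"
      by (simp add: H_def D_sums[OF V'(1)] mult_ac)
  qed
  also have "\<dots> = (\<Sum>m\<in>V. \<Sum>n\<in>V. \<Sum>i\<in>V. \<Sum>j\<in>V. \<Sum>k\<in>V. \<Sum>l\<in>V. pd k (pd l (xx m n)) * xx l j * xx k i * (pd m f * pd n (pd i (pd j g))))"
    by (simp add: sum_distrib_right)
  also have "\<dots> = ?L"
    unfolding sum_tuple6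
    by (rule sum.reindex_bij_witness[of _ "\<lambda>(i,j,k,l,m,n). (m,n,i,j,k,l)" "\<lambda>(m,n,i,j,k,l). (i,j,k,l,m,n)"]) auto
  finally show ?thesis by simp
qed

lemma sum_F_conv:
  assumes S: "finite S" "vars f \<subseteq> S" "vars g \<subseteq> S" and V: "V = cl (cl S)"
  shows "(\<Sum>i\<in>V. \<Sum>j\<in>V. \<Sum>k\<in>V. \<Sum>l\<in>V. \<Sum>m\<in>V. \<Sum>n\<in>V. pd k (xx i j) * xx k l * xx m n *
       (pd j (pd l (pd m f)) * pd i (pd n g))) = Ff f g"
    (is "?L = _")
proof -
  have V': "finite V" "vars f \<subseteq> V" "vars g \<subseteq> V" "cl S \<subseteq> V"
    using S subset_cl(1)[of S] subset_cl(1)[of "cl S"] by (auto simp: V)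
  have "Ff f g = (\<Sum>j\<in>V. \<Sum>l\<in>V. \<Sum>m\<in>V. \<Sum>i\<in>V. \<Sum>n\<in>V. (B (xx i j) (var l) * xx m n) * (pd j (pd l (pd m f)) * pd i (pd n g)))"
    by (simp add: Ff_def D_sums[OF V'(1,2)] D_sums[OF V'(1,3)] sum_distrib_right sum_distrib_left mult_ac)
  also have "\<dots> = (\<Sum>j\<in>V. \<Sum>l\<in>V. \<Sum>m\<in>V. \<Sum>i\<in>V. \<Sum>n\<in>V. (\<Sum>k\<in>V. pd k (xx i j) * xx k l * xx m n) * (pd j (pd l (pd m f)) * pd i (pd n g)))"
  proof (intro sum.cong refl mult_cong_nz)
    fix j l m i n assume "pd j (pd l (pd m f)) * pd i (pd n g) \<noteq> 0"
    then have *: "i \<in> S" "j \<in> S"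
      using pd2_outside[OF S(3), of i n] pd3_outside[OF S(2), of j l m] by (metis mult_zero_left mult_zero_right)+
    then have "vars (xx i j) \<subseteq> V" using vars_cl[of i S j] V' by auto
    then show "B (xx i j) (var l) * xx m n = (\<Sum>k\<in>V. pd k (xx i j) * xx k l * xx m n)"
      by (simp add: bracket_sum[OF V'(1)] sum_distrib_right sum_distrib_left mult_ac)
  qed
  also have "\<dots> = (\<Sum>j\<in>V. \<Sum>l\<in>V. \<Sum>m\<in>V. \<Sum>i\<in>V. \<Sum>n\<in>V. \<Sum>k\<in>V. pd k (xx i j) * xx k l * xx m n * (pd j (pd l (pd m f)) * pd i (pd n g)))"
    by (simp add: sum_distrib_right)
  also have "\<dots> = ?L"
    unfolding sum_tuple6
    by (rule sum.reindex_bij_witness[of _ "\<lambda>(i,j,k,l,m,n). (j,l,m,i,n,k)" "\<lambda>(j,l,m,i,n,k). (i,j,k,l,m,n)"]) auto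
  finally show ?thesis by simp
qed

lemma star3_eq: "star3 B f g = scale (1/48) (b3 f g)"
proof -
  define S where "S = vars f \<union> vars g"
  define V where "V = cl (cl S)"
  have S: "finite S" "vars f \<subseteq> S" "vars g \<subseteq> S" by (auto simp: S_def)
  have V: "finite V" "S \<subseteq> V" "cl S \<subseteq> V"
    using S subset_cl(1)[of S] subset_cl(1)[of "cl S"] by (auto simp: V_def)
  have SV: "i \<in> V" if "i \<in> S" for i using V that by blast
  have clV: "i \<in> V" if "i \<in> cl S" for i using V that by blast
  have W: "vars (xx i j) \<subseteq> cl S" if "i \<in> S" "j \<in> S" for i j using vars_cl that by blast
  have WV: "vars (xx i j) \<subseteq> V" if "i \<in> cl S" "j \<in> cl S" for i j using vars_cl that by (simp add: V_def)
  have Scl: "i \<in> cl S" if "i \<in> S" for i using subset_cl that by blast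
  have o1: "pd i f = 0" "pd i g = 0" if "i \<notin> S" for i
    using pderiv_outside[OF S(2) that] pderiv_outside[OF S(3) that] .
  have o2: "pd i (pd j f) = 0" "pd i (pd j g) = 0" if "\<not> (i \<in> S \<and> j \<in> S)" for i j
    using pd2_outside[OF S(2) that] pd2_outside[OF S(3) that] .
  have o3: "pd i (pd j (pd k f)) = 0" "pd i (pd j (pd k g)) = 0" if "\<not> (i \<in> S \<and> j \<in> S \<and> k \<in> S)" for i j k
    using pd3_outside[OF S(2) that] pd3_outside[OF S(3) that] .
  have dist: "(\<Sum>i\<in>V. \<Sum>j\<in>V. \<Sum>k\<in>V. \<Sum>l\<in>V. \<Sum>m\<in>V. \<Sum>n\<in>V. t i j k l m n * (u i j k l m n - v i j k l m n))
    = (\<Sum>i\<in>V. \<Sum>j\<in>V. \<Sum>k\<in>V. \<Sum>l\<in>V. \<Sum>m\<in>V. \<Sum>n\<in>V. t i j k l m n * u i j k l m n)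
    - (\<Sum>i\<in>V. \<Sum>j\<in>V. \<Sum>k\<in>V. \<Sum>l\<in>V. \<Sum>m\<in>V. \<Sum>n\<in>V. t i j k l m n * v i j k l m n)"
    for t u v :: "'i \<Rightarrow> 'i \<Rightarrow> 'i \<Rightarrow> 'i \<Rightarrow> 'i \<Rightarrow> 'i \<Rightarrow> ('i, 'a) mpoly"
    by (simp add: right_diff_distrib sum_subtractf)
  have e1: "(\<Sum>\<^sub>*i j k l m n. X B i j [] * X B k l [i] * X B m n [j, k] *
            (\<partial> [n] f * \<partial> [l, m] g - \<partial> [l, m] f * \<partial> [n] g)) = Aa f g - Aa g f"
  proof (subst Sum_any6[OF V(1)])
    fix i j k l m n assume *: "\<not> (i \<in> V \<and> j \<in> V \<and> k \<in> V \<and> l \<in> V \<and> m \<in> V \<and> n \<in> V)"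
    show "X B i j [] * X B k l [i] * X B m n [j, k] *
            (\<partial> [n] f * \<partial> [l, m] g - \<partial> [l, m] f * \<partial> [n] g) = 0"
    \<comment> \<open>In a nonzero term the derivatives of \<open>f\<close> and \<open>g\<close>
      force \<open>l\<close>, \<open>m\<close>, \<open>n\<close> into \<open>S\<close>, then the
      second derivative of \<open>X_mn\<close> forces \<open>j\<close>, \<open>k\<close> into
      \<open>cl S\<close>, and finally the derivative of \<open>X_kl\<close> forces \<open>i\<close>
      into \<open>V\<close>.\<close>
    proof (cases "l \<in> S \<and> m \<in> S \<and> n \<in> S")
      case T: True
      show ?thesis
      proof (cases "j \<in> cl S \<and> k \<in> cl S")
        case True
        then have "pd i (xx k l) = 0" using * T SV clV by (intro pderiv_outside[OF WV]) (auto simp: Scl)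
        then show ?thesis by (simp add: X_def pderivs_def)
      next
        case False
        then have "pd j (pd k (xx m n)) = 0" using T by (intro pd2_outside[OF W]) auto
        then show ?thesis by (simp add: X_def pderivs_def)
      qed
    next
      case False
      then show ?thesis using o1[of n] o2[of l m] by (auto simp: X_def pderivs_def)
    qed
  next
    show "(\<Sum>i\<in>V. \<Sum>j\<in>V. \<Sum>k\<in>V. \<Sum>l\<in>V. \<Sum>m\<in>V. \<Sum>n\<in>V. X B i j [] * X B k l [i] * X B m n [j, k] *
            (\<partial> [n] f * \<partial> [l, m] g - \<partial> [l, m] f * \<partial> [n] g)) = Aa f g - Aa g f"
      unfolding dist sum_A_conv[OF S V_def, symmetric] sum_A_conv[OF S(1,3,2) V_def, symmetric]
      by (simp add: X_def pderivs_def mult_ac)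
  qed
  have e2: "(\<Sum>\<^sub>*i j k l m n. X B i j [] * X B k l [] * X B m n [] *
            (\<partial> [i, k, m] f * \<partial> [j, l, n] g)) = Bb f g"
  proof (subst Sum_any6[OF S(1)])
    fix i j k l m n assume "\<not> (i \<in> S \<and> j \<in> S \<and> k \<in> S \<and> l \<in> S \<and> m \<in> S \<and> n \<in> S)"
    then have "\<not> (i \<in> S \<and> k \<in> S \<and> m \<in> S) \<or> \<not> (j \<in> S \<and> l \<in> S \<and> n \<in> S)" by blast
    then have "\<partial> [i, k, m] f = 0 \<or> \<partial> [j, l, n] g = 0"
      using o3[of i k m] o3[of j l n] by (simp add: pderivs_def) blast
    then show "X B i j [] * X B k l [] * X B m n [] * (\<partial> [i, k, m] f * \<partial> [j, l, n] g) = 0"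
      by (elim disjE) simp_all
  qed (simp add: X_def pderivs_def sum_B_conv[OF S])
  have e3: "(\<Sum>\<^sub>*i j k l m n. X B l m [k] * X B j n [l] * X B k i [] *
            (\<partial> [m, n] f * \<partial> [i, j] g - \<partial> [i, j] f * \<partial> [m, n] g)) = Cc f g - Cc g f"
  proof (subst Sum_any6[OF V(1)])
    fix i j k l m n assume *: "\<not> (i \<in> V \<and> j \<in> V \<and> k \<in> V \<and> l \<in> V \<and> m \<in> V \<and> n \<in> V)"
    show "X B l m [k] * X B j n [l] * X B k i [] *
            (\<partial> [m, n] f * \<partial> [i, j] g - \<partial> [i, j] f * \<partial> [m, n] g) = 0"
    proof (cases "i \<in> S \<and> j \<in> S \<and> m \<in> S \<and> n \<in> S")
      case T: True
      show ?thesis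
      proof (cases "l \<in> cl S")
        case True
        then have "pd k (xx l m) = 0" using * T SV clV by (intro pderiv_outside[OF WV]) (auto simp: Scl)
        then show ?thesis by (simp add: X_def pderivs_def)
      next
        case False
        then have "pd l (xx j n) = 0" using T by (intro pderiv_outside[OF W]) auto
        then show ?thesis by (simp add: X_def pderivs_def)
      qed
    next
      case False
      then show ?thesis using o2[of i j] o2[of m n] by (auto simp: X_def pderivs_def)
    qed
  next
    show "(\<Sum>i\<in>V. \<Sum>j\<in>V. \<Sum>k\<in>V. \<Sum>l\<in>V. \<Sum>m\<in>V. \<Sum>n\<in>V. X B l m [k] * X B j n [l] * X B k i [] *
            (\<partial> [m, n] f * \<partial> [i, j] g - \<partial> [i, j] f * \<partial> [m, n] g)) = Cc f g - Cc g f"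
      unfolding dist sum_C_conv[OF S V_def, symmetric] sum_C_conv[OF S(1,3,2) V_def, symmetric]
      by (simp add: X_def pderivs_def mult_ac)
  qed
  have e4: "(\<Sum>\<^sub>*i j k l m n. X B m n [k, l] * X B l j [] * X B k i [] *
            (\<partial> [m] f * \<partial> [n, i, j] g - \<partial> [n, i, j] f * \<partial> [m] g)) = Dd f g - Dd g f"
  proof (subst Sum_any6[OF V(1)])
    fix i j k l m n assume *: "\<not> (i \<in> V \<and> j \<in> V \<and> k \<in> V \<and> l \<in> V \<and> m \<in> V \<and> n \<in> V)"
    show "X B m n [k, l] * X B l j [] * X B k i [] *
            (\<partial> [m] f * \<partial> [n, i, j] g - \<partial> [n, i, j] f * \<partial> [m] g) = 0"
    proof (cases "i \<in> S \<and> j \<in> S \<and> m \<in> S \<and> n \<in> S")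
      case T: True
      then have "pd k (pd l (xx m n)) = 0" using * SV clV by (intro pd2_outside[OF W]) auto
      then show ?thesis by (simp add: X_def pderivs_def)
    next
      case False
      then show ?thesis using o1[of m] o3[of n i j] by (auto simp: X_def pderivs_def)
    qed
  next
    show "(\<Sum>i\<in>V. \<Sum>j\<in>V. \<Sum>k\<in>V. \<Sum>l\<in>V. \<Sum>m\<in>V. \<Sum>n\<in>V. X B m n [k, l] * X B l j [] * X B k i [] *
            (\<partial> [m] f * \<partial> [n, i, j] g - \<partial> [n, i, j] f * \<partial> [m] g)) = Dd f g - Dd g f"
      unfolding dist sum_D_conv[OF S V_def, symmetric] sum_D_conv[OF S(1,3,2) V_def, symmetric]
      by (simp add: X_def pderivs_def mult_ac)
  qed
  have e5: "(\<Sum>\<^sub>*i j k l m n. X B i j [k] * X B k l [] * X B m n [] *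
            (\<partial> [j, l, m] f * \<partial> [i, n] g - \<partial> [i, n] f * \<partial> [j, l, m] g)) = Ff f g - Ff g f"
  proof (subst Sum_any6[OF V(1)])
    fix i j k l m n assume *: "\<not> (i \<in> V \<and> j \<in> V \<and> k \<in> V \<and> l \<in> V \<and> m \<in> V \<and> n \<in> V)"
    show "X B i j [k] * X B k l [] * X B m n [] *
            (\<partial> [j, l, m] f * \<partial> [i, n] g - \<partial> [i, n] f * \<partial> [j, l, m] g) = 0"
    proof (cases "i \<in> S \<and> j \<in> S \<and> l \<in> S \<and> m \<in> S \<and> n \<in> S")
      case T: True
      then have "pd k (xx i j) = 0" using * SV clV by (intro pderiv_outside[OF W]) auto
      then show ?thesis by (simp add: X_def pderivs_def)
    next
      case False
      then show ?thesis using o2[of i n] o3[of j l m] by (auto simp: X_def pderivs_def)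
    qed
  next
    show "(\<Sum>i\<in>V. \<Sum>j\<in>V. \<Sum>k\<in>V. \<Sum>l\<in>V. \<Sum>m\<in>V. \<Sum>n\<in>V. X B i j [k] * X B k l [] * X B m n [] *
            (\<partial> [j, l, m] f * \<partial> [i, n] g - \<partial> [i, n] f * \<partial> [j, l, m] g)) = Ff f g - Ff g f"
      unfolding dist sum_F_conv[OF S V_def, symmetric] sum_F_conv[OF S(1,3,2) V_def, symmetric]
      by (simp add: X_def pderivs_def mult_ac)
  qed
  show ?thesis unfolding star3_def e1 e2 e3 e4 e5 b3_def ..
qed

end

section \<open>Symbols of differential operators\<close>

text \<open>The commutator of \<open>T\<close> with multiplication by \<open>x_y\<close>. It lowers
  the order of a differential operator, so iterated commutators evaluated at 1 recover the
  coefficients of the operator up to factorials.\<close>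

definition ad :: "'i \<Rightarrow> (('i, 'a::field_char_0) mpoly \<Rightarrow> ('i, 'a) mpoly) \<Rightarrow> ('i, 'a) mpoly \<Rightarrow> ('i, 'a) mpoly" where
  "ad y T = (\<lambda>f. T (var y * f) - var y * T f)"

lemma ad_basic:
  "ad y (\<lambda>f. f) = (\<lambda>f. 0)"
  "ad y (\<lambda>f. F f + G f) = (\<lambda>f. ad y F f + ad y G f)"
  "ad y (\<lambda>f. F f - G f) = (\<lambda>f. ad y F f - ad y G f)"
  "ad y (\<lambda>f. - F f) = (\<lambda>f. - ad y F f)"
  "ad y (\<lambda>f. a * F f) = (\<lambda>f. a * ad y F f)"
  "ad y (\<lambda>f. F f * a) = (\<lambda>f. a * ad y F f)"
  "ad y (\<lambda>f. 0) = (\<lambda>f. 0)"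
  by (simp_all add: ad_def algebra_simps)

lemma D_applied:
  "D1 c (var y * f + g) = var y * D1 c f + c y * f + D1 c g"
  "D2 c2 (var y * f + g) = var y * D2 c2 f + D1 (\<lambda>i. c2 y i + c2 i y) f + D2 c2 g"
  "D3 c3 (var y * f + g) = var y * D3 c3 f + D2 (\<lambda>i j. c3 y i j + c3 i y j + c3 i j y) f + D3 c3 g"
  by (simp_all add: D_lin D1_var_mult D2_var_mult D3_var_mult)

lemma ad_D:
  "ad y (\<lambda>f. D1 c (F f)) = (\<lambda>f. D1 c (ad y F f) + c y * F f)"
  "ad y (\<lambda>f. D2 c2 (F f)) = (\<lambda>f. D2 c2 (ad y F f) + D1 (\<lambda>i. c2 y i + c2 i y) (F f))"
  "ad y (\<lambda>f. D3 c3 (F f)) = (\<lambda>f. D3 c3 (ad y F f) + D2 (\<lambda>i j. c3 y i j + c3 i y j + c3 i j y) (F f))"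
proof -
  have *: "F (var y * f) = var y * F f + ad y F f" for F :: "('a, 'b) mpoly \<Rightarrow> ('a, 'b) mpoly" and f
    by (simp add: ad_def)
  show "ad y (\<lambda>f. D1 c (F f)) = (\<lambda>f. D1 c (ad y F f) + c y * F f)"
    "ad y (\<lambda>f. D2 c2 (F f)) = (\<lambda>f. D2 c2 (ad y F f) + D1 (\<lambda>i. c2 y i + c2 i y) (F f))"
    "ad y (\<lambda>f. D3 c3 (F f)) = (\<lambda>f. D3 c3 (ad y F f) + D2 (\<lambda>i j. c3 y i j + c3 i y j + c3 i j y) (F f))"
    unfolding ad_def[of y "\<lambda>f. D1 c (F f)"] ad_def[of y "\<lambda>f. D2 c2 (F f)"] ad_def[of y "\<lambda>f. D3 c3 (F f)"] *[of F]
    by (simp_all add: D_applied fun_eq_iff)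
qed

text \<open>\<open>D1\<close>, \<open>D2\<close>, \<open>D3\<close> are linear over the algebra in
  their coefficients. Hence commutators can be taken in either argument of a bidifferential
  operator, also in the one that is hidden in the coefficients.\<close>

lemma ad_coeff:
  "ad y (\<lambda>f. D1 (\<lambda>i. C i f) u) = (\<lambda>f. D1 (\<lambda>i. ad y (C i) f) u)"
  "ad y (\<lambda>f. D2 (\<lambda>i j. C2 i j f) u) = (\<lambda>f. D2 (\<lambda>i j. ad y (C2 i j) f) u)"
  "ad y (\<lambda>f. D3 (\<lambda>i j k. C3 i j k f) u) = (\<lambda>f. D3 (\<lambda>i j k. ad y (C3 i j k) f) u)"
  by (simp_all add: ad_def D_coeff)

lemmas ad_rules = ad_basic ad_D ad_D[where F="\<lambda>f. f", simplified ad_basic D_lin add_0] ad_coeff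

lemma lin_ad: "lin T \<Longrightarrow> lin (ad y T)"
  unfolding ad_def by (rule lin_sub[OF lin_compose[OF _ lin_mult_left] lin_mult])

lemma lin_zero_by_ad:
  assumes T: "lin T" and "T 1 = 0" "\<And>y f. ad y T f = 0"
  shows "T f = 0"
  using assms(3) by (intro lin_eq0I[OF T assms(2)]) (simp add: ad_def)

context poisson
begin

lemma B_applied:
  "B (var y * f + g) h = var y * B f h + B (var y) h * f + B g h"
  "B h (var y * f + g) = var y * B h f + B h (var y) * f + B h g"
  by (simp_all add: B_lin mult_left mult_right)

lemma ad_B:
  "ad y (\<lambda>f. B u (F f)) = (\<lambda>f. B u (ad y F f) + B u (var y) * F f)"
  "ad y (\<lambda>f. B (F f) u) = (\<lambda>f. B (ad y F f) u + B (var y) u * F f)"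
  "ad y (B u) = (\<lambda>f. B u (var y) * f)"
proof -
  have *: "F (var y * f) = var y * F f + ad y F f" for F :: "('i, 'a) mpoly \<Rightarrow> ('i, 'a) mpoly" and f
    by (simp add: ad_def)
  show "ad y (\<lambda>f. B u (F f)) = (\<lambda>f. B u (ad y F f) + B u (var y) * F f)"
   "ad y (\<lambda>f. B (F f) u) = (\<lambda>f. B (ad y F f) u + B (var y) u * F f)"
    unfolding ad_def[of y "\<lambda>f. B u (F f)"] ad_def[of y "\<lambda>f. B (F f) u"] *[of F]
    by (simp_all add: B_applied fun_eq_iff)
  show "ad y (B u) = (\<lambda>f. B u (var y) * f)"
    by (simp add: ad_def mult_right mult_left fun_eq_iff)
qed

lemma D1_bracket: "D1 (\<lambda>i. B G (var i)) F = B G F"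
  by (subst antisym, subst antisym, subst (2) B_eq_D1) (simp add: D1_coeff)

lemma lin_H: "lin (\<lambda>F. H F a b)"
  unfolding H_def by (rule lin_D2)

lemma lin_Q: "lin (Q x)"
  unfolding Q_def by (rule lin_D2)

lemmas HQ_lin = lin_apply[OF lin_H] lin_apply[OF lin_Q] lin_numeral[OF lin_H] lin_numeral[OF lin_Q]

lemma Q_simps [simp]: "Q x 1 = 0" "Q x (var y) = 0"
  by (simp_all add: Q_def)

lemma ad_Q:
  "ad y (\<lambda>f. Q x (F f)) = (\<lambda>f. Q x (ad y F f) + D1 (\<lambda>i. B (xx x y) (var i) + B (xx x i) (var y)) (F f))"
  "ad y (Q x) = D1 (\<lambda>i. B (xx x y) (var i) + B (xx x i) (var y))"
  unfolding Q_def by (simp_all add: ad_rules)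

lemma H_sym: "H F a b = H F b a"
proof -
  have "H F a b - H F b a = 0"
    by (rule lin_zero_by_ad[where f=F], unfold H_def, intro lin_sub lin_D2, simp)
      (simp add: ad_rules D_coeff)
  then show ?thesis by simp
qed

text \<open>The Hamiltonian field of \<open>b\<close> acts on the sum of \<open>X_ia\<close> times
  the derivatives of \<open>F\<close>: on the derivatives it gives \<open>H\<close>, on the
  coefficients \<open>X_ia\<close> the first order sum. The proof compares commutators with
  variables.\<close>

lemma bracket_H: "B (B F (var a)) (var b) = H F a b + D1 (\<lambda>i. B (xx i a) (var b)) F"
proof -
  have "B (B F (var a)) (var b) - (H F a b + D1 (\<lambda>i. B (xx i a) (var b)) F) = 0"
  proof (rule lin_zero_by_ad[where f=F])
    show "lin (\<lambda>F. B (B F (var a)) (var b) - (H F a b + D1 (\<lambda>i. B (xx i a) (var b)) F))"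
      by (intro lin_sub lin_plus lin_compose[OF lin_left lin_left] lin_H lin_D1)
    show "ad y (\<lambda>F. B (B F (var a)) (var b) - (H F a b + D1 (\<lambda>i. B (xx i a) (var b)) F)) f = 0" for y f
    proof -
      have "D1 (\<lambda>i. xx i a * xx y b) f = xx y b * B f (var a)" "D1 (\<lambda>i. xx y a * xx i b) f = xx y a * B f (var b)"
        by (simp_all add: D1_coeff flip: B_eq_D1)
      then show ?thesis
        by (simp add: ad_rules ad_B H_def B_lin mult_left D1_coeff algebra_simps)
    qed
  qed (simp add: H_def B_lin)
  then show ?thesis by simp
qed

text \<open>Solved for the first order sums, so that rewriting removes these contractions from the
  symbols.\<close>

lemma D1_bracket_H:
  "D1 (\<lambda>i. B (xx i a) (var b)) F = B (B F (var a)) (var b) - H F a b"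
  "D1 (\<lambda>i. B (xx a i) (var b)) F = H F a b - B (B F (var a)) (var b)"
proof -
  show *: "D1 (\<lambda>i. B (xx i a) (var b)) F = B (B F (var a)) (var b) - H F a b"
    by (simp only: bracket_H[of F] add_diff_cancel_left')
  have "(\<lambda>i. B (xx a i) (var b)) = (\<lambda>i. - B (xx i a) (var b))"
    by (rule ext, subst antisym[of "var a"], rule B_lin)
  then show "D1 (\<lambda>i. B (xx a i) (var b)) F = H F a b - B (B F (var a)) (var b)"
    by (simp only: D1_coeff * minus_diff_eq)
qed

lemma H_fold: "D2 (\<lambda>k l. xx k a * xx l b) F = H F a b" "D2 (\<lambda>k l. xx l b * xx k a) F = H F a b"
  by (simp_all add: H_def mult.commute)

text \<open>\<^term>\<open>E3 x g h\<close> is 48 times the associator of \<open>(var x, g, h)\<close> in order three, and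
  \<^term>\<open>E2 x g h\<close> below is 24 times the one in order two. The lemma with suffix \<open>r_s\<close> says that the part of
  order \<open>r\<close> in \<open>g\<close> and \<open>s\<close> in \<open>h\<close> vanishes. After evaluation on variables, each of them is an
  identity between iterated brackets, which follows from antisymmetry and the Jacobi identity.\<close>

definition E3 where
  "E3 x g h = b3 (var x) g * h + ad x (\<lambda>f. b3 f h) g - b3 (var x) (g * h)
    + B (b2 (var x) g) h + b2 (B (var x) g) h - B (var x) (b2 g h) - b2 (var x) (B g h)"

lemmas b_defs = b2_def b3_def Aa_def Bb_def Cc_def Dd_def Ff_def Om_def

lemma numerals [simp]: "B f (numeral n) = 0" "B (numeral n) f = 0" for f
  using lin_numeral[OF lin_right, of f n 1] lin_numeral[OF lin_left[of f], of n 1] by simp_all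

lemma H_simps [simp]: "H 1 a b = 0" "H (var y) a b = 0"
  by (simp_all add: H_def)

lemmas symbol_simps = E3_def b_defs ad_rules ad_B ad_Q D_lin HQ_lin B_lin D_coeff
  D1_var_mult D2_var_mult D3_var_mult mult_left mult_right D1_bracket D1_bracket_H H_fold

lemma ad_H:
  "ad y (\<lambda>f. H (F f) a b) = (\<lambda>f. H (ad y F f) a b + xx y a * B (F f) (var b) + xx y b * B (F f) (var a))"
  "ad y (\<lambda>f. H f a b) = (\<lambda>f. xx y a * B f (var b) + xx y b * B f (var a))"
proof -
  have "D1 (\<lambda>i. xx i a * xx y b) f = xx y b * B f (var a)" "D1 (\<lambda>i. xx y a * xx i b) f = xx y a * B f (var b)" for f
    by (simp_all add: D1_coeff flip: B_eq_D1)
  then show "ad y (\<lambda>f. H (F f) a b) = (\<lambda>f. H (ad y F f) a b + xx y a * B (F f) (var b) + xx y b * B (F f) (var a))"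
   "ad y (\<lambda>f. H f a b) = (\<lambda>f. xx y a * B f (var b) + xx y b * B f (var a))"
    by (simp_all add: H_def ad_rules D1_coeff fun_eq_iff)
qed

text \<open>The Jacobi identity as a rewrite rule towards left-normed brackets. The two flips below
  move a fixed letter \<open>F\<close> to the innermost left place. The left-normed brackets that
  begin with a fixed letter form a basis of the multilinear Lie words, so afterwards only
  coefficients have to be compared. The flips are instantiated with explicit variables because in
  general form they apply to their own results.\<close>

lemma B_B: "B F (B f g) = B (B F f) g - B (B F g) f"
proof -
  have j: "B F (B f g) = - B f (B g F) - B g (B F f)"
    using jacobi[of F f g] by (simp add: algebra_simps eq_neg_iff_add_eq_0)
  have a: "B (B F f) g = - B g (B F f)" by (rule antisym)
  have b: "B (B F g) f = B f (B g F)"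
    by (simp only: antisym[of F g] antisym[of "- B g F" f] B_lin(1-3) minus_minus)
  show ?thesis unfolding j a b by simp
qed

lemma B_B_flip1: "B (B f g) F = B (B F g) f - B (B F f) g"
  using antisym[of "B f g" F] by (simp add: B_B)

lemma B_B_flip2: "B (B (B f g) h) F = B (B (B F h) f) g - B (B (B F h) g) f - B (B (B F f) g) h + B (B (B
  F g) f) h"
  using antisym[of "B (B f g) h" F] by (simp add: B_B B_lin)

lemma E3_symbol_1_1: "ad z (\<lambda>h. E3 x (var y) h) 1 = 0"
  by (simp add: symbol_simps ad_H antisym[of "var y" "var x"] antisym[of "var z" "var x"]
    antisym[of "var z" "var y"])

lemma E3_symbol_1_2: "ad w (ad z (\<lambda>h. E3 x (var y) h)) 1 = 0"
  apply (simp add: symbol_simps ad_H antisym[of "var y" "var x"] antisym[of "var z" "var x"]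
    antisym[of "var w" "var x"] antisym[of "var z" "var y"] antisym[of "var w" "var y"]
    antisym[of "var w" "var z"])
  by (simp add: B_B B_B_flip1[of "var y" "var z" "var x"] B_B_flip2[of "var y" "var z" "var w" "var x"]
    B_B_flip1[of "var y" "var w" "var x"] B_B_flip2[of "var y" "var w" "var z" "var x"]
    B_B_flip1[of "var z" "var w" "var x"] B_B_flip2[of "var z" "var w" "var y" "var x"]
   H_sym algebra_simps B_lin)

text \<open>Top order in \<open>h\<close>: this equation ends the induction on the order and is
  therefore stated for every \<open>h\<close> and not only at 1.\<close>

lemma E3_symbol_1_3: "ad v (ad w (ad z (\<lambda>h. E3 x (var y) h))) h = 0"
  apply (simp add: symbol_simps ad_H antisym[of "var y" "var x"] antisym[of "var z" "var x"]
    antisym[of "var w" "var x"] antisym[of "var v" "var x"] antisym[of "var z" "var y"]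
    antisym[of "var w" "var y"] antisym[of "var v" "var y"] antisym[of "var w" "var z"]
    antisym[of "var v" "var z"] antisym[of "var v" "var w"])
  by (simp add: B_B H_sym algebra_simps B_lin)

text \<open>The symbol of order two in \<open>g\<close>, evaluated at 1, is still an operator in
  \<open>h\<close>, whose own symbols are treated in this and the next three lemmas.\<close>

lemma E3_symbol_2_0: "ad z (ad y (\<lambda>g. E3 x g 1)) 1 = 0"
  by (simp add: symbol_simps)

lemma E3_symbol_2_1: "ad u (\<lambda>h. ad z (ad y (\<lambda>g. E3 x g h)) 1) 1 = 0"
  apply (simp add: symbol_simps ad_H B_eq_D1[symmetric] antisym[of "var y" "var x"]
    antisym[of "var z" "var x"] antisym[of "var u" "var x"] antisym[of "var z" "var y"]
    antisym[of "var u" "var y"] antisym[of "var u" "var z"])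
  by (simp add: B_B B_B_flip1[of "var y" "var z" "var x"] B_B_flip2[of "var y" "var z" "var u" "var x"]
    B_B_flip1[of "var y" "var u" "var x"] B_B_flip2[of "var y" "var u" "var z" "var x"]
    B_B_flip1[of "var z" "var u" "var x"] B_B_flip2[of "var z" "var u" "var y" "var x"]
   H_sym algebra_simps B_lin)

lemma E3_symbol_2_2: "ad v (ad u (\<lambda>h. ad z (ad y (\<lambda>g. E3 x g h)) 1)) 1 = 0"
  apply (simp add: symbol_simps ad_H B_eq_D1[symmetric] antisym[of "var y" "var x"]
    antisym[of "var z" "var x"] antisym[of "var u" "var x"] antisym[of "var v" "var x"]
    antisym[of "var z" "var y"] antisym[of "var u" "var y"] antisym[of "var v" "var y"]
    antisym[of "var u" "var z"] antisym[of "var v" "var z"] antisym[of "var v" "var u"])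
  by (simp add: B_B B_B_flip1[of "var y" "var z" "var x"] B_B_flip1[of "var y" "var u" "var x"]
    B_B_flip1[of "var y" "var v" "var x"] B_B_flip1[of "var z" "var u" "var x"]
    B_B_flip1[of "var z" "var v" "var x"] B_B_flip1[of "var u" "var v" "var x"] H_sym algebra_simps B_lin)

lemma E3_symbol_2_3: "ad w (ad v (ad u (\<lambda>h. ad z (ad y (\<lambda>g. E3 x g h)) 1))) h = 0"
  apply (simp add: symbol_simps ad_H B_eq_D1[symmetric] antisym[of "var y" "var x"]
    antisym[of "var z" "var x"] antisym[of "var u" "var x"] antisym[of "var v" "var x"]
    antisym[of "var w" "var x"] antisym[of "var z" "var y"] antisym[of "var u" "var y"]
    antisym[of "var v" "var y"] antisym[of "var w" "var y"] antisym[of "var u" "var z"]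
    antisym[of "var v" "var z"] antisym[of "var w" "var z"] antisym[of "var v" "var u"]
    antisym[of "var w" "var u"] antisym[of "var w" "var v"])
  by (simp add: B_B H_sym algebra_simps B_lin)

text \<open>Top order in \<open>g\<close>. Here the identity can be verified directly with
  \<open>h\<close> left arbitrary.\<close>

lemma E3_symbol_3: "ad w (ad z (ad y (\<lambda>g. E3 x g h))) f = 0"
  apply (simp add: symbol_simps ad_H B_eq_D1[symmetric] antisym[of "var y" "var x"]
    antisym[of "var z" "var x"] antisym[of "var w" "var x"] antisym[of "var z" "var y"]
    antisym[of "var w" "var y"] antisym[of "var w" "var z"])
  by (simp add: B_B H_sym algebra_simps B_lin)

lemma E3_one: "E3 x 1 h = 0"
  by (simp add: symbol_simps algebra_simps)

lemma E3_symbol_1_0: "E3 x (var y) 1 = 0"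
  by (simp add: symbol_simps algebra_simps)

text \<open>The factor 6 is 24 times the two factors 1/2 of \<open>star1\<close>. The term with
  \<open>ad\<close> unites \<open>b2 (x g) h\<close> and \<open>x * b2 g h\<close>.\<close>

definition E2 where
  "E2 x g h = b2 (var x) g * h + ad x (\<lambda>f. b2 f h) g - b2 (var x) (g * h)
    + 6 * (B (B (var x) g) h - B (var x) (B g h))"

lemma E2_symbol_0: "E2 x 1 h = 0" "E2 x (var y) 1 = 0" "ad z (ad y (\<lambda>g. E2 x g 1)) 1 = 0"
  by (simp_all add: E2_def symbol_simps algebra_simps)

lemma E2_symbol_1_1: "ad z (\<lambda>h. E2 x (var y) h) 1 = 0"
  apply (simp add: E2_def symbol_simps ad_H B_eq_D1[symmetric] antisym[of "var y" "var x"]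
    antisym[of "var z" "var x"] antisym[of "var z" "var y"])
  by (simp add: B_B B_B_flip1[of "var y" "var z" "var x"]
   H_sym algebra_simps B_lin)

lemma E2_symbol_1_2: "ad w (ad z (\<lambda>h. E2 x (var y) h)) h = 0"
  apply (simp add: E2_def symbol_simps ad_H B_eq_D1[symmetric] antisym[of "var y" "var x"]
    antisym[of "var z" "var x"] antisym[of "var w" "var x"] antisym[of "var z" "var y"]
    antisym[of "var w" "var y"] antisym[of "var w" "var z"])
  by (simp add: B_B H_sym algebra_simps B_lin)

lemma E2_symbol_2_1: "ad u (\<lambda>h. ad z (ad y (\<lambda>g. E2 x g h)) 1) h = 0"
  by (simp add: E2_def symbol_simps ad_H B_eq_D1[symmetric] antisym[of "var y" "var x"]
    antisym[of "var z" "var x"] antisym[of "var u" "var x"] antisym[of "var z" "var y"]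
    antisym[of "var u" "var y"] antisym[of "var u" "var z"])

lemma E2_symbol_3: "ad w (ad z (ad y (\<lambda>g. E2 x g h))) f = 0"
  apply (simp add: E2_def symbol_simps ad_H B_eq_D1[symmetric] antisym[of "var y" "var x"]
    antisym[of "var z" "var x"] antisym[of "var w" "var x"] antisym[of "var z" "var y"]
    antisym[of "var w" "var y"] antisym[of "var w" "var z"])
  by (simp add: B_B H_sym algebra_simps B_lin)

section \<open>Vanishing of the associators from the vanishing of their symbols\<close>

lemma lin_zero_by_ad3:
  assumes T: "lin T" and T0: "T 1 = 0" and T1: "\<And>y. ad y T 1 = 0" and T2: "\<And>y z. ad z (ad y T) 1 = 0"
    and T3: "\<And>y z w f. ad w (ad z (ad y T)) f = 0"
  shows "T f = 0"
proof (rule lin_zero_by_ad[OF T T0])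
  fix y f
  show "ad y T f = 0"
  proof (rule lin_zero_by_ad[OF lin_ad[OF T] T1])
    fix z f
    show "ad z (ad y T) f = 0"
      by (rule lin_zero_by_ad[OF lin_ad[OF lin_ad[OF T]] T2 T3])
  qed
qed

lemma lin_coeff:
  "(\<And>i. lin (C i)) \<Longrightarrow> lin (\<lambda>f. D1 (\<lambda>i. C i f) u)"
  "(\<And>i j. lin (C2 i j)) \<Longrightarrow> lin (\<lambda>f. D2 (\<lambda>i j. C2 i j f) u)"
  "(\<And>i j k. lin (C3 i j k)) \<Longrightarrow> lin (\<lambda>f. D3 (\<lambda>i j k. C3 i j k f) u)"
  by (simp_all add: lin_iff D_coeff) (simp_all add: scale_def D_coeff)

lemmas lin_intros = lin_plus lin_sub lin_mult lin_mult' lin_coeff lin_D1 lin_D2 lin_D3 lin_Q lin_ad lin_id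
  lin_compose[OF lin_D1] lin_compose[OF lin_D2] lin_compose[OF lin_D3] lin_compose[OF lin_Q]

lemma lin_b2: "lin (b2 f)" "lin (\<lambda>f. b2 f g)"
  unfolding b_defs by (intro lin_intros)+

lemma lin_b3: "lin (b3 f)" "lin (\<lambda>f. b3 f g)"
  unfolding b_defs by (intro lin_intros)+

lemma lin_E3: "lin (E3 x g)" "lin (\<lambda>g. E3 x g h)"
  unfolding E3_def ad_def
  by (intro lin_plus lin_sub lin_mult lin_mult' lin_b3 lin_right lin_left lin_mult_left lin_mult_right
      lin_compose[OF lin_b3(1) lin_mult_left] lin_compose[OF lin_b3(1) lin_mult_right] lin_compose[OF lin_b3(2) lin_mult_left]
      lin_compose[OF lin_b2(1) lin_right] lin_compose[OF lin_b2(1) lin_left] lin_compose[OF lin_b2(2) lin_right] lin_b2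
      lin_compose[OF lin_left lin_b2(1)] lin_compose[OF lin_right lin_b2(2)] lin_compose[OF lin_right lin_b2(1)])+

lemma lin_E2: "lin (E2 x g)" "lin (\<lambda>g. E2 x g h)"
  unfolding E2_def ad_def
  by (intro lin_plus lin_sub lin_mult lin_mult' lin_b2 lin_right lin_left lin_mult_left lin_mult_right
      lin_compose[OF lin_b2(1) lin_mult_left] lin_compose[OF lin_b2(1) lin_mult_right] lin_compose[OF lin_b2(2) lin_mult_left]
      lin_compose[OF lin_left lin_right] lin_compose[OF lin_right lin_right] lin_compose[OF lin_right lin_left])+

text \<open>A nested induction on orders: each symbol in \<open>g\<close> is shown to vanish as an
  operator in \<open>h\<close>, and these results are then combined to an induction in
  \<open>g\<close>.\<close>

lemma E3_zero: "E3 x g h = 0"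
proof -
  \<comment> \<open>Since \<open>E3 x 1 h\<close> is zero, the first order symbol in
    \<open>g\<close> at 1 is simply the value at \<open>var y\<close>.\<close>
  have 1: "E3 x (var y) h = 0" for y h
    by (rule lin_zero_by_ad3[OF lin_E3(1) E3_symbol_1_0 E3_symbol_1_1 E3_symbol_1_2 E3_symbol_1_3])
  have 2: "ad z (ad y (\<lambda>g. E3 x g h)) 1 = 0" for y z h
    by (rule lin_zero_by_ad3[OF _ E3_symbol_2_0 E3_symbol_2_1 E3_symbol_2_2 E3_symbol_2_3], unfold ad_def) (intro lin_sub lin_mult lin_E3(1))
  show ?thesis
    by (rule lin_zero_by_ad3[OF lin_E3(2) E3_one _ 2 E3_symbol_3]) (simp add: ad_def 1 E3_one)
qed

lemma E2_zero: "E2 x g h = 0"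
proof -
  have 1: "E2 x (var y) h = 0" for y h
    by (rule lin_zero_by_ad3[OF lin_E2(1) E2_symbol_0(2) E2_symbol_1_1]) (simp_all add: E2_symbol_1_2, simp add: ad_def E2_symbol_1_2[unfolded ad_def])
  have 2: "ad z (ad y (\<lambda>g. E2 x g h)) 1 = 0" for y z h
    by (rule lin_zero_by_ad[OF _ E2_symbol_0(3) E2_symbol_2_1], unfold ad_def) (intro lin_sub lin_mult lin_E2(1))
  show ?thesis
    by (rule lin_zero_by_ad3[OF lin_E2(2) E2_symbol_0(1) _ 2 E2_symbol_3]) (simp add: ad_def 1 E2_symbol_0)
qed

end

section \<open>Associators and obstructions\<close>

definition assoc :: "(nat \<Rightarrow> ('i, 'a::field_char_0) binop) \<Rightarrow> nat \<Rightarrow>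
    ('i, 'a) mpoly \<Rightarrow> ('i, 'a) mpoly \<Rightarrow> ('i, 'a) mpoly \<Rightarrow> ('i, 'a) mpoly" where
  "assoc ps n f g h = (\<Sum>a\<le>n. ps a (ps (n - a) f g) h - ps a f (ps (n - a) g h))"

definition obs :: "(nat \<Rightarrow> ('i, 'a::field_char_0) binop) \<Rightarrow> nat \<Rightarrow>
    ('i, 'a) mpoly \<Rightarrow> ('i, 'a) mpoly \<Rightarrow> ('i, 'a) mpoly \<Rightarrow> ('i, 'a) mpoly" where
  "obs ps n f g h = (\<Sum>a\<in>{1..<n}. ps a (ps (n - a) f g) h - ps a f (ps (n - a) g h))"

definition coboundary :: "('i, 'a::field_char_0) binop \<Rightarrow>
    ('i, 'a) mpoly \<Rightarrow> ('i, 'a) mpoly \<Rightarrow> ('i, 'a) mpoly \<Rightarrow> ('i, 'a) mpoly" where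
  "coboundary p f g h = f * p g h - p (f * g) h + p f (g * h) - p f g * h"

text \<open>The summands with index 0 and \<open>n\<close> are those that contain
  \<open>ps n\<close>, and they make up its negative Hochschild coboundary. Finding
  \<open>ps n\<close> is thus a cohomological problem for the earlier terms.\<close>

lemma assoc_eq_obs:
  assumes "ps 0 = (*)" "n > 0"
  shows "assoc ps n f g h = obs ps n f g h - coboundary (ps n) f g h"
proof -
  have "{..n} = insert 0 (insert n {1..<n})" using assms by auto
  then show ?thesis
    using assms by (simp add: assoc_def obs_def coboundary_def)
qed

lemma fps_X_power_dvd_iff: "fps_X ^ m dvd F \<longleftrightarrow> (\<forall>k<m. fps_nth F k = 0)"
  for F :: "'a::comm_ring_1 fps"
proof
  assume "\<forall>k<m. fps_nth F k = 0"
  then have "F = fps_X ^ m * fps_shift m F"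
    by (intro fps_ext) (simp add: fps_X_power_mult_nth)
  then show "fps_X ^ m dvd F" by (rule dvdI)
qed (auto simp: fps_X_power_mult_nth elim!: dvdE)

lemma bilinear_map_iff: "bilinear_map p \<longleftrightarrow> (\<forall>f. lin (p f)) \<and> (\<forall>g. lin (\<lambda>f. p f g))"
  by (simp add: bilinear_map_def)

lemma fps_unfold: "F = fps_const (fps_nth F 0) + fps_X * fps_shift 1 F"
  for F :: "'a::comm_ring_1 fps"
  by (rule fps_ext) (simp add: fps_nth_fps_const)

locale graded_product =
  fixes n :: nat and ps :: "nat \<Rightarrow> ('i, 'a::field_char_0) binop"
  assumes ps0: "ps 0 = (*)" and bil: "\<And>i. i \<le> n \<Longrightarrow> bilinear_map (ps i)"
begin

abbreviation mu where "mu \<equiv> deformed_product n ps"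

lemma lin1: "i \<le> n \<Longrightarrow> lin (ps i f)" and lin2: "i \<le> n \<Longrightarrow> lin (\<lambda>f. ps i f g)"
  using bil by (auto simp: bilinear_map_iff)

lemma mu_add: "mu (F + F') G = mu F G + mu F' G" "mu F (G + G') = mu F G + mu F G'"
  "mu (F - F') G = mu F G - mu F' G" "mu F (G - G') = mu F G - mu F G'"
proof -
  have *: "extend_fps (ps i) (F + F') G = extend_fps (ps i) F G + extend_fps (ps i) F' G"
    "extend_fps (ps i) F (G + G') = extend_fps (ps i) F G + extend_fps (ps i) F G'" 
    "extend_fps (ps i) (F - F') G = extend_fps (ps i) F G - extend_fps (ps i) F' G"
    "extend_fps (ps i) F (G - G') = extend_fps (ps i) F G - extend_fps (ps i) F G'" if "i \<le> n" for i
    by (rule fps_ext, simp add: extend_fps_def lin_add[OF lin1[OF that]] lin_add[OF lin2[OF that]]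
      lin_diff[OF lin1[OF that]] lin_diff[OF lin2[OF that]] sum.distrib sum_subtractf)+
  show "mu (F + F') G = mu F G + mu F' G" "mu F (G + G') = mu F G + mu F G'"
    "mu (F - F') G = mu F G - mu F' G" "mu F (G - G') = mu F G - mu F G'"
    by (simp_all add: deformed_product_def * ring_distribs sum.distrib sum_subtractf)
qed

lemma extend_X:
  assumes "i \<le> n"
  shows "extend_fps (ps i) (fps_X * F) G = fps_X * extend_fps (ps i) F G"
    "extend_fps (ps i) F (fps_X * G) = fps_X * extend_fps (ps i) F G"
proof -
  note z = lin_zero[OF lin1[OF assms]] lin_zero[OF lin2[OF assms]]
  show "extend_fps (ps i) (fps_X * F) G = fps_X * extend_fps (ps i) F G"
  proof (rule fps_ext)
    show "fps_nth (extend_fps (ps i) (fps_X * F) G) k = fps_nth (fps_X * extend_fps (ps i) F G) k" for k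
      by (cases k) (simp_all add: extend_fps_def z sum.atMost_Suc_shift del: sum.atMost_Suc)
  qed
  show "extend_fps (ps i) F (fps_X * G) = fps_X * extend_fps (ps i) F G"
  proof (rule fps_ext)
    fix k
    show "fps_nth (extend_fps (ps i) F (fps_X * G)) k = fps_nth (fps_X * extend_fps (ps i) F G) k"
    proof (cases k)
      case (Suc k')
      have "(\<Sum>j\<le>k'. ps i (fps_nth F j) (fps_nth (fps_X * G) (Suc k' - j))) = (\<Sum>j\<le>k'. ps i (fps_nth F j) (fps_nth G (k' - j)))"
        by (intro sum.cong) (simp_all add: Suc_diff_le)
      then show ?thesis by (simp add: Suc extend_fps_def z)
    qed (simp add: extend_fps_def z)
  qed
qed

lemma mu_X: "mu (fps_X * F) G = fps_X * mu F G" "mu F (fps_X * G) = fps_X * mu F G"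
  by (simp_all add: deformed_product_def extend_X sum_distrib_left mult.left_commute)

definition As where "As F G H = mu (mu F G) H - mu F (mu G H)"

lemma As_add: "As (F + F') G H = As F G H + As F' G H" "As F (G + G') H = As F G H + As F G' H"
  "As F G (H + H') = As F G H + As F G H'"
  by (simp_all add: As_def mu_add)

lemma As_X: "As (fps_X * F) G H = fps_X * As F G H" "As F (fps_X * G) H = fps_X * As F G H"
  "As F G (fps_X * H) = fps_X * As F G H"
  by (simp_all add: As_def mu_X right_diff_distrib)

lemma mu_nth:
  "fps_nth (mu F G) k = (\<Sum>i\<le>n. if k < i then 0 else fps_nth (extend_fps (ps i) F G) (k - i))"
  by (simp add: deformed_product_def fps_sum_nth fps_X_power_mult_nth)

lemma extend_const:
  assumes "i \<le> n"
  shows "fps_nth (extend_fps (ps i) F (fps_const h)) k = ps i (fps_nth F k) h"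
    "fps_nth (extend_fps (ps i) (fps_const f) G) k = ps i f (fps_nth G k)"
proof -
  note z = lin_zero[OF lin1[OF assms]] lin_zero[OF lin2[OF assms]]
  have "(\<Sum>j\<le>k. ps i (fps_nth F j) (fps_nth (fps_const h) (k - j))) = (\<Sum>j\<le>k. if j = k then ps i (fps_nth F j) h else 0)"
    by (intro sum.cong) (auto simp: z)
  then show "fps_nth (extend_fps (ps i) F (fps_const h)) k = ps i (fps_nth F k) h"
    by (simp add: extend_fps_def)
  have "(\<Sum>j\<le>k. ps i (fps_nth (fps_const f) j) (fps_nth G (k - j))) = (\<Sum>j\<le>k. if j = 0 then ps i f (fps_nth G k) else 0)"
    by (intro sum.cong) (auto simp: z)
  then show "fps_nth (extend_fps (ps i) (fps_const f) G) k = ps i f (fps_nth G k)"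
    by (simp add: extend_fps_def)
qed

lemma mu_const_nth:
  assumes "k \<le> n"
  shows "fps_nth (mu F (fps_const h)) k = (\<Sum>i\<le>k. ps i (fps_nth F (k - i)) h)"
    "fps_nth (mu (fps_const f) G) k = (\<Sum>i\<le>k. ps i f (fps_nth G (k - i)))"
proof -
  have "(\<Sum>i\<le>n. if k < i then 0 else t i) = (\<Sum>i\<le>k. t i)" for t :: "nat \<Rightarrow> ('i, 'a) mpoly"
    using assms by (intro sum.mono_neutral_cong_right) auto
  note * = this
  show "fps_nth (mu F (fps_const h)) k = (\<Sum>i\<le>k. ps i (fps_nth F (k - i)) h)"
    "fps_nth (mu (fps_const f) G) k = (\<Sum>i\<le>k. ps i f (fps_nth G (k - i)))"
    unfolding mu_nth * using assms by (auto intro!: sum.cong simp: extend_const)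
qed

lemma As_const_nth:
  assumes "k \<le> n"
  shows "fps_nth (As (fps_const f) (fps_const g) (fps_const h)) k = assoc ps k f g h"
proof -
  have *: "fps_nth (mu (fps_const f) (fps_const g)) j = ps j f g" if "j \<le> n" for f g j
  proof -
    have "(\<Sum>i\<le>j. ps i f (fps_nth (fps_const g) (j - i))) = (\<Sum>i\<le>j. if i = j then ps j f g else 0)"
      using that by (intro sum.cong) (auto simp: lin_zero[OF lin1])
    then show ?thesis by (simp add: mu_const_nth(2) that)
  qed
  show ?thesis
    using assms by (simp add: As_def mu_const_nth(1)[OF assms, of "mu (fps_const f) (fps_const g)"]
        mu_const_nth(2)[OF assms, of f "mu (fps_const g) (fps_const h)"] assoc_def * sum_subtractf)
qed

text \<open>Every argument is its constant term plus \<open>fps_X\<close> times a series. The second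
  part gains one power of \<open>fps_X\<close> over the induction hypothesis, and constants are
  governed by \<open>assoc\<close>.\<close>

lemma As_dvd:
  assumes "\<And>k f g h. k < m \<Longrightarrow> assoc ps k f g h = 0" "m \<le> Suc n"
  shows "fps_X ^ m dvd As F G H"
proof -
  have c: "fps_X ^ m dvd As (fps_const f) (fps_const g) (fps_const h)" for f g h
    unfolding fps_X_power_dvd_iff using assms by (auto simp: As_const_nth)
  have "j \<le> m \<Longrightarrow> fps_X ^ j dvd As F G H" for j
  proof (induction j arbitrary: F G H)
    case (Suc j)
    then have IH: "fps_X ^ j dvd As F G H" for F G H by simp
    have X: "fps_X ^ Suc j dvd fps_X * As F G H" for F G H
      using IH by (simp add: mult_dvd_mono)
    have "fps_X ^ Suc j dvd As (fps_const f) (fps_const g) (fps_const h)" for f g h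
      using Suc.prems by (intro dvd_trans[OF le_imp_power_dvd c])
    then have "fps_X ^ Suc j dvd As (fps_const f) (fps_const g) H" for f g H
      by (subst fps_unfold[of H]) (simp only: As_add As_X dvd_add X)
    then have "fps_X ^ Suc j dvd As (fps_const f) G H" for f G H
      by (subst fps_unfold[of G]) (simp only: As_add As_X dvd_add X)
    then show ?case
      by (subst fps_unfold[of F]) (simp only: As_add As_X dvd_add X)
  qed simp
  then show ?thesis by simp
qed

lemma deformation_iff: "deformation n ps \<longleftrightarrow> (\<forall>k\<le>n. \<forall>f g h. assoc ps k f g h = 0)"
proof
  assume "deformation n ps"
  then have "fps_X ^ Suc n dvd As F G H" for F G H
    by (simp add: deformation_def As_def)
  then show "\<forall>k\<le>n. \<forall>f g h. assoc ps k f g h = 0"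
    unfolding fps_X_power_dvd_iff using As_const_nth by (metis le_imp_less_Suc)
next
  assume "\<forall>k\<le>n. \<forall>f g h. assoc ps k f g h = 0"
  then have "fps_X ^ Suc n dvd As F G H" for F G H
    by (intro As_dvd) auto
  then show "deformation n ps"
    using ps0 bil by (simp add: deformation_def As_def)
qed

text \<open>The identity \<open>f (g, h, k) - (f g, h, k) + (f, g h, k) - (f, g, h k) + (f, g, h) k = 0\<close> for
  associators holds in every nonassociative ring.\<close>

lemma assoc_cocycle:
  assumes z: "\<And>k f g h. k < n \<Longrightarrow> assoc ps k f g h = 0" and n: "n > 0"
  shows "f * assoc ps n g h k - assoc ps n (f * g) h k + assoc ps n f (g * h) k - assoc ps n f g (h * k)
    + assoc ps n f g h * k = 0"
proof -
  let ?c = "fps_const :: ('i, 'a) mpoly \<Rightarrow> _"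
  have dvd: "fps_nth (As F G H) j = 0" if "j < n" for F G H j
    using As_dvd[OF z, of n F G H] that by (simp add: fps_X_power_dvd_iff)
  \<comment> \<open>The higher terms of the inner product carry a factor \<open>fps_X\<close>, so
    they meet only coefficients of the associator below \<open>n\<close>, which vanish.\<close>
  have m: "mu (?c f) (?c g) = ?c (f * g) + fps_X * fps_shift 1 (mu (?c f) (?c g))" for f g
    by (subst fps_unfold) (simp add: mu_const_nth ps0)
  have 1: "fps_nth (As (mu (?c f) (?c g)) (?c h) (?c k)) n = assoc ps n (f * g) h k"
    and 2: "fps_nth (As (?c f) (mu (?c g) (?c h)) (?c k)) n = assoc ps n f (g * h) k"
    and 3: "fps_nth (As (?c f) (?c g) (mu (?c h) (?c k))) n = assoc ps n f g (h * k)"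
    by (subst m, simp add: As_add As_X As_const_nth dvd n)+
  have 4: "fps_nth (mu (?c f) A) n = f * fps_nth A n" and 5: "fps_nth (mu A (?c f)) n = fps_nth A n * f"
    if "\<And>j. j < n \<Longrightarrow> fps_nth A j = 0" for f A
  proof -
    have "(\<Sum>i\<le>n. ps i f (fps_nth A (n - i))) = (\<Sum>i\<le>n. if i = 0 then f * fps_nth A n else 0)"
      "(\<Sum>i\<le>n. ps i (fps_nth A (n - i)) f) = (\<Sum>i\<le>n. if i = 0 then fps_nth A n * f else 0)"
      by (intro sum.cong refl, use that n in \<open>simp add: lin_zero[OF lin1] lin_zero[OF lin2] ps0\<close>)+
    then show "fps_nth (mu (?c f) A) n = f * fps_nth A n" "fps_nth (mu A (?c f)) n = fps_nth A n * f"
      by (simp_all add: mu_const_nth)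
  qed
  have "mu (?c f) (As (?c g) (?c h) (?c k)) - As (mu (?c f) (?c g)) (?c h) (?c k)
    + As (?c f) (mu (?c g) (?c h)) (?c k) - As (?c f) (?c g) (mu (?c h) (?c k))
    + mu (As (?c f) (?c g) (?c h)) (?c k) = 0"
    by (simp add: As_def mu_add)
  from this[THEN arg_cong[where f = "\<lambda>F. fps_nth F n"]] show ?thesis
    by (simp add: 1 2 3 4 5 dvd As_const_nth)
qed

end

text \<open>Only terms of order between 0 and \<open>n\<close> enter \<open>obs\<close>. With the
  term of order \<open>n\<close> replaced by zero, \<open>obs\<close> becomes an associator, and
  \<open>assoc_cocycle\<close> applies to it.\<close>

lemma obs_cocycle:
  assumes ps0: "ps 0 = (*)" and bil: "\<And>i. i < n \<Longrightarrow> bilinear_map (ps i)"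
    and z: "\<And>k f g h. k < n \<Longrightarrow> assoc ps k f g h = 0" and n: "n > 0"
  shows "f * obs ps n g h k - obs ps n (f * g) h k + obs ps n f (g * h) k - obs ps n f g (h * k)
    + obs ps n f g h * k = 0"
proof -
  define qs where "qs = ps(n := \<lambda>f g. 0)"
  have lt: "qs i = ps i" if "i < n" for i using that by (simp add: qs_def)
  interpret graded_product n qs
    using n bil by unfold_locales (auto simp: qs_def ps0 bilinear_map_iff lin_0)
  have a: "assoc qs k f g h = assoc ps k f g h" if "k < n" for k f g h
    using that by (auto simp: assoc_def lt intro!: sum.cong)
  have "obs qs n f g h = obs ps n f g h" for f g h
    by (auto simp: obs_def lt intro!: sum.cong)
  then have "assoc qs n f g h = obs ps n f g h" for f g h
    using assoc_eq_obs[of qs n f g h] ps0 n by (simp add: coboundary_def) (simp add: qs_def)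
  then show ?thesis
    using assoc_cocycle[of f g h k] n z by (simp add: a)
qed

section \<open>Three-cocycles with vanishing alternation are coboundaries\<close>

lemma keys_single_add: "Poly_Mapping.keys (Poly_Mapping.single i (1::nat) + m) = insert i (Poly_Mapping.keys m)"
  by (auto simp: in_keys_iff lookup_add lookup_single when_def split: if_splits)

abbreviation lb :: "'i::linorder \<Rightarrow> ('i \<Rightarrow>\<^sub>0 nat) \<Rightarrow> bool" where
  "lb y m \<equiv> \<forall>i\<in>Poly_Mapping.keys m. y \<le> i"

lemma obtain_min:
  assumes "m \<noteq> 0"
  obtains y m' where "m = Poly_Mapping.single y 1 + m'" "lb y m'" "y = Min (Poly_Mapping.keys m)"
    "m' = m - Poly_Mapping.single y 1"
proof -
  let ?y = "Min (Poly_Mapping.keys m)"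
  have "Poly_Mapping.keys m \<noteq> {}"
    using assms by (metis all_not_in_conv lookup_not_eq_zero_eq_in_keys lookup_zero poly_mapping_eqI)
  then have y: "?y \<in> Poly_Mapping.keys m" by simp
  have "lb ?y (m - Poly_Mapping.single ?y 1)"
    by (auto simp: in_keys_iff lookup_minus intro!: Min_le)
  with add_remove[OF y] show ?thesis by (intro that) auto
qed

lemma min_induct [case_names zero add]:
  fixes m :: "'i::linorder \<Rightarrow>\<^sub>0 nat"
  assumes "P 0" "\<And>y m. lb y m \<Longrightarrow> P m \<Longrightarrow> P (Poly_Mapping.single y 1 + m)"
  shows "P m"
proof (induction "deg m" arbitrary: m rule: less_induct)
  case less
  show ?case
  proof (cases "m = 0")
    case False
    then obtain y m' where m: "m = Poly_Mapping.single y 1 + m'" "lb y m'" "m' = m - Poly_Mapping.single y 1"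
      by (rule obtain_min)
    have "y \<in> Poly_Mapping.keys m" by (subst m(1)) (simp only: keys_single_add insert_iff simp_thms)
    then have "deg m' < deg m" unfolding m(3) by (rule deg_remove)
    then have "P m'" by (rule less)
    with m(2) show ?thesis by (subst m(1)) (rule assms(2))
  qed (use assms in simp)
qed

text \<open>The solution of \<open>Rec (x m) = x Rec m + s x m\<close>, where \<open>x\<close> is the smallest variable
  of the monomial \<open>x m\<close>.\<close>

function Rec :: "('i::linorder \<Rightarrow> ('i \<Rightarrow>\<^sub>0 nat) \<Rightarrow> ('i, 'a::field_char_0) mpoly) \<Rightarrow> ('i \<Rightarrow>\<^sub>0 nat) \<Rightarrow> ('i, 'a) mpoly" where
  "Rec s m = (if m = 0 then 0 else
     var (Min (Poly_Mapping.keys m)) * Rec s (m - Poly_Mapping.single (Min (Poly_Mapping.keys m)) 1)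
     + s (Min (Poly_Mapping.keys m)) (m - Poly_Mapping.single (Min (Poly_Mapping.keys m)) 1))"
  by auto
termination
proof (relation "measure (deg \<circ> snd)")
  fix s :: "'a::linorder \<Rightarrow> ('a \<Rightarrow>\<^sub>0 nat) \<Rightarrow> ('a, 'b::field_char_0) mpoly" and m :: "'a \<Rightarrow>\<^sub>0 nat" assume "m \<noteq> 0"
  then have "Min (Poly_Mapping.keys m) \<in> Poly_Mapping.keys m"
    by (intro Min_in finite_keys) (metis all_not_in_conv lookup_not_eq_zero_eq_in_keys lookup_zero poly_mapping_eqI)
  then show "((s, m - Poly_Mapping.single (Min (Poly_Mapping.keys m)) 1), s, m) \<in> measure (deg \<circ> snd)"
    using deg_remove by simp
qed simp

declare Rec.simps [simp del]

lemma Rec_0 [simp]: "Rec s 0 = 0"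
  by (simp add: Rec.simps)

lemma Rec_add:
  assumes "lb y m"
  shows "Rec s (Poly_Mapping.single y 1 + m) = var y * Rec s m + s y m"
proof -
  have "Min (Poly_Mapping.keys (Poly_Mapping.single y 1 + m)) = y"
    unfolding keys_single_add using assms by (intro Min_eqI) auto
  moreover have "Poly_Mapping.single y 1 + m \<noteq> 0"
    using keys_single_add[of y m] by force
  ultimately show ?thesis by (subst Rec.simps) simp
qed

lemma Rec_zero: "(\<And>y m. s y m = 0) \<Longrightarrow> Rec s m = 0"
  by (induction m rule: min_induct) (simp_all only: Rec_0 Rec_add mult_zero_right add_0_right)

lemma lin_Rec:
  assumes "\<And>y m. lin (s y m)"
  shows "lin (\<lambda>c. Rec (\<lambda>y m. s y m c) m)"
proof (induction m rule: min_induct)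
  case (add y m)
  then show ?case unfolding Rec_add[OF add(1)] by (intro lin_plus lin_mult assms)
qed (simp add: lin_0)

definition ext :: "(('i \<Rightarrow>\<^sub>0 nat) \<Rightarrow> ('i, 'a) mpoly) \<Rightarrow> ('i, 'a::field_char_0) mpoly \<Rightarrow> ('i, 'a) mpoly" where
  "ext \<phi> f = (\<Sum>m\<in>Poly_Mapping.keys f. scale (Poly_Mapping.lookup f m) (\<phi> m))"

lemma ext_superset:
  assumes "finite K" "Poly_Mapping.keys f \<subseteq> K"
  shows "ext \<phi> f = (\<Sum>m\<in>K. scale (Poly_Mapping.lookup f m) (\<phi> m))"
  unfolding ext_def using assms by (intro sum.mono_neutral_left) (auto simp: in_keys_iff)

lemma lin_ext: "lin (ext (\<phi> :: ('i \<Rightarrow>\<^sub>0 nat) \<Rightarrow> ('i, 'a::field_char_0) mpoly))"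
  unfolding lin_iff
proof safe
  fix f g :: "('i, 'a) mpoly"
  let ?K = "Poly_Mapping.keys f \<union> Poly_Mapping.keys g"
  have "Poly_Mapping.keys (f + g) \<subseteq> ?K" by (rule keys_add)
  then show "ext \<phi> (f + g) = ext \<phi> f + ext \<phi> g"
    by (simp add: ext_superset[of ?K] lookup_add scale_add_left sum.distrib)
next
  fix c :: 'a and f :: "('i, 'a) mpoly"
  have "Poly_Mapping.keys (scale c f) \<subseteq> Poly_Mapping.keys f"
    by (auto simp: in_keys_iff lookup_scale)
  then show "ext \<phi> (scale c f) = scale c (ext \<phi> f)"
    by (simp add: ext_superset[of "Poly_Mapping.keys f"] lookup_scale scale_sum)
qed

lemma ext_mon [simp]: "ext \<phi> (mon m) = \<phi> m"
  by (simp add: ext_def mon_def)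

lemma lin_ext_param:
  assumes "\<And>m. lin (\<phi> m)"
  shows "lin (\<lambda>c. ext (\<lambda>m. \<phi> m c) f)"
  unfolding lin_iff using assms
  by (simp add: ext_def lin_add lin_scale scale_add sum.distrib scale_sum mult.commute)

lemma mon_single_add: "mon (Poly_Mapping.single y 1 + m) = var y * mon m"
  by (simp only: mon_add mon_single)

text \<open>Vanishing at 1 is built into the notion because the recursions over monomials start
  there.\<close>

definition cocycle3 :: "(('i, 'a::field_char_0) mpoly \<Rightarrow> ('i, 'a) mpoly \<Rightarrow> ('i, 'a) mpoly \<Rightarrow> ('i, 'a) mpoly) \<Rightarrow> bool" where
  "cocycle3 \<omega> \<longleftrightarrow> (\<forall>f g. lin (\<omega> f g)) \<and> (\<forall>f h. lin (\<lambda>g. \<omega> f g h)) \<and> (\<forall>g h. lin (\<lambda>f. \<omega> f g h)) \<and>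
    (\<forall>g h. \<omega> 1 g h = 0) \<and> (\<forall>f h. \<omega> f 1 h = 0) \<and> (\<forall>f g. \<omega> f g 1 = 0) \<and>
    (\<forall>f g h k. f * \<omega> g h k - \<omega> (f * g) h k + \<omega> f (g * h) k - \<omega> f g (h * k) + \<omega> f g h * k = 0)"

definition normalized :: "('i, 'a::field_char_0) binop \<Rightarrow> bool" where
  "normalized p \<longleftrightarrow> bilinear_map p \<and> (\<forall>f. p 1 f = 0 \<and> p f 1 = 0)"

definition alt :: "(('i, 'a::field_char_0) mpoly \<Rightarrow> ('i, 'a) mpoly \<Rightarrow> ('i, 'a) mpoly \<Rightarrow> ('i, 'a) mpoly) \<Rightarrow> 'i \<Rightarrow> 'i \<Rightarrow> 'i \<Rightarrow> ('i, 'a) mpoly" where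
  "alt \<omega> x y z = \<omega> (var x) (var y) (var z) - \<omega> (var x) (var z) (var y) - \<omega> (var y) (var x) (var z)
     + \<omega> (var y) (var z) (var x) + \<omega> (var z) (var x) (var y) - \<omega> (var z) (var y) (var x)"

text \<open>The two terms with a product inside \<open>p\<close> cancel under a transposition, as
  the algebra is commutative; the two outer terms cancel each other after a cyclic
  permutation.\<close>

lemma alt_coboundary: "alt (coboundary p) x y z = 0"
  by (simp add: alt_def coboundary_def algebra_simps)

lemma alt_diff: "alt (\<lambda>f g h. u f g h - v f g h) x y z = alt u x y z - alt v x y z"
  by (simp add: alt_def)

lemma cocycle3_coboundary:
  assumes "normalized p"
  shows "cocycle3 (coboundary p)"
proof -
  have l1: "lin (p f)" and l2: "lin (\<lambda>f. p f g)" and n: "p 1 f = 0" "p f 1 = 0" for f g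
    using assms by (auto simp: normalized_def bilinear_map_iff)
  show ?thesis
    unfolding cocycle3_def
  proof (intro conjI allI)
    show "lin (coboundary p f g)" for f g
      unfolding coboundary_def[abs_def] by (intro lin_plus lin_sub lin_mult l1 l2 lin_mult_left lin_compose[OF l1 lin_mult_left])
    show "lin (\<lambda>g. coboundary p f g h)" for f h
      unfolding coboundary_def[abs_def]
      by (intro lin_plus lin_sub lin_mult lin_mult' l1 l2 lin_mult_left lin_compose[OF l1 lin_mult_right] lin_compose[OF l2 lin_mult_left])
    show "lin (\<lambda>f. coboundary p f g h)" for g h
      unfolding coboundary_def[abs_def]
      by (intro lin_plus lin_sub lin_mult lin_mult' l1 l2 lin_mult_right lin_compose[OF l2 lin_mult_right])
  qed (simp_all add: coboundary_def n lin_diff[OF l1] lin_add[OF l1] lin_diff[OF l2] lin_add[OF l2] algebra_simps)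
qed

lemma cocycle3_diff: "cocycle3 u \<Longrightarrow> cocycle3 v \<Longrightarrow> cocycle3 (\<lambda>f g h. u f g h - v f g h)"
  unfolding cocycle3_def
proof (intro conjI allI, goal_cases)
  case (7 f g h k)
  then have "(f * u g h k - u (f * g) h k + u f (g * h) k - u f g (h * k) + u f g h * k)
    - (f * v g h k - v (f * g) h k + v f (g * h) k - v f g (h * k) + v f g h * k) = 0"
    by (metis diff_zero)
  then show ?case by (simp add: algebra_simps)
qed (auto intro: lin_sub)

text \<open>The cochain is chosen such that the cocycle becomes zero on \<open>(x, m, c)\<close> for all monomials \<open>m\<close> without
  a variable smaller than \<open>x\<close>. The second step does the same for \<open>(x, y, m)\<close> when \<open>m\<close> has no variable
  smaller than \<open>y\<close>. What is left is determined by the values on \<open>(x, y, z)\<close> with \<open>x > y > z\<close>, and there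
  the other five terms of the alternation are zero.\<close>

lemma cocycle3_step1:
  fixes \<omega> :: "('i::linorder, 'a::field_char_0) mpoly \<Rightarrow> _"
  assumes w: "cocycle3 \<omega>"
  obtains p where "normalized p" "\<And>x m c. lb x m \<Longrightarrow> coboundary p (var x) (mon m) c = \<omega> (var x) (mon m) c"
proof -
  have l: "lin (\<omega> f g)" and n: "\<omega> f 1 h = 0" "\<omega> f g 1 = 0" for f g h
    using w by (auto simp: cocycle3_def)
  \<comment> \<open>If \<open>p\<close> vanishes on a variable in its first argument, the coboundary
    on (x, m, c) is \<open>x * p m c - p (x * m) c\<close>. The recursion solves this equation, and
    each monomial receives only one condition, as its smallest variable is unique.\<close>
  define p where "p f c = ext (\<lambda>m. Rec (\<lambda>y m. - \<omega> (var y) (mon m) c) m) f" for f c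
  have r: "p (var x * mon m) c = var x * p (mon m) c - \<omega> (var x) (mon m) c" if "lb x m" for x m c
    unfolding mon_single_add[symmetric] by (simp only: p_def ext_mon Rec_add[OF that] diff_conv_add_uminus)
  have x: "p (var x) c = 0" for x c
    using r[where x=x and m=0 and c=c] by (simp add: n p_def del: ext_mon) (simp add: ext_mon[where m=0, simplified])
  have "normalized p"
    unfolding normalized_def bilinear_map_iff
  proof (intro conjI allI)
    show "lin (p f)" for f
      unfolding p_def by (intro lin_ext_param lin_Rec lin_uminus l)
    show "lin (\<lambda>f. p f c)" for c
      unfolding p_def by (rule lin_ext)
    show "p 1 f = 0" for f
      unfolding p_def by (simp add: ext_mon[where m=0, simplified])
    show "p f 1 = 0" for f
      unfolding p_def by (simp add: n Rec_zero ext_def)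
  qed
  then show ?thesis
    by (rule that) (simp add: coboundary_def r x)
qed

lemma cocycle3_step2:
  fixes \<omega> :: "('i::linorder, 'a::field_char_0) mpoly \<Rightarrow> _"
  assumes w: "cocycle3 \<omega>" and P1: "\<And>x m c. lb x m \<Longrightarrow> \<omega> (var x) (mon m) c = 0"
  obtains p where "normalized p" "\<And>x m c. lb x m \<Longrightarrow> coboundary p (var x) (mon m) c = 0"
    "\<And>x y m. lb y m \<Longrightarrow> coboundary p (var x) (var y) (mon m) = \<omega> (var x) (var y) (mon m)"
proof -
  have n: "\<omega> f g 1 = 0" for f g
    using w by (auto simp: cocycle3_def)
  \<comment> \<open>\<open>\<phi> x\<close> will become \<open>p (var x)\<close>, integrated from
    the values on (x, y, m). By the first step it is zero on monomials without a variable smaller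
    than \<open>x\<close>.\<close>
  define \<phi> where "\<phi> x = ext (Rec (\<lambda>y m. \<omega> (var x) (var y) (mon m)))" for x
  have l: "lin (\<phi> x)" for x unfolding \<phi>_def by (rule lin_ext)
  have \<phi>1: "\<phi> x 1 = 0" for x by (simp add: \<phi>_def ext_mon[where m=0, simplified])
  have \<phi>r: "\<phi> x (var y * mon m) = var y * \<phi> x (mon m) + \<omega> (var x) (var y) (mon m)" if "lb y m" for x y m
    unfolding mon_single_add[symmetric] by (simp only: \<phi>_def ext_mon Rec_add[OF that])
  have \<phi>v: "\<phi> x (var y) = 0" for x y
    using \<phi>r[where y=y and m=0 and x=x] by (simp add: n \<phi>1)
  have P1v: "\<omega> (var x) (var y) c = 0" if "x \<le> y" for x y c
    using P1[where x=x and m="Poly_Mapping.single y 1" and c=c] that by (simp only: mon_single keys_single) simp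
  have \<phi>0: "\<phi> x (mon m) = 0" if "lb x m" for x m
    using that
  proof (induction m rule: min_induct)
    case (add y m)
    then show ?case
      by (simp only: mon_single_add \<phi>r keys_single_add) (simp add: P1v)
  qed (simp add: \<phi>1)
  \<comment> \<open>The extension to longer first arguments is the one for which the coboundary is
    zero on (x, m, c); this preserves what the first step has achieved.\<close>
  define p where "p f c = ext (\<lambda>m. Rec (\<lambda>x m. \<phi> x (mon m * c) - \<phi> x (mon m) * c) m) f" for f c
  have r: "p (var x * mon m) c = var x * p (mon m) c + (\<phi> x (mon m * c) - \<phi> x (mon m) * c)" if "lb x m" for x m c
    unfolding mon_single_add[symmetric] by (simp only: p_def ext_mon Rec_add[OF that])
  have p1: "p 1 f = 0" for f
    unfolding p_def by (simp add: ext_mon[where m=0, simplified])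
  have px: "p (var x) c = \<phi> x c" for x c
    using r[where x=x and m=0 and c=c] by (simp add: \<phi>1 p1)
  have "normalized p"
    unfolding normalized_def bilinear_map_iff
  proof (intro conjI allI p1)
    show "lin (p f)" for f
      unfolding p_def by (intro lin_ext_param lin_Rec lin_sub lin_compose[OF l lin_mult_left] lin_mult_left)
    show "lin (\<lambda>f. p f c)" for c
      unfolding p_def by (rule lin_ext)
    show "p f 1 = 0" for f
      unfolding p_def by (simp add: Rec_zero ext_def)
  qed
  moreover have c1: "coboundary p (var x) (mon m) c = 0" if "lb x m" for x m c
    using that by (simp add: coboundary_def r px)
  moreover have "coboundary p (var x) (var y) (mon m) = \<omega> (var x) (var y) (mon m)" if m: "lb y m" for x y m
  proof (cases "x \<le> y")
    case True
    then show ?thesis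
      using c1[where x=x and m="Poly_Mapping.single y 1" and c="mon m"] by (simp only: mon_single keys_single) (simp add: P1v)
  next
    case False
    \<comment> \<open>The product is expanded along its smaller variable \<open>y\<close>. What
      remains of the coboundary is \<open>\<phi> x (y * m) - y * \<phi> x m\<close>, which is the
      prescribed value.\<close>
    have "p (var y * var x) (mon m) = var y * \<phi> x (mon m) + (\<phi> y (var x * mon m) - \<phi> y (var x) * mon m)"
      using r[where x=y and m="Poly_Mapping.single x 1" and c="mon m"] False by (simp only: mon_single keys_single px) simp
    moreover have "\<phi> y (var x * mon m) = 0"
      using \<phi>0[where x=y and m="Poly_Mapping.single x 1 + m"] m False by (simp only: mon_single_add keys_single_add) simp
    ultimately show ?thesis
      using m by (simp add: coboundary_def px \<phi>v \<phi>0 \<phi>r mult.commute[of "var x" "var y"])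
  qed
  ultimately show ?thesis by (rule that)
qed

text \<open>The cocycle identity moves the smallest variable out of a product. Vanishing spreads
  from variables to the third argument, then to the second and at last to the first.\<close>

lemma cocycle3_zero:
  fixes \<omega> :: "('i::linorder, 'a::field_char_0) mpoly \<Rightarrow> _"
  assumes w: "cocycle3 \<omega>" and P1: "\<And>x m c. lb x m \<Longrightarrow> \<omega> (var x) (mon m) c = 0"
    and P2: "\<And>x y m. lb y m \<Longrightarrow> \<omega> (var x) (var y) (mon m) = 0"
    and P3: "\<And>x y z. z < y \<Longrightarrow> y < x \<Longrightarrow> alt \<omega> x y z = 0"
  shows "\<omega> f g h = 0"
proof -
  have lin: "lin (\<omega> f g)" "lin (\<lambda>g. \<omega> f g h)" "lin (\<lambda>f. \<omega> f g h)"
    and n: "\<omega> 1 g h = 0" "\<omega> f 1 h = 0" "\<omega> f g 1 = 0"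
    and cocycle: "f * \<omega> g h k - \<omega> (f * g) h k + \<omega> f (g * h) k - \<omega> f g (h * k) + \<omega> f g h * k = 0" for f g h k
    using w by (auto simp: cocycle3_def)
  have P1v: "\<omega> (var x) (var y) c = 0" if "x \<le> y" for x y c
    using P1[where x=x and m="Poly_Mapping.single y 1" and c=c] that by (simp only: mon_single keys_single) simp
  have P2v: "\<omega> (var x) (var y) (var z) = 0" if "y \<le> z" for x y z
    using P2[where y=y and m="Poly_Mapping.single z 1" and x=x] that by (simp only: mon_single keys_single) simp
  have var0: "\<omega> (var x) (var y) (var z) = 0" for x y z
  proof (cases "z < y \<and> y < x")
    case True
    then have "z \<le> y" "y \<le> x" "z \<le> x" by auto
    then show ?thesis
      using P3[of z y x] True by (simp add: alt_def P1v P2v)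
  qed (use P1v P2v in force)
  have R1: "\<omega> (var x * mon m) c d = var x * \<omega> (mon m) c d + \<omega> (var x) (mon m * c) d" if "lb x m" for x m c d
    using cocycle[of "var x" "mon m" c d] P1[OF that] by (simp add: algebra_simps)
  have R2: "\<omega> (var x) (var y * mon m) d = var y * \<omega> (var x) (mon m) d + \<omega> (var x) (var y) (mon m * d)"
    if "y < x" "lb y m" "\<And>d. \<omega> (var y) (var x * mon m) d = 0" "\<omega> (var x) (var y) (mon m) = 0" for x y m d
  proof -
    \<comment> \<open>Read with the smaller variable in front, the product falls under
      \<open>R1\<close>.\<close>
    have "\<omega> (var y * var x) (mon m) d = var y * \<omega> (var x) (mon m) d + \<omega> (var y) (var x * mon m) d"
      using R1[where x=y and m="Poly_Mapping.single x 1" and c="mon m" and d=d] that by (simp only: mon_single keys_single) simp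
    then show ?thesis
      using cocycle[of "var x" "var y" "mon m" d] P1[OF that(2)] that by (simp add: algebra_simps)
  qed
  have P1': "\<omega> (var y) (var x * mon m) d = 0" if "y \<le> x" "lb y m" for x y m d
    using P1[where x=y and m="Poly_Mapping.single x 1 + m" and c=d] that by (simp only: mon_single_add keys_single_add) simp
  have R2': "\<omega> (var x) (var y * mon m) d = var y * \<omega> (var x) (mon m) d + \<omega> (var x) (var y) (mon m * d)"
    if "y < x" "lb y m" for x y m d
    using that by (intro R2 P1' P2) auto
  have vv: "\<omega> (var x) (var y) (mon d) = 0" for x y d
  proof (induction d rule: min_induct)
    case (add z m)
    show ?case
    proof (cases "z < y \<and> y < x")
      case True
      then have zy: "z < y" and yx: "y < x" by auto
      have a: "\<omega> (var y) (var z) (mon m) = 0" by (rule P2[OF add(1)])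
      have R2v: "\<omega> (var u) (var z * var v) (mon m) = var z * \<omega> (var u) (var v) (mon m) + \<omega> (var u) (var z) (var v * mon m)"
        if "z < u" "z \<le> v" for u v
        using R2'[where y=z and x=u and m="Poly_Mapping.single v 1" and d="mon m"] that by (simp only: mon_single keys_single) simp
      have e: "\<omega> (var u) (var z) (var v * mon m) = 0" if "z \<le> v" for u v
        using P2[where y=z and m="Poly_Mapping.single v 1 + m" and x=u] add(1) that by (simp only: mon_single_add keys_single_add) simp
      have b: "\<omega> (var y * var x) (var z) (mon m) = 0"
        using R1[where x=y and m="Poly_Mapping.single x 1" and c="var z" and d="mon m"] yx zy R2v[of y x] P1v[of y x] e[of x y] P2[OF add(1)]
        by (simp only: mon_single keys_single) (simp add: mult.commute)
      have c: "\<omega> (var x) (var y * var z) (mon m) = var z * \<omega> (var x) (var y) (mon m)"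
        using R2v[of x y] zy yx e[of y x] by (simp add: mult.commute)
      \<comment> \<open>The cocycle identity on (x, y, z, m) now reduces to
        \<open>\<omega> x y (z * m) = z * \<omega> x y m\<close>, and the right-hand side is zero by
        induction.\<close>
      show ?thesis
        using cocycle[of "var x" "var y" "var z" "mon m"] a b c add.IH
        by (simp add: mon_single_add[unfolded One_nat_def] var0 mult.commute[of "var x" "var y"])
    next
      case False
      then consider "x \<le> y" | "y \<le> z" by force
      then show ?thesis
      proof cases
        case 2
        then show ?thesis using add(1) by (intro P2) (simp only: keys_single_add, force)
      qed (rule P1v)
    qed
  qed (simp add: n)
  have vv': "\<omega> (var x) (var y) d = 0" for x y d
    by (rule lin_eqI[OF lin(1) lin_0 vv])
  have v: "\<omega> (var x) (mon m) d = 0" for x m d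
  proof (induction m rule: min_induct)
    case (add y m)
    show ?case
    proof (cases "y < x")
      case True
      then show ?thesis using R2'[OF True add(1)] add.IH by (simp add: mon_single_add[unfolded One_nat_def] vv')
    next
      case False
      then show ?thesis using add(1) by (intro P1) (simp only: keys_single_add, force)
    qed
  qed (simp add: n)
  have v': "\<omega> (var x) c d = 0" for x c d
    by (rule lin_eqI[OF lin(2) lin_0 v])
  have "\<omega> (mon m) g h = 0" for m
    by (induction m rule: min_induct) (simp_all add: n R1 v' mon_single_add[unfolded One_nat_def])
  then show ?thesis
    by (rule lin_eqI[OF lin(3) lin_0])
qed

text \<open>A part of the Hochschild-Kostant-Rosenberg theorem in degree three, by explicit
  integration over any totally ordered set of variables. The alternation is not changed by the
  subtraction of coboundaries, so it is still zero after the two steps.\<close>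

theorem cocycle3_is_coboundary:
  fixes \<omega> :: "('i::linorder, 'a::field_char_0) mpoly \<Rightarrow> _"
  assumes w: "cocycle3 \<omega>" and alt: "\<And>x y z. z < y \<Longrightarrow> y < x \<Longrightarrow> alt \<omega> x y z = 0"
  obtains p where "normalized p" "\<And>f g h. coboundary p f g h = \<omega> f g h"
proof -
  obtain p1 where p1: "normalized p1" "\<And>x m c. lb x m \<Longrightarrow> coboundary p1 (var x) (mon m) c = \<omega> (var x) (mon m) c"
    by (rule cocycle3_step1[OF w]) blast
  define \<omega>1 where "\<omega>1 f g h = \<omega> f g h - coboundary p1 f g h" for f g h
  have w1: "cocycle3 \<omega>1" unfolding \<omega>1_def by (rule cocycle3_diff[OF w cocycle3_coboundary[OF p1(1)]])
  have P1: "\<omega>1 (var x) (mon m) c = 0" if "lb x m" for x m c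
    using p1(2)[OF that] by (simp add: \<omega>1_def)
  obtain p2 where p2: "normalized p2" "\<And>x m c. lb x m \<Longrightarrow> coboundary p2 (var x) (mon m) c = 0"
    "\<And>x y m. lb y m \<Longrightarrow> coboundary p2 (var x) (var y) (mon m) = \<omega>1 (var x) (var y) (mon m)"
    using cocycle3_step2[OF w1 P1] by blast
  define \<omega>2 where "\<omega>2 f g h = \<omega>1 f g h - coboundary p2 f g h" for f g h
  have w2: "cocycle3 \<omega>2" unfolding \<omega>2_def by (rule cocycle3_diff[OF w1 cocycle3_coboundary[OF p2(1)]])
  have "\<omega>2 f g h = 0" for f g h
  proof (rule cocycle3_zero[OF w2])
    show "alt \<omega>2 x y z = 0" if "z < y" "y < x" for x y z
      using alt[OF that] by (simp add: \<omega>2_def[abs_def] \<omega>1_def[abs_def] alt_diff alt_coboundary)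
  qed (simp_all add: \<omega>2_def P1 p2)
  then have "coboundary (\<lambda>f g. p1 f g + p2 f g) f g h = \<omega> f g h" for f g h
    by (simp add: \<omega>2_def \<omega>1_def coboundary_def algebra_simps)
  moreover have "normalized (\<lambda>f g. p1 f g + p2 f g)"
    using p1(1) p2(1) by (simp add: normalized_def bilinear_map_iff lin_plus)
  ultimately show ?thesis by (rule that[rotated])
qed

section \<open>The obstruction of order four\<close>

lemma scale_eq_0_iff: "c \<noteq> 0 \<Longrightarrow> scale c f = 0 \<longleftrightarrow> f = 0"
proof
  assume c: "c \<noteq> 0" and "scale c f = 0"
  then have "scale (inverse c) (scale c f) = scale (inverse c) 0" by (simp only:)
  with c show "f = 0" by simp
qed simp

lemma scale_numeral_mult: "scale c (numeral k * f) = scale (c * numeral k) f"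
  by (simp flip: scale_numeral)

lemmas scale_simps = scale_add scale_diff scale_minus scale_mult_left scale_mult_right scale_numeral_mult

lemma lin_sum_fun: "(\<And>a. a \<in> S \<Longrightarrow> lin (E a)) \<Longrightarrow> lin (\<lambda>f. \<Sum>a\<in>S. E a f)"
  by (simp add: lin_iff sum.distrib scale_sum)

text \<open>Once the terms with a variable in front vanish, the cocycle identity on (y, f, g, h)
  says that the associator commutes with multiplication of its first argument by
  \<open>y\<close>.\<close>

lemma (in graded_product) assoc_zero_by_vars:
  assumes z: "\<And>k f g h. k < n \<Longrightarrow> assoc ps k f g h = 0" and n: "n > 0"
    and one: "\<And>i f. 0 < i \<Longrightarrow> i \<le> n \<Longrightarrow> ps i 1 f = 0"
    and v: "\<And>x g h. assoc ps n (var x) g h = 0"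
  shows "assoc ps n f g h = 0"
proof (rule lin_eq0I[where f = f])
  show "lin (\<lambda>f. assoc ps n f g h)"
    unfolding assoc_def
    by (intro lin_sum_fun lin_sub lin_compose[OF lin2 lin2] lin2) auto
  show "assoc ps n (var y * f) g h = var y * assoc ps n f g h" for y f
    using assoc_cocycle[OF z n, of "var y" f g h] by (simp add: v)
  have "{..n} = insert 0 (insert n {1..<n})" using n by auto
  then show "assoc ps n 1 g h = 0"
    using n by (simp add: assoc_def one ps0 lin_zero[OF lin2])
qed

lemma cocycle3_obs:
  assumes ps0: "ps 0 = (*)" and norm: "\<And>i. 0 < i \<Longrightarrow> i < n \<Longrightarrow> normalized (ps i)"
    and z: "\<And>k f g h. k < n \<Longrightarrow> assoc ps k f g h = 0" and n: "n > 0"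
  shows "cocycle3 (obs ps n)"
proof -
  have bil: "bilinear_map (ps i)" if "i < n" for i
    using norm[of i] that ps0 by (cases "i = 0") (auto simp: normalized_def bilinear_map_iff lin_mult_left lin_mult_right)
  have l1: "lin (ps i f)" and l2: "lin (\<lambda>f. ps i f g)" if "i < n" for i f g
    using bil[OF that] by (auto simp: bilinear_map_iff)
  have one: "ps i 1 f = 0" "ps i f 1 = 0" if "0 < i" "i < n" for i f
    using norm[OF that] by (auto simp: normalized_def)
  have lt: "n - a < n" "a < n" if "a \<in> {1..<n}" for a using that by auto
  show ?thesis
    unfolding cocycle3_def
  proof (intro conjI allI)
    show "lin (obs ps n f g)" for f g
      unfolding obs_def[abs_def] by (intro lin_sum_fun lin_sub l1 lin_compose[OF l1 l1] lt)
    show "lin (\<lambda>g. obs ps n f g h)" for f h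
      unfolding obs_def[abs_def] by (intro lin_sum_fun lin_sub lin_compose[OF l2 l1] lin_compose[OF l1 l2] lt)
    show "lin (\<lambda>f. obs ps n f g h)" for g h
      unfolding obs_def[abs_def] by (intro lin_sum_fun lin_sub l2 lin_compose[OF l2 l2] lt)
    show "f * obs ps n g h k - obs ps n (f * g) h k + obs ps n f (g * h) k - obs ps n f g (h * k)
      + obs ps n f g h * k = 0" for f g h k
      by (rule obs_cocycle[OF ps0 bil z n])
  qed (auto simp: obs_def one lin_zero[OF l1] lin_zero[OF l2] intro!: sum.neutral)
qed

text \<open>Reversal interchanges the two kinds of summands, which gives the minus sign; the
  parities of the inner and the outer operation multiply to \<open>(-1) ^ n\<close>.\<close>

lemma obs_reverse:
  fixes ps :: "nat \<Rightarrow> ('i, 'b::field_char_0) binop"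
  assumes lin: "\<And>i f. 0 < i \<Longrightarrow> i < n \<Longrightarrow> lin (ps i f)"
    and par: "\<And>i f g. 0 < i \<Longrightarrow> i < n \<Longrightarrow> ps i g f = scale ((-1) ^ i) (ps i f g)"
  shows "obs ps n h g f = - scale ((-1) ^ n) (obs ps n f g h)"
proof -
  have "ps a (ps (n - a) h g) f - ps a h (ps (n - a) g f)
    = - scale ((-1) ^ n) (ps a (ps (n - a) f g) h - ps a f (ps (n - a) g h))" if a: "a \<in> {1..<n}" for a
  proof -
    have a': "0 < a" "a < n" "0 < n - a" "n - a < n" using a by auto
    have e: "ps (n - a) v u = scale ((-1) ^ (n - a)) (ps (n - a) u v)" for u v
      by (rule par[OF a'(3,4)])
    have d1: "ps a (scale s u) v = scale (s * (-1) ^ a) (ps a v u)" for s u v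
      using par[OF a'(1,2), of "scale s u" v] by (simp add: lin_scale[OF lin[OF a'(1,2)]] mult.commute)
    have d2: "ps a v (scale s u) = scale (s * (-1) ^ a) (ps a u v)" for s u v
    proof -
      have "ps a v u = scale ((-1) ^ a) (ps a u v)" by (rule par[OF a'(1,2)])
      then show ?thesis by (simp only: lin_scale[OF lin[OF a'(1,2)]] scale_scale)
    qed
    have p: "(-1) ^ (n - a) * (-1) ^ a = ((-1) ^ n :: 'b)"
      using a' by (simp flip: power_add)
    have 1: "ps a (ps (n - a) h g) f = scale ((-1) ^ n) (ps a f (ps (n - a) g h))"
      by (simp only: e[of h g] d1 p)
    have 2: "ps a h (ps (n - a) g f) = scale ((-1) ^ n) (ps a (ps (n - a) f g) h)"
      by (simp only: e[of g f] d2 p)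
    show ?thesis unfolding 1 2 by (simp add: scale_diff)
  qed
  then show ?thesis
    by (simp add: obs_def scale_sum sum_negf[symmetric])
qed

context poisson
begin

lemma star_terms_simps: "star_terms B 0 = (*)" "star_terms B (Suc 0) = star1 B"
  "star_terms B (Suc (Suc 0)) = star2 B" "star_terms B (Suc (Suc (Suc 0))) = star3 B"
  by (simp_all add: star_terms_def)

lemma b_one: "b2 1 g = 0" "b2 f 1 = 0" "b3 1 g = 0" "b3 f 1 = 0"
  by (simp_all add: b_defs D_coeff)

lemma normalized_star: "normalized (star1 B)" "normalized (star2 B)" "normalized (star3 B)"
proof -
  have "star1 B = (\<lambda>f g. scale (1/2) (B f g))" "star2 B = (\<lambda>f g. scale (1/24) (b2 f g))"
    "star3 B = (\<lambda>f g. scale (1/48) (b3 f g))"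
    by (intro ext, rule star1_eq star2_eq star3_eq)+
  then show "normalized (star1 B)" "normalized (star2 B)" "normalized (star3 B)"
    unfolding normalized_def bilinear_map_iff
    by (simp_all add: b_one lin_scaled lin_b2 lin_b3 lin_left lin_right)
qed

text \<open>Exchanging the arguments amounts to transposing the indices of every coefficient: two
  sign changes here, three for \<open>Bb\<close>.\<close>

lemma Om_sym: "Om f g = Om g f"
proof -
  define V where "V = vars f \<union> vars g"
  have V: "finite V" "vars f \<subseteq> V" "vars g \<subseteq> V" by (auto simp: V_def)
  have *: "Om f g = (\<Sum>i\<in>V. \<Sum>k\<in>V. \<Sum>j\<in>V. \<Sum>l\<in>V.
     xx i j * xx k l * (pd i (pd k f) * pd j (pd l g)))" if "vars f \<subseteq> V" "vars g \<subseteq> V" for f g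
    by (simp add: Om_def D_sums(2)[OF V(1)] that sum_distrib_left sum_distrib_right mult_ac)
  have xx2: "xx j i * xx l k * (p * q) = xx i j * xx k l * (q * p)" for i j k l p q
    by (subst antisym[of "var j"], subst antisym[of "var l"]) (simp add: mult.commute)
  show ?thesis
    unfolding *[OF V(2,3)] *[OF V(3,2)] sum_tuple4
    by (rule sum.reindex_bij_witness[of _ "\<lambda>(i,k,j,l). (j,l,i,k)" "\<lambda>(i,k,j,l). (j,l,i,k)"])
      (simp_all add: split_beta xx2 mem_Times_iff)
qed

lemma Bb_antisym: "Bb g f = - Bb f g"
proof -
  define V where "V = vars f \<union> vars g"
  have V: "finite V" "vars f \<subseteq> V" "vars g \<subseteq> V" by (auto simp: V_def)
  have xx3: "- (xx j i * xx l k * xx n m * (p * q)) = xx i j * xx k l * xx m n * (q * p)" for i j k l m n p q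
    by (subst antisym[of "var j"] , subst antisym[of "var l"] , subst antisym[of "var n"]) (simp add:
      mult.commute)
  show ?thesis
    unfolding sum_B_conv[OF V, symmetric] sum_B_conv[OF V(1,3,2), symmetric] sum_negf[symmetric] sum_tuple6
    by (rule sum.reindex_bij_witness[of _ "\<lambda>(i,j,k,l,m,n). (j,i,l,k,n,m)" "\<lambda>(i,j,k,l,m,n). (j,i,l,k,n,m)"])
      (simp_all add: split_beta xx3 mem_Times_iff del: mult_minus_left mult_minus_right)
qed

lemma b2_sym: "b2 g f = b2 f g"
  by (simp add: b2_def Om_sym[of g f] add.commute)

lemma b3_antisym: "b3 g f = - b3 f g"
  by (simp add: b3_def Bb_antisym[of g f])

lemma star_parity:
  assumes "0 < i" "i < 4"
  shows "star_terms B i g f = scale ((-1) ^ i) (star_terms B i f g)"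
proof -
  consider "i = 1" | "i = 2" | "i = 3" using assms by linarith
  then show ?thesis
  proof cases
    case 1
    then show ?thesis using antisym[of g f]
      by (simp add: star_terms_def star1_eq scale_left_minus scale_minus)
  next
    case 2
    then show ?thesis by (simp add: star_terms_def star2_eq b2_sym[of g f])
  next
    case 3
    then show ?thesis by (simp add: star_terms_def star3_eq b3_antisym[of g f] scale_left_minus scale_minus)
  qed
qed

lemma normalized_star_terms:
  assumes "0 < i" "i < 4"
  shows "normalized (star_terms B i)"
proof -
  consider "i = 1" | "i = 2" | "i = 3" using assms by linarith
  then show ?thesis by cases (simp_all add: star_terms_def normalized_star)
qed

lemma bilinear_star_terms: "bilinear_map (star_terms B i)"
proof (cases "0 < i \<and> i < 4")
  case True
  then show ?thesis using normalized_star_terms by (simp add: normalized_def)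
qed (auto simp: star_terms_def bilinear_map_iff lin_mult_left lin_mult_right lin_0)

lemma assoc_star:
  assumes "k < 4"
  shows "assoc (star_terms B) k f g h = 0"
proof -
  have one: "star_terms B i 1 f = 0" if "0 < i" "i < 4" for i f
    using normalized_star_terms[OF that] by (auto simp: normalized_def)
  have 0: "assoc (star_terms B) 0 f g h = 0" for f g h
    by (simp add: assoc_def star_terms_simps mult_ac)
  have 1: "assoc (star_terms B) 1 f g h = 0" for f g h
    by (simp add: assoc_def star_terms_simps star1_eq mult_left mult_right scale_add scale_mult_left scale_mult_right algebra_simps)
  have 2: "assoc (star_terms B) 2 f g h = 0" for f g h
  proof -
    interpret graded_product 2 "star_terms B"
      by unfold_locales (simp_all add: star_terms_simps bilinear_star_terms)
    show ?thesis
    proof (rule assoc_zero_by_vars)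
      show "assoc (star_terms B) k f g h = 0" if "k < 2" for k f g h
        using that 0 1 by (auto simp: less_2_cases_iff)
      show "assoc (star_terms B) 2 (var x) g h = 0" for x g h
      proof -
        have "assoc (star_terms B) 2 (var x) g h = scale (1/24) (E2 x g h)"
          by (simp add: assoc_def numeral_2_eq_2 star_terms_simps star1_eq star2_eq B_lin scale_simps E2_def ad_def)
        then show ?thesis by (simp add: E2_zero)
      qed
    qed (simp_all add: one)
  qed
  have 3: "assoc (star_terms B) 3 f g h = 0" for f g h
  proof -
    interpret graded_product 3 "star_terms B"
      by unfold_locales (simp_all add: star_terms_simps bilinear_star_terms)
    show ?thesis
    proof (rule assoc_zero_by_vars)
      show "assoc (star_terms B) k f g h = 0" if "k < 3" for k f g h
      proof -
        have "k = 0 \<or> k = 1 \<or> k = 2" using that by linarith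
        then show ?thesis by (elim disjE) (simp_all only: 0 1 2)
      qed
      show "assoc (star_terms B) 3 (var x) g h = 0" for x g h
      proof -
        have "assoc (star_terms B) 3 (var x) g h = scale (1/48) (E3 x g h)"
          by (simp add: assoc_def numeral_3_eq_3 star_terms_simps star1_eq star2_eq star3_eq B_lin
              lin_scale[OF lin_b2(1)] lin_scale[OF lin_b2(2)] scale_simps E3_def ad_def)
        then show ?thesis by (simp add: E3_zero)
      qed
    qed (simp_all add: one)
  qed
  have "k = 0 \<or> k = 1 \<or> k = 2 \<or> k = 3" using assms by linarith
  then show ?thesis by (elim disjE) (simp_all only: 0 1 2 3)
qed

section \<open>The alternating sum in order four\<close>

lemma sum_tuple5: "(\<Sum>i\<in>V. \<Sum>j\<in>V. \<Sum>k\<in>V. \<Sum>l\<in>V. \<Sum>m\<in>V. t i j k l m)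
   = (\<Sum>(i, j, k, l, m)\<in>V\<times>V\<times>V\<times>V\<times>V. t i j k l m)"
  by (simp add: sum.cartesian_product)

text \<open>The only derivative that falls on the variable fixes one index as
  \<open>\<gamma>\<close>. The names \<open>k\<close> and \<open>l\<close> are exchanged, and the
  signs of two antisymmetries cancel.\<close>

lemma obstruction_sum_A:
  assumes S: "finite S" "\<gamma> \<in> S" "vars F \<subseteq> S" and V: "V = cl (cl S)"
  shows "(\<Sum>i\<in>V. \<Sum>j\<in>V. \<Sum>k\<in>V. \<Sum>l\<in>V. \<Sum>m\<in>V. xx i j * pd i (xx k l) *
      (pd k (pd m F) * pd j (pd l (xx \<gamma> m)))) = Aa (var \<gamma>) F" (is "?L = _")
proof -
  have v: "vars (var \<gamma>) \<subseteq> S" by (rule subset_trans[OF vars_var]) (use S in simp)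
  have V': "finite V" "\<gamma> \<in> V" using S subset_cl(1)[of S] subset_cl(1)[of "cl S"] by (auto simp: V)
  have sgn: "pd i (xx k l) * (P * pd j (pd l' (xx \<gamma> m))) = pd i (xx l k) * pd j (pd l' (xx m \<gamma>)) * P" for i j k l l' m P
    by (subst antisym[of "var k"] , subst antisym[of "var \<gamma>"]) (simp add: lin_minus[OF
      lin_pderiv] mult_ac)
  have "Aa (var \<gamma>) F = (\<Sum>i\<in>V. \<Sum>j\<in>V. \<Sum>k\<in>V. \<Sum>l\<in>V. \<Sum>m\<in>V. xx i j * pd i (xx k l) * pd j (pd k (xx m \<gamma>)) * pd l (pd m F))"
    unfolding sum_A_conv[OF S(1) v S(3) V, symmetric]
    by (intro sum.cong refl) (use V' in \<open>simp add: pderiv_var_var if_distrib[of "\<lambda>x. x * _"] if_distrib[of "\<lambda>x. _ * x"] cong: if_cong\<close>)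
  also have "\<dots> = ?L"
    unfolding sum_tuple5
    by (rule sum.reindex_bij_witness[of _ "\<lambda>(i,j,k,l,m). (i,j,l,k,m)" "\<lambda>(i,j,k,l,m). (i,j,l,k,m)"])
      (simp_all add: split_beta mem_Times_iff mult.assoc sgn)
  finally show ?thesis by simp
qed

lemma obstruction_sum_D:
  assumes S: "finite S" "\<gamma> \<in> S" "vars F \<subseteq> S" and V: "V = cl (cl S)"
  shows "(\<Sum>i\<in>V. \<Sum>j\<in>V. \<Sum>k\<in>V. \<Sum>l\<in>V. \<Sum>m\<in>V. xx i j * xx k l *
      (pd i (pd k (pd m F)) * pd j (pd l (xx \<gamma> m)))) = Dd (var \<gamma>) F" (is "?L = _")
proof -
  have v: "vars (var \<gamma>) \<subseteq> S" by (rule subset_trans[OF vars_var]) (use S in simp)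
  have V': "finite V" "\<gamma> \<in> V" using S subset_cl(1)[of S] subset_cl(1)[of "cl S"] by (auto simp: V)
  have sgn: "xx i j * xx k l * (pd i (pd k (pd m F)) * P) = P * xx l k * xx j i * pd m (pd i (pd k F))" for i j k l m P
  proof -
    have "pd i (pd k (pd m F)) = pd m (pd i (pd k F))" by (subst pderiv_commute[of k m], rule pderiv_commute)
    then show ?thesis
      by (subst antisym[of "var i"], subst antisym[of "var k"]) (simp add: mult_ac)
  qed
  have "Dd (var \<gamma>) F = (\<Sum>i\<in>V. \<Sum>j\<in>V. \<Sum>k\<in>V. \<Sum>l\<in>V. \<Sum>n\<in>V. \<Sum>m\<in>V. pd k (pd l (xx m n)) * xx l j * xx k i *
       (pd m (var \<gamma>) * pd n (pd i (pd j F))))"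
    unfolding sum_D_conv[OF S(1) v S(3) V, symmetric] sum_tuple6
    by (rule sum.reindex_bij_witness[of _ "\<lambda>(i,j,k,l,n,m). (i,j,k,l,m,n)" "\<lambda>(i,j,k,l,m,n). (i,j,k,l,n,m)"])
      (simp_all add: split_beta mem_Times_iff)
  also have "\<dots> = (\<Sum>i\<in>V. \<Sum>j\<in>V. \<Sum>k\<in>V. \<Sum>l\<in>V. \<Sum>n\<in>V. pd k (pd l (xx \<gamma> n)) * xx l j * xx k i * pd n (pd i (pd j F)))"
    by (intro sum.cong refl) (use V' in \<open>simp add: pderiv_var_var if_distrib[of "\<lambda>x. x * _"] if_distrib[of "\<lambda>x. _ * x"] cong: if_cong\<close>)
  also have "\<dots> = ?L"
    unfolding sum_tuple5
    by (rule sum.reindex_bij_witness[of _ "\<lambda>(i,j,k,l,m). (i,k,j,l,m)" "\<lambda>(i,k,j,l,m). (i,j,k,l,m)"])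
      (simp_all add: split_beta mem_Times_iff sgn)
  finally show ?thesis by simp
qed

text \<open>Only those sums survive in which the variable is differentiated exactly once.\<close>

lemma b3_var: "b3 (var \<gamma>) F = 2 * Aa (var \<gamma>) F + Dd (var \<gamma>) F"
  by (simp add: b3_def Aa_def Bb_def Cc_def Dd_def Ff_def D_coeff)

lemma obstruction_eq:
  "obstruction B \<alpha> \<beta> \<gamma> = b3 (var \<gamma>) (xx \<alpha> \<beta>) + b3 (var \<alpha>) (xx \<beta> \<gamma>) + b3 (var \<beta>) (xx \<gamma> \<alpha>)"
proof -
  define S where "S = {\<alpha>, \<beta>, \<gamma>} \<union> vars (xx \<alpha> \<beta>) \<union> vars (xx \<beta> \<gamma>) \<union> vars (xx \<gamma> \<alpha>)"
  define V where "V = cl (cl S)"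
  have S: "finite S" "\<alpha> \<in> S" "\<beta> \<in> S" "\<gamma> \<in> S" "vars (xx \<alpha> \<beta>) \<subseteq> S" "vars (xx \<beta> \<gamma>) \<subseteq> S" "vars (xx \<gamma> \<alpha>) \<subseteq> S"
    by (auto simp: S_def)
  have V: "finite V" "S \<subseteq> V" "cl S \<subseteq> V"
    using S subset_cl(1)[of S] subset_cl(1)[of "cl S"] by (auto simp: V_def)
  have zA: "pd i (xx k l) * (pd k (pd m F) * pd j (pd l (xx c m))) = 0"
    if F: "vars F \<subseteq> S" and c: "c \<in> S" and n: "\<not> (i \<in> V \<and> j \<in> V \<and> k \<in> V \<and> l \<in> V \<and> m \<in> V)" for F c i j k l m
  proof (cases "k \<in> S \<and> m \<in> S")
    case km: True
    show ?thesis
    proof (cases "j \<in> cl S \<and> l \<in> cl S")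
      case True
      then have "i \<notin> V" using n km V by blast
      moreover have "vars (xx k l) \<subseteq> V" unfolding V_def using True km by (intro vars_cl) (auto simp: subset_cl)
      ultimately have "pd i (xx k l) = 0" by (intro pderiv_outside)
      then show ?thesis by simp
    next
      case False
      then have "pd j (pd l (xx c m)) = 0" using km c by (intro pd2_outside[OF vars_cl]) auto
      then show ?thesis by simp
    qed
  next
    case False
    then have "pd k (pd m F) = 0" by (intro pd2_outside[OF F]) auto
    then show ?thesis by simp
  qed
  have zD: "pd i (pd k (pd m F)) * pd j (pd l (xx c m)) = 0"
    if F: "vars F \<subseteq> S" and c: "c \<in> S" and n: "\<not> (i \<in> V \<and> j \<in> V \<and> k \<in> V \<and> l \<in> V \<and> m \<in> V)" for F c i j k l m
  proof (cases "i \<in> S \<and> k \<in> S \<and> m \<in> S")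
    case True
    then have "\<not> (j \<in> cl S \<and> l \<in> cl S)" using n V by blast
    then have "pd j (pd l (xx c m)) = 0" using True c by (intro pd2_outside[OF vars_cl]) auto
    then show ?thesis by simp
  next
    case False
    then have "pd i (pd k (pd m F)) = 0" by (intro pd3_outside[OF F]) auto
    then show ?thesis by simp
  qed
  have eA: "(\<Sum>\<^sub>*i j k l m. X B i j [] * X B k l [i] *
            (X B \<alpha> \<beta> [k, m] * X B \<gamma> m [j, l]
             + X B \<beta> \<gamma> [k, m] * X B \<alpha> m [j, l]
             + X B \<gamma> \<alpha> [k, m] * X B \<beta> m [j, l]))
    = Aa (var \<gamma>) (xx \<alpha> \<beta>) + Aa (var \<alpha>) (xx \<beta> \<gamma>) + Aa (var \<beta>) (xx \<gamma> \<alpha>)"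
  proof (subst Sum_any5[OF V(1)])
    fix i j k l m assume n: "\<not> (i \<in> V \<and> j \<in> V \<and> k \<in> V \<and> l \<in> V \<and> m \<in> V)"
    show "X B i j [] * X B k l [i] *
            (X B \<alpha> \<beta> [k, m] * X B \<gamma> m [j, l]
             + X B \<beta> \<gamma> [k, m] * X B \<alpha> m [j, l]
             + X B \<gamma> \<alpha> [k, m] * X B \<beta> m [j, l]) = 0"
      using zA[OF S(5,4) n] zA[OF S(6,2) n] zA[OF S(7,3) n]
      by (simp add: X_def pderivs_def distrib_left mult.assoc)
  next
    show "(\<Sum>i\<in>V. \<Sum>j\<in>V. \<Sum>k\<in>V. \<Sum>l\<in>V. \<Sum>m\<in>V. X B i j [] * X B k l [i] *
            (X B \<alpha> \<beta> [k, m] * X B \<gamma> m [j, l]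
             + X B \<beta> \<gamma> [k, m] * X B \<alpha> m [j, l]
             + X B \<gamma> \<alpha> [k, m] * X B \<beta> m [j, l]))
      = Aa (var \<gamma>) (xx \<alpha> \<beta>) + Aa (var \<alpha>) (xx \<beta> \<gamma>) + Aa (var \<beta>) (xx \<gamma> \<alpha>)"
      unfolding obstruction_sum_A[OF S(1,4,5) V_def, symmetric] obstruction_sum_A[OF S(1,2,6) V_def, symmetric]
        obstruction_sum_A[OF S(1,3,7) V_def, symmetric]
      by (simp only: X_def pderivs_def foldr_Cons foldr_Nil o_apply id_apply distrib_left sum.distrib)
  qed
  have eD: "(\<Sum>\<^sub>*i j k l m. X B i j [] * X B k l [] *
            (X B \<alpha> \<beta> [i, k, m] * X B \<gamma> m [j, l]
             + X B \<beta> \<gamma> [i, k, m] * X B \<alpha> m [j, l]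
             + X B \<gamma> \<alpha> [i, k, m] * X B \<beta> m [j, l]))
    = Dd (var \<gamma>) (xx \<alpha> \<beta>) + Dd (var \<alpha>) (xx \<beta> \<gamma>) + Dd (var \<beta>) (xx \<gamma> \<alpha>)"
  proof (subst Sum_any5[OF V(1)])
    fix i j k l m assume n: "\<not> (i \<in> V \<and> j \<in> V \<and> k \<in> V \<and> l \<in> V \<and> m \<in> V)"
    show "X B i j [] * X B k l [] *
            (X B \<alpha> \<beta> [i, k, m] * X B \<gamma> m [j, l]
             + X B \<beta> \<gamma> [i, k, m] * X B \<alpha> m [j, l]
             + X B \<gamma> \<alpha> [i, k, m] * X B \<beta> m [j, l]) = 0"
      using zD[OF S(5,4) n] zD[OF S(6,2) n] zD[OF S(7,3) n]
      by (simp add: X_def pderivs_def distrib_left)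
  next
    show "(\<Sum>i\<in>V. \<Sum>j\<in>V. \<Sum>k\<in>V. \<Sum>l\<in>V. \<Sum>m\<in>V. X B i j [] * X B k l [] *
            (X B \<alpha> \<beta> [i, k, m] * X B \<gamma> m [j, l]
             + X B \<beta> \<gamma> [i, k, m] * X B \<alpha> m [j, l]
             + X B \<gamma> \<alpha> [i, k, m] * X B \<beta> m [j, l]))
      = Dd (var \<gamma>) (xx \<alpha> \<beta>) + Dd (var \<alpha>) (xx \<beta> \<gamma>) + Dd (var \<beta>) (xx \<gamma> \<alpha>)"
      unfolding obstruction_sum_D[OF S(1,4,5) V_def, symmetric] obstruction_sum_D[OF S(1,2,6) V_def, symmetric]
        obstruction_sum_D[OF S(1,3,7) V_def, symmetric]
      by (simp only: X_def pderivs_def foldr_Cons foldr_Nil o_apply id_apply distrib_left sum.distrib)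
  qed
  show ?thesis
    unfolding obstruction_def eA eD b3_var by (simp add: algebra_simps)
qed

lemma b2_vars: "b2 (var x) (var y) = 0"
  by (simp add: b_defs D_coeff)

lemma b3_vars: "b3 (var x) (var y) = 0"
  by (simp add: b_defs D_coeff)

text \<open>The terms of order two and three vanish on pairs of variables, so the inner operation
  must be \<open>star1\<close> and the outer one \<open>star3\<close>; 96 is 2 times 48.\<close>

lemma obs_star4:
  "obs (star_terms B) 4 (var x) (var y) (var z) =
     - scale (1/96) (b3 (var z) (xx x y) + b3 (var x) (xx y z))"
proof -
  have "{1..<4::nat} = {1, 2, 3}" by auto
  then have "obs (star_terms B) 4 (var x) (var y) (var z) = scale (1/96) (b3 (xx x y) (var z) - b3 (var x) (xx y z))"
    by (simp add: obs_def star_terms_def star1_eq star2_eq star3_eq b2_vars b3_vars B_lin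
        lin_zero[OF lin_b2(1)] lin_zero[OF lin_b2(2)] lin_scale[OF lin_b3(1)] lin_scale[OF lin_b3(2)] scale_diff)
  then show ?thesis
    using b3_antisym[of "xx x y" "var z"] by (simp add: scale_diff scale_add scale_minus)
qed

lemma alt_obs_star4: "alt (obs (star_terms B) 4) x y z = - scale (1/24) (obstruction B x y z)"
proof -
  have neg: "b3 (var a) (xx c b) = - b3 (var a) (xx b c)" for a b c
    by (subst antisym) (rule lin_minus[OF lin_b3(1)])
  \<comment> \<open>Six permutations with two terms each make every one of the three terms of the
    obstruction occur four times.\<close>
  have "alt (obs (star_terms B) 4) x y z = - scale (1/96) (4 * obstruction B x y z)"
    unfolding alt_def obs_star4 obstruction_eq
    by (simp add: scale_simps neg[of _ y x] neg[of _ z y] neg[of _ x z] algebra_simps)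
  then show ?thesis by (simp add: scale_numeral_mult)
qed

end

section \<open>Necessity and sufficiency of the condition\<close>

lemma obs_cong: "(\<And>i. 0 < i \<Longrightarrow> i < n \<Longrightarrow> ps i = qs i) \<Longrightarrow> obs ps n = obs qs n"
  by (auto simp: obs_def fun_eq_iff intro!: sum.cong)

lemma assoc_cong: "(\<And>i. i \<le> n \<Longrightarrow> ps i = qs i) \<Longrightarrow> assoc ps n = assoc qs n"
  by (auto simp: assoc_def fun_eq_iff intro!: sum.cong)

lemma alt_swap: "alt \<omega> z y x = - alt \<omega> x y z"
  by (simp add: alt_def)

text \<open>Reversing three arguments is an odd permutation.\<close>

lemma alt_reversible: "(\<And>f g h. \<omega> h g f = \<omega> f g h) \<Longrightarrow> alt \<omega> x y z = 0"
  by (simp add: alt_def)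

text \<open>Whatever the fourth term of an extension is, its coboundary has alternation
  zero.\<close>

lemma obstruction_zero:
  assumes B: "poisson_bracket B" and ext: "extends_to_order 3 m (star_terms B)" and m: "4 \<le> m"
  shows "obstruction B x y z = 0"
proof -
  interpret poisson B by unfold_locales (rule B)
  obtain qs where qs: "\<And>i. i \<le> 3 \<Longrightarrow> qs i = star_terms B i" and def: "deformation m qs"
    using ext by (auto simp: extends_to_order_def)
  interpret graded_product m qs
    using def by unfold_locales (auto simp: deformation_def)
  have "assoc qs 4 f g h = 0" for f g h
    using def m by (simp add: deformation_iff)
  moreover have "obs qs 4 = obs (star_terms B) 4"
    by (rule obs_cong) (simp add: qs)
  ultimately have "obs (star_terms B) 4 f g h = coboundary (qs 4) f g h" for f g h
    using assoc_eq_obs[of qs 4 f g h] ps0 by simp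
  then have "obs (star_terms B) 4 = coboundary (qs 4)" by (simp add: fun_eq_iff)
  then have "scale (1/24) (obstruction B x y z) = 0"
    using alt_obs_star4[of x y z] by (simp add: alt_coboundary)
  then show ?thesis by (simp add: scale_eq_0_iff)
qed

lemma unobstructed_extends:
  fixes B :: "('i::linorder, 'a::field_char_0) binop"
  assumes B: "poisson_bracket B" and u: "unobstructed B"
  obtains qs where "\<And>i. i \<le> 3 \<Longrightarrow> qs i = star_terms B i" "deformation 4 qs" "deformation 5 qs"
proof -
  interpret poisson B by unfold_locales (rule B)
  let ?s = "star_terms B"
  have "cocycle3 (obs ?s 4)"
    by (rule cocycle3_obs) (simp_all add: star_terms_simps normalized_star_terms assoc_star)
  moreover have "alt (obs ?s 4) x y z = 0" if "z < y" "y < x" for x y z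
    using u that alt_swap[of "obs ?s 4" x y z] by (simp add: unobstructed_def alt_obs_star4)
  ultimately obtain p where p: "normalized p" "\<And>f g h. coboundary p f g h = obs ?s 4 f g h"
    using cocycle3_is_coboundary by blast
  \<comment> \<open>Reversal turns the cocycle of order four into its negative, and the coboundary
    of \<open>p\<close> into the negative coboundary of the opposite map. So the symmetrization of
    \<open>p\<close> solves the same equation, and it has the parity that the order five
    requires.\<close>
  define q where "q f g = scale (1/2) (p f g + p g f)" for f g
  have q_norm: "normalized q"
    using p(1) unfolding normalized_def bilinear_map_iff q_def by (simp add: lin_scaled lin_plus)
  have q_sym: "q g f = q f g" for f g by (simp add: q_def add.commute)
  have rev: "obs ?s 4 h g f = - obs ?s 4 f g h" for f g h
  proof -
    have "obs ?s 4 h g f = - scale ((-1) ^ 4) (obs ?s 4 f g h)"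
      by (rule obs_reverse[OF _ star_parity]) (use normalized_star_terms in \<open>auto simp: normalized_def bilinear_map_iff\<close>)
    then show ?thesis by simp
  qed
  have q: "coboundary q f g h = obs ?s 4 f g h" for f g h
  proof -
    have "coboundary q f g h = scale (1/2) (coboundary p f g h - coboundary p h g f)"
      unfolding coboundary_def q_def
      by (simp add: scale_simps mult_ac algebra_simps)
    also have "\<dots> = scale (1/2) (2 * obs ?s 4 f g h)"
      by (simp add: p(2) rev[of f g h])
    finally show ?thesis by (simp add: scale_numeral_mult)
  qed
  define r where "r = ?s(4 := q)"
  have r_norm: "normalized (r i)" if "0 < i" "i < 5" for i
    using normalized_star_terms[of i] q_norm that by (cases "i = 4") (auto simp: r_def)
  have r_assoc: "assoc r k f g h = 0" if "k < 5" for k f g h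
  proof (cases "k = 4")
    case True
    have "obs r 4 = obs ?s 4" by (rule obs_cong) (simp add: r_def)
    then show ?thesis
      using True assoc_eq_obs[of r 4 f g h] q by (simp add: r_def star_terms_simps)
  next
    case False
    then have "assoc r k = assoc ?s k" using that by (intro assoc_cong) (simp add: r_def)
    then show ?thesis using that False by (simp add: assoc_star)
  qed
  have "cocycle3 (obs r 5)"
    by (rule cocycle3_obs) (simp_all add: r_norm r_assoc, simp add: r_def star_terms_simps)
  moreover have "alt (obs r 5) x y z = 0" for x y z
  proof (rule alt_reversible)
    fix f g h
    have par: "r i g f = scale ((-1) ^ i) (r i f g)" if "0 < i" "i < 5" for i f g
      using star_parity[of i g f] q_sym[of g f] that by (cases "i = 4") (auto simp: r_def)
    have "obs r 5 h g f = - scale ((-1) ^ 5) (obs r 5 f g h)"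
      by (rule obs_reverse[OF _ par]) (use r_norm in \<open>auto simp: normalized_def bilinear_map_iff\<close>)
    then show "obs r 5 h g f = obs r 5 f g h" by (simp add: scale_left_minus)
  qed
  ultimately obtain p5 where p5: "normalized p5" "\<And>f g h. coboundary p5 f g h = obs r 5 f g h"
    using cocycle3_is_coboundary by blast
  \<comment> \<open>One sequence serves both orders, since order four reads only the terms up to
    four.\<close>
  define qs where "qs = r(5 := p5)"
  have qs_assoc: "assoc qs k f g h = 0" if "k < 6" for k f g h
  proof (cases "k = 5")
    case True
    have "obs qs 5 = obs r 5" by (rule obs_cong) (simp add: qs_def)
    then show ?thesis
      using True assoc_eq_obs[of qs 5 f g h] p5(2) by (simp add: qs_def r_def star_terms_simps)
  next
    case False
    then have "assoc qs k = assoc r k" using that by (intro assoc_cong) (simp add: qs_def)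
    then show ?thesis using that False by (simp add: r_assoc)
  qed
  have qs_bil: "bilinear_map (qs i)" for i
    using bilinear_star_terms[of i] q_norm p5(1) by (simp add: qs_def r_def normalized_def)
  have qs0: "qs 0 = (*)" by (simp add: qs_def r_def star_terms_simps)
  interpret d4: graded_product 4 qs by unfold_locales (simp_all add: qs0 qs_bil)
  interpret d5: graded_product 5 qs by unfold_locales (simp_all add: qs0 qs_bil)
  show ?thesis
    by (rule that[of qs]) (simp_all add: d4.deformation_iff d5.deformation_iff qs_assoc, simp add: qs_def r_def)
qed

section \<open>An obstructed Poisson algebra\<close>

definition DX :: "(nat, 'a::field_char_0) mpoly \<Rightarrow> (nat, 'a) mpoly" where
  "DX f = var 0 * (var 0 * pderiv_var 0 f)"

definition DY :: "(nat, 'a::field_char_0) mpoly \<Rightarrow> (nat, 'a) mpoly" where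
  "DY f = pderiv_var 1 f - var 1 * (var 1 * pderiv_var 2 f)"

text \<open>The wedge product of two derivations. They commute, which gives the Jacobi identity; all
  variables beyond the third are central. By the same commutation the exponential of h/2 (DX tensor
  DY - DY tensor DX) is a deformation to all orders, as for the Moyal product. So what fails to
  extend below are the given terms, not the bracket.\<close>

definition bracket_XY :: "(nat, 'a::field_char_0) binop" where
  "bracket_XY f g = DX f * DY g - DY f * DX g"

lemma DXY_derivations:
  "DX (f * g) = DX f * g + f * DX g" "DY (f * g) = DY f * g + f * DY g"
  "DX (f - g) = DX f - DX g" "DY (f - g) = DY f - DY g"
  by (simp_all add: DX_def DY_def pderiv_mult lin_diff[OF lin_pderiv] algebra_simps)

lemma DXY_commute: "DX (DY f) = DY (DX f)"
  by (simp add: DX_def DY_def pderiv_mult pderiv_var_var lin_diff[OF lin_pderiv] pderiv_commute[of 0] algebra_simps)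

lemma lin_DXY: "lin DX" "lin DY"
  unfolding DX_def[abs_def] DY_def[abs_def] by (intro lin_sub lin_mult lin_pderiv)+

lemma poisson_bracket_XY: "poisson_bracket bracket_XY"
  unfolding poisson_bracket_def biderivation_def bilinear_map_iff
proof (intro conjI allI)
  show "lin (bracket_XY f)" "lin (\<lambda>f. bracket_XY f g)" for f g
    unfolding bracket_XY_def[abs_def] by (intro lin_sub lin_mult lin_mult' lin_DXY)+
qed (simp_all add: bracket_XY_def DXY_derivations DXY_commute algebra_simps)

interpretation XY: poisson bracket_XY
  by unfold_locales (rule poisson_bracket_XY)

lemma XY_generators:
  "bracket_XY (var 0) (var 1) = var 0 * var 0" "bracket_XY (var 1) (var 0) = - (var 0 * var 0)"
  "bracket_XY (var 0) (var 2) = - (var 0 * (var 0 * (var 1 * var 1)))"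
  "bracket_XY (var 2) (var 0) = var 0 * (var 0 * (var 1 * var 1))"
  "bracket_XY (var 1) (var 2) = 0" "bracket_XY (var 2) (var 1) = 0"
  by (simp_all add: bracket_XY_def DX_def DY_def pderiv_var_var)

text \<open>As \<open>X_12\<close> is zero, two contributions remain: twice \<open>Aa\<close> on
  (x_2, x_0^2) gives 16 x_0^5, and \<open>Dd\<close> on (x_1, x_0^2 x_1^2) gives -8 x_0^5.\<close>

lemma obstruction_XY: "obstruction bracket_XY 0 1 2 = 8 * (var 0 * (var 0 * (var 0 * (var 0 * var 0))))"
  unfolding XY.obstruction_eq XY.b3_var XY.Aa_def XY.Dd_def XY_generators
  by (simp add: XY.Q_def XY.H_def XY_generators XY_generators[unfolded One_nat_def] D_lin D_coeff D1_var_mult D2_var_mult D3_var_mult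
      XY.B_lin XY.mult_left XY.mult_right algebra_simps)

lemma not_unobstructed_XY: "\<not> unobstructed (bracket_XY :: (nat, 'a::field_char_0) binop)"
proof -
  have "(var 0 :: (nat, 'a) mpoly) \<noteq> 0"
    using pderiv_var_var[of 0 "0 :: nat"] by (metis pderiv_0 zero_neq_one)
  then have "obstruction (bracket_XY :: (nat, 'a) binop) 0 1 2 \<noteq> 0"
    unfolding obstruction_XY by simp
  moreover have "(0::nat) < 1 \<and> (1::nat) < 2" by simp
  ultimately show ?thesis unfolding unobstructed_def by blast
qed

theorem theorem6p1:
  shows "(\<forall>B :: ('i::linorder, 'a::field_char_0) binop. poisson_bracket B \<longrightarrow>
            (extends_to_order 3 4 (star_terms B) \<longleftrightarrow> unobstructed B) \<and>
            (extends_to_order 3 5 (star_terms B) \<longleftrightarrow> unobstructed B))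
       \<and> (\<exists>B :: (nat, 'a) binop. poisson_bracket B \<and> \<not> unobstructed B)"
proof (intro conjI allI impI)
  fix B :: "('i, 'a) binop"
  assume B: "poisson_bracket B"
  have "unobstructed B" if "extends_to_order 3 m (star_terms B)" "4 \<le> m" for m
    using obstruction_zero[OF B that] by (simp add: unobstructed_def)
  moreover have "extends_to_order 3 4 (star_terms B) \<and> extends_to_order 3 5 (star_terms B)" if "unobstructed B"
    using unobstructed_extends[OF B that] unfolding extends_to_order_def by metis
  ultimately show "extends_to_order 3 4 (star_terms B) \<longleftrightarrow> unobstructed B"
    "extends_to_order 3 5 (star_terms B) \<longleftrightarrow> unobstructed B"
    by auto
next
  \<comment> \<open>The example has its own index type, because with fewer than three variables the
    condition is empty.\<close>
  show "\<exists>B :: (nat, 'a) binop. poisson_bracket B \<and> \<not> unobstructed B"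
    using poisson_bracket_XY not_unobstructed_XY by blast
qed

end
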